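(* Let $\overline{M}^{n+1}$ be a Riemannian manifold, let $N$ be a totally geodesic hypersurface of $\overline{M}$, and let $M^n=\mathbb{R}\times_fP^{n-1}$ be a warped product hypersurface in $\overline{M}$ with $\mathcal{H}'(t)\ge0$, where $\mathcal{H}(t)=f'(t)/f(t)$. Suppose that $M$ and $N$ are normal hypersurfaces such that $\Sigma^{n-1}=M\cap N$ is a complete parabolic submanifold of $\overline{M}$ with Ricci curvature bounded from below and with bounded height function $h\colon\Sigma\to\mathbb{R}$. Then $\Sigma$ is a totally geodesic slice of $M$.
   Context: Superscripts denote dimensions. $M^n=\mathbb{R}\times_fP^{n-1}$ is the manifold $\mathbb{R}\times P$ with the metric $dt^2+f(t)^2g_P$, where $(P,g_P)$ is a Riemannian manifold and $f\colon\mathbb{R}\to\mathbb{R}^+$ is smooth; it is isometrically immersed as a hypersurface in $\overline{M}$. The slices of $M$ are the hypersurfaces $\Sigma_t=\{t\}\times P$, $t\in\mathbb{R}$. For a hypersurface $\Sigma$ of $M$, its height function $h\colon\Sigma\to\mathbb{R}$ is $h(p)=\pi_{\mathbb{R}}(p)$, where $\pi_{\mathbb{R}}\colon M\to\mathbb{R}$ is the projection onto the first factor. Two submanifolds $M$ and $N$ of a Riemannian manifold $\overline{M}$ are called normal submanifolds (normal hypersurfaces, when both are hypersurfaces) if (a) $M\cap N$ is a submanifold of $\overline{M}$, and (b) $T_pM\cap T_p^\perp(M\cap N)\subset T_p^\perp N$ for all $p\in M\cap N$, where $\perp$ denotes normal spaces in $\overline{M}$. For hypersurfaces this is equivalent to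 their unit normals being orthogonal along $M\cap N$. A Riemannian manifold $\Sigma$ is parabolic if the only subharmonic functions on $\Sigma$ bounded from above are the constants: if $u\in C^2(\Sigma)$ satisfies $\Delta^\Sigma u\ge0$ and $\sup_\Sigma u<\infty$, then $u$ is constant, where $\Delta^\Sigma=\operatorname{tr}\operatorname{Hess}$. Completeness, parabolicity and the Ricci bound refer to the induced metric on $\Sigma$.
   Formalization: P is assumed connected: otherwise Σ can be a single component of a slice and the claim fails (parabolicity makes Σ connected). The degenerate case n = 1, where P is a point, is left out. *)

theory Defs
  imports "HOL-Analysis.Analysis"
begin

section \<open>Smooth maps between Euclidean spaces\<close>

text \<open>Only used for open \<open>S\<close>.\<close>

primrec Ck_on :: "nat \<Rightarrow> 'a::euclidean_space set \<Rightarrow> ('a \<Rightarrow> 'b::real_normed_vector) \<Rightarrow> bool" where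
  "Ck_on 0 S f \<longleftrightarrow> continuous_on S f"
| "Ck_on (Suc k) S f \<longleftrightarrow>
     (\<forall>x\<in>S. f differentiable (at x)) \<and> (\<forall>v. Ck_on k S (\<lambda>x. frechet_derivative f (at x) v))"

definition smooth_on :: "'a::euclidean_space set \<Rightarrow> ('a \<Rightarrow> 'b::real_normed_vector) \<Rightarrow> bool" where
  "smooth_on S f \<longleftrightarrow> (\<forall>k. Ck_on k S f)"

section \<open>Smooth manifolds\<close>

text \<open>The points of a manifold form a type, which carries the manifold topology; hence
  manifolds are nonempty. A smooth structure is given by a (not necessarily maximal) atlas.
  Manifolds have no boundary. They are not required to be connected.\<close>

type_synonym ('p, 'e) chart = "'p set \<times> ('p \<Rightarrow> 'e)"
type_synonym ('p, 'e) atlas = "('p, 'e) chart set"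

abbreviation dom :: "('p, 'e) chart \<Rightarrow> 'p set" where "dom \<equiv> fst"
abbreviation coord :: "('p, 'e) chart \<Rightarrow> 'p \<Rightarrow> 'e" where "coord \<equiv> snd"

definition coord_inv :: "('p, 'e) chart \<Rightarrow> 'e \<Rightarrow> 'p" where
  "coord_inv c = inv_into (dom c) (coord c)"

definition local_rep :: "('p, 'e) chart \<Rightarrow> ('q, 'd) chart \<Rightarrow> ('p \<Rightarrow> 'q) \<Rightarrow> 'e \<Rightarrow> 'd" where
  "local_rep c d F = coord d \<circ> F \<circ> coord_inv c"

definition smooth_atlas ::
  "('p::{t2_space,second_countable_topology}, 'e::euclidean_space) atlas \<Rightarrow> bool" where
  "smooth_atlas A \<longleftrightarrow>
     (\<forall>c\<in>A. open (dom c) \<and> open (coord c ` dom c) \<and>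
        homeomorphism (dom c) (coord c ` dom c) (coord c) (coord_inv c)) \<and>
     (\<Union>c\<in>A. dom c) = UNIV \<and>
     (\<forall>c\<in>A. \<forall>d\<in>A. smooth_on (coord c ` (dom c \<inter> dom d)) (local_rep c d (\<lambda>p. p)))"

definition smooth_map :: "('p::topological_space, 'e::euclidean_space) atlas \<Rightarrow>
    ('q::topological_space, 'd::euclidean_space) atlas \<Rightarrow> ('p \<Rightarrow> 'q) \<Rightarrow> bool" where
  "smooth_map A B F \<longleftrightarrow> continuous_on UNIV F \<and>
     (\<forall>c\<in>A. \<forall>d\<in>B. smooth_on (coord c ` (dom c \<inter> F -` dom d)) (local_rep c d F))"

text \<open>Tangent vectors at \<open>p\<close> are represented by their components with respect to a chart
  around \<open>p\<close>. The differential of \<open>F\<close> at \<open>p\<close> with respect to charts \<open>c\<close> around \<open>p\<close> and \<open>d\<close>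
  around \<open>F p\<close>; for \<open>F = (\<lambda>p. p)\<close> it is the change of components from \<open>c\<close> to \<open>d\<close>.\<close>

definition differential :: "('p, 'e::euclidean_space) chart \<Rightarrow> ('q, 'd::euclidean_space) chart \<Rightarrow>
    ('p \<Rightarrow> 'q) \<Rightarrow> 'p \<Rightarrow> 'e \<Rightarrow> 'd" where
  "differential c d F p = frechet_derivative (local_rep c d F) (at (coord c p))"

definition immersion :: "('p::topological_space, 'e::euclidean_space) atlas \<Rightarrow>
    ('q::topological_space, 'd::euclidean_space) atlas \<Rightarrow> ('p \<Rightarrow> 'q) \<Rightarrow> bool" where
  "immersion A B F \<longleftrightarrow> smooth_map A B F \<and>
     (\<forall>c\<in>A. \<forall>d\<in>B. \<forall>p \<in> dom c \<inter> F -` dom d. inj (differential c d F p))"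

section \<open>Riemannian metrics\<close>

text \<open>\<open>g c p v w\<close> is the inner product of the tangent vectors at \<open>p\<close> with components \<open>v\<close>, \<open>w\<close>
  with respect to the chart \<open>c\<close>. It is relevant only for charts \<open>c\<close> of the atlas and
  \<open>p \<in> dom c\<close>.\<close>

type_synonym ('p, 'e) metric = "('p, 'e) chart \<Rightarrow> 'p \<Rightarrow> 'e \<Rightarrow> 'e \<Rightarrow> real"

definition riemannian_metric ::
  "('p, 'e::euclidean_space) atlas \<Rightarrow> ('p, 'e) metric \<Rightarrow> bool" where
  "riemannian_metric A g \<longleftrightarrow>
     (\<forall>c\<in>A. \<forall>p \<in> dom c. bilinear (g c p) \<and> (\<forall>v w. g c p v w = g c p w v) \<and>
        (\<forall>v. v \<noteq> 0 \<longrightarrow> g c p v v > 0)) \<and>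
     (\<forall>c\<in>A. \<forall>v w. smooth_on (coord c ` dom c) (\<lambda>y. g c (coord_inv c y) v w)) \<and>
     (\<forall>c\<in>A. \<forall>d\<in>A. \<forall>p \<in> dom c \<inter> dom d. \<forall>v w.
        g c p v w = g d p (differential c d (\<lambda>p. p) p v) (differential c d (\<lambda>p. p) p w))"

definition riemannian_manifold ::
  "('p::{t2_space,second_countable_topology}, 'e::euclidean_space) atlas \<Rightarrow> ('p, 'e) metric \<Rightarrow> bool"
  where "riemannian_manifold A g \<longleftrightarrow> smooth_atlas A \<and> riemannian_metric A g"

definition isometric_immersion ::
  "('p::topological_space, 'e::euclidean_space) atlas \<Rightarrow> ('p, 'e) metric \<Rightarrow>
   ('q::topological_space, 'd::euclidean_space) atlas \<Rightarrow> ('q, 'd) metric \<Rightarrow> ('p \<Rightarrow> 'q) \<Rightarrow> bool" where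
  "isometric_immersion A g B h F \<longleftrightarrow> immersion A B F \<and>
     (\<forall>c\<in>A. \<forall>d\<in>B. \<forall>p \<in> dom c \<inter> F -` dom d. \<forall>v w.
        g c p v w = h d (F p) (differential c d F p v) (differential c d F p w))"

section \<open>Levi-Civita connection, Hessian, Laplacian, Ricci curvature\<close>

text \<open>The vector \<open>u\<close> with \<open>G u z = \<phi> z\<close> for all \<open>z\<close>, for an inner product \<open>G\<close> and linear \<open>\<phi>\<close>.\<close>

definition sharp :: "('e \<Rightarrow> 'e \<Rightarrow> real) \<Rightarrow> ('e \<Rightarrow> real) \<Rightarrow> 'e" where
  "sharp G \<phi> = (THE u. \<forall>z. G u z = \<phi> z)"

definition endo_trace :: "('e::euclidean_space \<Rightarrow> 'e) \<Rightarrow> real" where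
  "endo_trace T = (\<Sum>b\<in>Basis. T b \<bullet> b)"

text \<open>The trace with respect to \<open>G\<close> of the bilinear form \<open>B\<close>, i.e. the trace of the
  endomorphism \<open>T\<close> with \<open>G (T v) z = B v z\<close>.\<close>

definition metric_trace ::
  "('e::euclidean_space \<Rightarrow> 'e \<Rightarrow> real) \<Rightarrow> ('e \<Rightarrow> 'e \<Rightarrow> real) \<Rightarrow> real" where
  "metric_trace G B = endo_trace (\<lambda>v. sharp G (B v))"

text \<open>The derivative at \<open>p\<close> in direction \<open>v\<close> of a function of the points, read in the chart \<open>c\<close>.\<close>

definition dir_deriv :: "('p, 'e::euclidean_space) chart \<Rightarrow> ('p \<Rightarrow> 'b::real_normed_vector) \<Rightarrow>
    'p \<Rightarrow> 'e \<Rightarrow> 'b" where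
  "dir_deriv c u p v = frechet_derivative (u \<circ> coord_inv c) (at (coord c p)) v"

text \<open>\<open>christoffel g c p v w\<close> is the covariant derivative at \<open>p\<close>, in direction \<open>v\<close>, of the
  vector field with constant components \<open>w\<close> (Koszul formula); its components for basis vectors
  \<open>v\<close>, \<open>w\<close> are the Christoffel symbols.\<close>

definition christoffel ::
  "('p, 'e::euclidean_space) metric \<Rightarrow> ('p, 'e) chart \<Rightarrow> 'p \<Rightarrow> 'e \<Rightarrow> 'e \<Rightarrow> 'e" where
  "christoffel g c p v w = sharp (g c p)
     (\<lambda>z. (dir_deriv c (\<lambda>q. g c q w z) p v + dir_deriv c (\<lambda>q. g c q v z) p w
           - dir_deriv c (\<lambda>q. g c q v w) p z) / 2)"

definition hessian ::
  "('p, 'e::euclidean_space) metric \<Rightarrow> ('p, 'e) chart \<Rightarrow> ('p \<Rightarrow> real) \<Rightarrow> 'p \<Rightarrow> 'e \<Rightarrow> 'e \<Rightarrow> real" where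
  "hessian g c u p v w =
     dir_deriv c (\<lambda>q. dir_deriv c u q w) p v - dir_deriv c u p (christoffel g c p v w)"

definition laplacian ::
  "('p, 'e::euclidean_space) metric \<Rightarrow> ('p, 'e) chart \<Rightarrow> ('p \<Rightarrow> real) \<Rightarrow> 'p \<Rightarrow> real" where
  "laplacian g c u p = metric_trace (g c p) (hessian g c u p)"

text \<open>\<open>R(X,Y)Z = \<nabla>\<^sub>X \<nabla>\<^sub>Y Z - \<nabla>\<^sub>Y \<nabla>\<^sub>X Z - \<nabla>\<^bsub>[X,Y]\<^esub> Z\<close>, evaluated on fields with constant
  components, for which the Lie bracket vanishes.\<close>

definition curvature ::
  "('p, 'e::euclidean_space) metric \<Rightarrow> ('p, 'e) chart \<Rightarrow> 'p \<Rightarrow> 'e \<Rightarrow> 'e \<Rightarrow> 'e \<Rightarrow> 'e" where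
  "curvature g c p x y z =
     dir_deriv c (\<lambda>q. christoffel g c q y z) p x + christoffel g c p x (christoffel g c p y z)
     - dir_deriv c (\<lambda>q. christoffel g c q x z) p y - christoffel g c p y (christoffel g c p x z)"

definition ricci :: "('p, 'e::euclidean_space) metric \<Rightarrow> ('p, 'e) chart \<Rightarrow> 'p \<Rightarrow> 'e \<Rightarrow> 'e \<Rightarrow> real" where
  "ricci g c p y z = endo_trace (\<lambda>x. curvature g c p x y z)"

definition ricci_bounded_below :: "('p, 'e::euclidean_space) atlas \<Rightarrow> ('p, 'e) metric \<Rightarrow> bool" where
  "ricci_bounded_below A g \<longleftrightarrow>
     (\<exists>\<kappa>. \<forall>c\<in>A. \<forall>p \<in> dom c. \<forall>v. ricci g c p v v \<ge> \<kappa> * g c p v v)"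

definition C2_function :: "('p, 'e::euclidean_space) atlas \<Rightarrow> ('p \<Rightarrow> real) \<Rightarrow> bool" where
  "C2_function A u \<longleftrightarrow> (\<forall>c\<in>A. Ck_on 2 (coord c ` dom c) (u \<circ> coord_inv c))"

definition parabolic :: "('p, 'e::euclidean_space) atlas \<Rightarrow> ('p, 'e) metric \<Rightarrow> bool" where
  "parabolic A g \<longleftrightarrow>
     (\<forall>u. C2_function A u \<and> (\<forall>c\<in>A. \<forall>p \<in> dom c. laplacian g c u p \<ge> 0) \<and> bdd_above (range u)
        \<longrightarrow> (\<exists>k. \<forall>p. u p = k))"

section \<open>Riemannian distance and completeness\<close>

definition piecewise_C1_curve ::
  "('p::topological_space, 'e::euclidean_space) atlas \<Rightarrow> (real \<Rightarrow> 'p) \<Rightarrow> bool" where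
  "piecewise_C1_curve A \<gamma> \<longleftrightarrow> continuous_on {0..1} \<gamma> \<and>
     (\<forall>c\<in>A. \<forall>a b. 0 \<le> a \<and> a \<le> b \<and> b \<le> 1 \<and> \<gamma> ` {a..b} \<subseteq> dom c \<longrightarrow>
        (coord c \<circ> \<gamma>) piecewise_C1_differentiable_on {a..b})"

text \<open>The speed does not depend on the chart around \<open>\<gamma> t\<close> in which it is computed.\<close>

definition speed :: "('p, 'e::euclidean_space) atlas \<Rightarrow> ('p, 'e) metric \<Rightarrow> (real \<Rightarrow> 'p) \<Rightarrow> real \<Rightarrow> real"
  where "speed A g \<gamma> t =
     (let c = (SOME c. c \<in> A \<and> \<gamma> t \<in> dom c); v = vector_derivative (coord c \<circ> \<gamma>) (at t)
      in sqrt (g c (\<gamma> t) v v))"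

definition curve_length ::
  "('p, 'e::euclidean_space) atlas \<Rightarrow> ('p, 'e) metric \<Rightarrow> (real \<Rightarrow> 'p) \<Rightarrow> ennreal" where
  "curve_length A g \<gamma> = (\<integral>\<^sup>+ t \<in> {0..1}. ennreal (speed A g \<gamma> t) \<partial>lborel)"

definition riem_dist ::
  "('p::topological_space, 'e::euclidean_space) atlas \<Rightarrow> ('p, 'e) metric \<Rightarrow> 'p \<Rightarrow> 'p \<Rightarrow> ennreal" where
  "riem_dist A g p q =
     (INF \<gamma> \<in> {\<gamma>. piecewise_C1_curve A \<gamma> \<and> \<gamma> 0 = p \<and> \<gamma> 1 = q}. curve_length A g \<gamma>)"

definition complete_manifold ::
  "('p::topological_space, 'e::euclidean_space) atlas \<Rightarrow> ('p, 'e) metric \<Rightarrow> bool" where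
  "complete_manifold A g \<longleftrightarrow>
     (\<forall>x :: nat \<Rightarrow> 'p.
        (\<forall>e>0. \<exists>N. \<forall>m\<ge>N. \<forall>n\<ge>N. riem_dist A g (x m) (x n) < ennreal e) \<longrightarrow>
        (\<exists>l. (\<lambda>n. riem_dist A g (x n) l) \<longlonglongrightarrow> 0))"

section \<open>Submanifolds\<close>

text \<open>The second fundamental form \<open>\<nabla>'\<^sub>X Y - \<nabla>\<^sub>X Y\<close> of an isometric immersion \<open>F\<close> of \<open>(A, g)\<close>
  into \<open>(B, h)\<close> (with connections \<open>\<nabla>\<close> and \<open>\<nabla>'\<close>), evaluated on fields with constant
  components \<open>v\<close>, \<open>w\<close>. The first two terms are the covariant derivative of \<open>dF w\<close> along \<open>F\<close>.\<close>

definition second_fundamental_form ::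
  "('p, 'e::euclidean_space) metric \<Rightarrow> ('q, 'd::euclidean_space) metric \<Rightarrow>
   ('p, 'e) chart \<Rightarrow> ('q, 'd) chart \<Rightarrow> ('p \<Rightarrow> 'q) \<Rightarrow> 'p \<Rightarrow> 'e \<Rightarrow> 'e \<Rightarrow> 'd" where
  "second_fundamental_form g h c d F p v w =
     dir_deriv c (\<lambda>q. differential c d F q w) p v
     + christoffel h d (F p) (differential c d F p v) (differential c d F p w)
     - differential c d F p (christoffel g c p v w)"

definition totally_geodesic ::
  "('p, 'e::euclidean_space) atlas \<Rightarrow> ('p, 'e) metric \<Rightarrow>
   ('q, 'd::euclidean_space) atlas \<Rightarrow> ('q, 'd) metric \<Rightarrow> ('p \<Rightarrow> 'q) \<Rightarrow> bool" where
  "totally_geodesic A g B h F \<longleftrightarrow>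
     (\<forall>c\<in>A. \<forall>d\<in>B. \<forall>p \<in> dom c \<inter> F -` dom d. \<forall>v w. second_fundamental_form g h c d F p v w = 0)"

text \<open>The tangent space \<open>dF(T\<^sub>p)\<close> of an immersed submanifold and its normal space at \<open>F p\<close>, as
  spaces of components with respect to the chart \<open>d\<close> of the ambient manifold.\<close>

definition tangent_image :: "('p, 'e::euclidean_space) chart \<Rightarrow> ('q, 'd::euclidean_space) chart \<Rightarrow>
    ('p \<Rightarrow> 'q) \<Rightarrow> 'p \<Rightarrow> 'd set" where
  "tangent_image c d F p = range (differential c d F p)"

definition normal_space :: "('p, 'e::euclidean_space) chart \<Rightarrow> ('q, 'd::euclidean_space) chart \<Rightarrow>
    ('q, 'd) metric \<Rightarrow> ('p \<Rightarrow> 'q) \<Rightarrow> 'p \<Rightarrow> 'd set" where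
  "normal_space c d h F p = {z. \<forall>x \<in> tangent_image c d F p. h d (F p) x z = 0}"

text \<open>The intersection of the submanifolds \<open>\<phi> : M \<rightarrow> Q\<close> and \<open>\<psi> : N \<rightarrow> Q\<close> is a submanifold \<open>S\<close>
  of \<open>Q\<close>, with inclusions \<open>a : S \<rightarrow> M\<close> and \<open>b : S \<rightarrow> N\<close>. Immersions need not be injective, so
  points of the intersection are pairs \<open>(x, y)\<close> with \<open>\<phi> x = \<psi> y\<close>. If \<open>\<phi>\<close> and \<open>\<psi>\<close> are injective,
  the condition says that \<open>\<phi> \<circ> a = \<psi> \<circ> b\<close> maps \<open>S\<close> bijectively onto \<open>range \<phi> \<inter> range \<psi>\<close>.\<close>

definition intersection_submanifold ::
  "('m::topological_space, 'i::euclidean_space) atlas \<Rightarrow>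
   ('n::topological_space, 'k::euclidean_space) atlas \<Rightarrow>
   ('s::topological_space, 'l::euclidean_space) atlas \<Rightarrow>
   ('q::topological_space, 'd::euclidean_space) atlas \<Rightarrow>
   ('m \<Rightarrow> 'q) \<Rightarrow> ('n \<Rightarrow> 'q) \<Rightarrow> ('s \<Rightarrow> 'm) \<Rightarrow> ('s \<Rightarrow> 'n) \<Rightarrow> bool" where
  "intersection_submanifold AM AN AS AQ \<phi> \<psi> a b \<longleftrightarrow>
     bij_betw (\<lambda>s. (a s, b s)) UNIV {(x, y). \<phi> x = \<psi> y} \<and>
     smooth_map AS AM a \<and> smooth_map AS AN b \<and> immersion AS AQ (\<phi> \<circ> a)"

definition normal_submanifolds ::
  "('m::topological_space, 'i::euclidean_space) atlas \<Rightarrow>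
   ('n::topological_space, 'k::euclidean_space) atlas \<Rightarrow>
   ('s::topological_space, 'l::euclidean_space) atlas \<Rightarrow>
   ('q::topological_space, 'd::euclidean_space) atlas \<Rightarrow> ('q, 'd) metric \<Rightarrow>
   ('m \<Rightarrow> 'q) \<Rightarrow> ('n \<Rightarrow> 'q) \<Rightarrow> ('s \<Rightarrow> 'm) \<Rightarrow> ('s \<Rightarrow> 'n) \<Rightarrow> bool" where
  "normal_submanifolds AM AN AS AQ gQ \<phi> \<psi> a b \<longleftrightarrow>
     intersection_submanifold AM AN AS AQ \<phi> \<psi> a b \<and>
     (\<forall>s. \<forall>cM\<in>AM. \<forall>cN\<in>AN. \<forall>cS\<in>AS. \<forall>d\<in>AQ.
        a s \<in> dom cM \<and> b s \<in> dom cN \<and> s \<in> dom cS \<and> \<phi> (a s) \<in> dom d \<longrightarrow>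
        tangent_image cM d \<phi> (a s) \<inter> normal_space cS d gQ (\<phi> \<circ> a) s
          \<subseteq> normal_space cN d gQ \<psi> (b s))"

section \<open>Warped products \<open>\<real> \<times>\<^sub>f P\<close>\<close>

definition cylinder_chart :: "('p, 'e) chart \<Rightarrow> (real \<times> 'p, real \<times> 'e) chart" where
  "cylinder_chart c = (UNIV \<times> dom c, map_prod id (coord c))"

definition cylinder_atlas :: "('p, 'e) atlas \<Rightarrow> (real \<times> 'p, real \<times> 'e) atlas" where
  "cylinder_atlas A = cylinder_chart ` A"

text \<open>Recovers \<open>c\<close> from \<open>cylinder_chart c\<close>.\<close>

definition base_chart :: "(real \<times> 'p, real \<times> 'e) chart \<Rightarrow> ('p, 'e) chart" where
  "base_chart d = ({p. (0, p) \<in> dom d}, \<lambda>p. snd (coord d (0, p)))"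

lemma base_chart_cylinder_chart [simp]: "base_chart (cylinder_chart c) = c"
  by (simp add: base_chart_def cylinder_chart_def)

definition warped_metric ::
  "(real \<Rightarrow> real) \<Rightarrow> ('p, 'e) metric \<Rightarrow> (real \<times> 'p, real \<times> 'e) metric" where
  "warped_metric f g = (\<lambda>d (t, p) (\<tau>, v) (\<sigma>, w). \<tau> * \<sigma> + (f t)\<^sup>2 * g (base_chart d) p v w)"

definition log_deriv :: "(real \<Rightarrow> real) \<Rightarrow> real \<Rightarrow> real" where
  "log_deriv f t = deriv f t / f t"

definition slice :: "real \<Rightarrow> (real \<times> 'p) set" where
  "slice t = {t} \<times> UNIV"

definition height :: "('s \<Rightarrow> real \<times> 'p) \<Rightarrow> 's \<Rightarrow> real" where
  "height a s = fst (a s)"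

end

theory Submission
  imports Defs
begin

text \<open>The unit normal of \<open>\<Sigma>\<close> in \<open>M\<close> is normal to \<open>N\<close>, because \<open>M\<close> and \<open>N\<close> meet orthogonally. Hence the second
fundamental form of \<open>\<Sigma>\<close> in \<open>M\<close> is a component of that of \<open>N\<close>, and \<open>\<Sigma>\<close> is totally geodesic in \<open>M\<close>
(\<open>second_fundamental_form_a\<close>).

In the warped product, with \<open>H = f'/f\<close>, one has \<open>\<nabla>\<^sub>v \<partial>\<^sub>t = H(v - \<langle>v, \<partial>\<^sub>t\<rangle> \<partial>\<^sub>t)\<close>. As \<open>\<Sigma>\<close> is totally geodesic, its height function \<open>h\<close>
satisfies \<open>Hess h = H(h) (g - dh \<otimes> dh)\<close> (\<open>hessian_height\<close>). The decisive choice is the warping function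
itself as a test function: with \<open>m = dim \<Sigma>\<close>, and since \<open>f' = f H\<close> and \<open>f'' = f (H' + H\<^sup>2)\<close>,
\<open>\<Delta> f(h) = f(h) (m H(h)\<^sup>2 + H'(h) |\<nabla>h|\<^sup>2) \<ge> 0\<close>.
The function \<open>f(h)\<close> is bounded because \<open>h\<close> is, so it is constant by parabolicity. Then its Laplacian
vanishes, which forces \<open>H(h) = 0\<close>. Now \<open>h\<close> itself is harmonic and bounded, hence constant
(\<open>height_constant\<close>).

It remains to see that \<open>\<Sigma>\<close> is all of the slice \<open>{t} \<times> P\<close> in which it lies. The projection to \<open>P\<close>
is a local isometry for the metric \<open>f(t)\<^sup>2 g\<^sub>P\<close>, between manifolds of the same dimension. Its image is
open by the inverse function theorem. It is closed because segments in charts of \<open>P\<close> lift to \<open>\<Sigma>\<close>, which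
is complete. As \<open>P\<close> is connected, the projection is onto (\<open>surj_of_complete_connected\<close>).

The computations are carried out for maps and metrics on open subsets of Euclidean spaces, where they
are identities between derivatives, and are then read in charts.\<close>

section \<open>Calculus in Euclidean spaces\<close>

abbreviation fd :: "('a::real_normed_vector \<Rightarrow> 'b::real_normed_vector) \<Rightarrow> 'a \<Rightarrow> 'a \<Rightarrow> 'b" where
  "fd f x \<equiv> frechet_derivative f (at x)"

lemma Ck_on_subset: "Ck_on k S f \<Longrightarrow> T \<subseteq> S \<Longrightarrow> Ck_on k T f"
  by (induction k arbitrary: f) (auto intro: continuous_on_subset)

lemma differentiable_transform_open:
  assumes "f differentiable (at x)" "open S" "x \<in> S" "\<And>y. y \<in> S \<Longrightarrow> f y = g y"
  shows "g differentiable (at x)"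
  using assms has_derivative_transform_within_open[of f _ x UNIV S g]
  unfolding differentiable_def by blast

lemma Ck_on_cong:
  assumes "open S" "\<And>x. x \<in> S \<Longrightarrow> f x = g x" "Ck_on k S f"
  shows "Ck_on k S g"
  using assms(2,3)
proof (induction k arbitrary: f g)
  case 0
  then show ?case by (simp cong: continuous_on_cong)
next
  case (Suc k)
  have "g differentiable at x" if "x \<in> S" for x
    using differentiable_transform_open[of f x S g] Suc.prems that assms(1) by simp
  moreover have "fd f x = fd g x" if "x \<in> S" for x
    using Suc.prems that assms(1) by (intro frechet_derivative_transform_within_open[of _ _ S]) auto
  ultimately show ?case
    using Suc.prems Suc.IH[of "\<lambda>x. fd f x v" "\<lambda>x. fd g x v" for v] by auto
qed

lemma Ck_on_const: "Ck_on k S (\<lambda>x. c)"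
  by (induction k arbitrary: c) auto

lemma Ck_on_local:
  assumes "\<And>x. x \<in> S \<Longrightarrow> \<exists>T. open T \<and> x \<in> T \<and> Ck_on k T f"
  shows "Ck_on k S f"
  using assms
proof (induction k arbitrary: f)
  case 0
  show ?case unfolding Ck_on.simps
  proof (rule continuous_at_imp_continuous_on, intro ballI)
    fix x assume "x \<in> S"
    then obtain T where "open T" "x \<in> T" "continuous_on T f" using 0 by auto
    then show "isCont f x" by (simp add: continuous_on_eq_continuous_at)
  qed
next
  case (Suc k)
  have "f differentiable at x" if "x \<in> S" for x
    using Suc.prems that by fastforce
  moreover have "Ck_on k S (\<lambda>x. fd f x v)" for v
    by (rule Suc.IH) (use Suc.prems in fastforce)
  ultimately show ?case by simp
qed

lemma Ck_on_bounded_linear: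
  assumes "bounded_linear L" "open S" "Ck_on k S f"
  shows "Ck_on k S (\<lambda>x. L (f x))"
  using assms(3)
proof (induction k arbitrary: f)
  case 0
  then show ?case using assms(1) by (simp add: bounded_linear.continuous_on)
next
  case (Suc k)
  have d: "((\<lambda>x. L (f x)) has_derivative (\<lambda>v. L (fd f x v))) (at x)" if "x \<in> S" for x
    by (rule bounded_linear.has_derivative[OF assms(1)])
       (use that Suc.prems frechet_derivative_works in auto)
  then have "fd (\<lambda>x. L (f x)) x v = L (fd f x v)" if "x \<in> S" for x v
    using frechet_derivative_at that by metis
  then have "Ck_on k S (\<lambda>x. fd (\<lambda>x. L (f x)) x v)" for v
    using Suc.prems by (intro Ck_on_cong[OF assms(2) _ Suc.IH[of "\<lambda>x. fd f x v"]]) auto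
  then show ?case using d by (auto simp: differentiable_def)
qed

lemma smooth_on_Ck: "smooth_on S f \<Longrightarrow> Ck_on k S f"
  by (simp add: smooth_on_def)

lemma smooth_on_subset: "smooth_on S f \<Longrightarrow> T \<subseteq> S \<Longrightarrow> smooth_on T f"
  by (meson smooth_on_def Ck_on_subset)

lemma smooth_on_cong:
  "open S \<Longrightarrow> (\<And>x. x \<in> S \<Longrightarrow> f x = g x) \<Longrightarrow> smooth_on S f \<Longrightarrow> smooth_on S g"
  unfolding smooth_on_def using Ck_on_cong by blast

lemma smooth_on_bounded_linear:
  "bounded_linear L \<Longrightarrow> open S \<Longrightarrow> smooth_on S f \<Longrightarrow> smooth_on S (\<lambda>x. L (f x))"
  by (simp add: smooth_on_def Ck_on_bounded_linear)

lemma smooth_on_fd: "smooth_on S f \<Longrightarrow> smooth_on S (\<lambda>x. fd f x v)"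
  unfolding smooth_on_def by (metis Ck_on.simps(2))

lemma smooth_on_differentiable: "smooth_on S f \<Longrightarrow> x \<in> S \<Longrightarrow> f differentiable (at x)"
  unfolding smooth_on_def by (metis Ck_on.simps(2))

lemma smooth_on_has_derivative: "smooth_on S f \<Longrightarrow> x \<in> S \<Longrightarrow> (f has_derivative fd f x) (at x)"
  using smooth_on_differentiable frechet_derivative_works by blast

lemma smooth_on_continuous: "smooth_on S f \<Longrightarrow> continuous_on S f"
  unfolding smooth_on_def by (metis Ck_on.simps(1))

lemma fd_linear: "f differentiable (at x) \<Longrightarrow> linear (fd f x)"
  by (rule linear_frechet_derivative)

lemma smooth_on_fd_linear: "smooth_on S f \<Longrightarrow> x \<in> S \<Longrightarrow> linear (fd f x)"
  by (simp add: fd_linear smooth_on_differentiable)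

lemma fd_eqI: "(f has_derivative f') (at x) \<Longrightarrow> fd f x v = f' v"
  using frechet_derivative_at by metis

lemma fd_cong:
  assumes "open T" "x \<in> T" "\<And>y. y \<in> T \<Longrightarrow> f y = g y" "f differentiable (at x)"
  shows "fd f x = fd g x"
  using assms by (intro frechet_derivative_transform_within_open) auto

lemma fd_compose:
  assumes "f differentiable (at (g x))" "g differentiable (at x)"
  shows "fd (\<lambda>x. f (g x)) x v = fd f (g x) (fd g x v)"
  using frechet_derivative_compose[OF assms(2,1)] by (simp add: o_def fun_eq_iff)

text \<open>Two applications of the mean value theorem to the second difference of \<open>f\<close> over a small parallelogram.
The left-hand side is symmetric in \<open>v\<close> and \<open>w\<close>, so that shrinking the parallelogram gives the symmetry of
second derivatives.\<close>

lemma mixed_derivatives_near: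
  fixes f :: "'a::euclidean_space \<Rightarrow> real"
  assumes "ball x r \<subseteq> S" "smooth_on S f" "0 < s" "s * (norm v + norm w) < r"
  shows "\<exists>\<xi>. dist x \<xi> \<le> s * (norm v + norm w) \<and>
     f (x + s *\<^sub>R v + s *\<^sub>R w) - f (x + s *\<^sub>R v) - f (x + s *\<^sub>R w) + f x = s * s * fd (\<lambda>y. fd f y v) \<xi> w"
proof -
  have sc: "norm (p *\<^sub>R v + q *\<^sub>R w) \<le> s * (norm v + norm w)" if "0 \<le> p" "p \<le> s" "0 \<le> q" "q \<le> s" for p q
  proof -
    have "norm (p *\<^sub>R v + q *\<^sub>R w) \<le> p * norm v + q * norm w"
      using norm_triangle_ineq[of "p *\<^sub>R v" "q *\<^sub>R w"] that by simp
    also have "\<dots> \<le> s * norm v + s * norm w"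
      using that by (intro add_mono mult_right_mono) auto
    finally show ?thesis by (simp add: algebra_simps)
  qed
  have inS: "x + p *\<^sub>R v + q *\<^sub>R w \<in> S" if "0 \<le> p" "p \<le> s" "0 \<le> q" "q \<le> s" for p q
  proof -
    have "dist x (x + p *\<^sub>R v + q *\<^sub>R w) = norm (p *\<^sub>R v + q *\<^sub>R w)"
      by (metis add.assoc add_diff_cancel_left' dist_commute dist_norm)
    then show ?thesis using sc[OF that] assms(1,4) by auto
  qed
  define k where "k p = f (x + p *\<^sub>R v + s *\<^sub>R w) - f (x + p *\<^sub>R v)" for p
  have "(k has_derivative (\<lambda>h. h * (fd f (x + p *\<^sub>R v + s *\<^sub>R w) v - fd f (x + p *\<^sub>R v) v))) (at p)"
    if "0 \<le> p" "p \<le> s" for p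
  proof -
    have 1: "((\<lambda>p. f (x + p *\<^sub>R v + q *\<^sub>R w)) has_derivative (\<lambda>h. fd f (x + p *\<^sub>R v + q *\<^sub>R w) (h *\<^sub>R v))) (at p)"
      if "0 \<le> q" "q \<le> s" for q
      by (rule has_derivative_compose[of "\<lambda>p. x + p *\<^sub>R v + q *\<^sub>R w", OF _ smooth_on_has_derivative[OF assms(2) inS]])
         (use that \<open>0 \<le> p\<close> \<open>p \<le> s\<close> in \<open>auto intro!: derivative_eq_intros\<close>)
    have lin: "fd f (x + p *\<^sub>R v + q *\<^sub>R w) (h *\<^sub>R v) = h * fd f (x + p *\<^sub>R v + q *\<^sub>R w) v" if "0 \<le> q" "q \<le> s" for q h
      using smooth_on_fd_linear[OF assms(2) inS[OF \<open>0 \<le> p\<close> \<open>p \<le> s\<close> that]] by (simp add: linear_cmul)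
    from has_derivative_diff[OF 1[of s] 1[of 0]] show ?thesis
      unfolding k_def using lin[of s] lin[of 0] assms(3) by (simp add: algebra_simps)
  qed
  note k = this
  have "continuous_on {0..s} k"
    using has_derivative_continuous[OF k] by (intro continuous_at_imp_continuous_on) simp
  from mvt[OF assms(3) this k]
  obtain p where p: "0 < p" "p < s" "k s - k 0 = s * (fd f (x + p *\<^sub>R v + s *\<^sub>R w) v - fd f (x + p *\<^sub>R v) v)"
    by simp metis
  define l where "l q = fd f (x + p *\<^sub>R v + q *\<^sub>R w) v" for q
  have l: "(l has_derivative (\<lambda>h. h * fd (\<lambda>y. fd f y v) (x + p *\<^sub>R v + q *\<^sub>R w) w)) (at q)"
    if "0 \<le> q" "q \<le> s" for q
  proof -
    have i: "x + p *\<^sub>R v + q *\<^sub>R w \<in> S" using inS p that by auto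
    note sm = smooth_on_fd[OF assms(2)]
    have "(l has_derivative (\<lambda>h. fd (\<lambda>y. fd f y v) (x + p *\<^sub>R v + q *\<^sub>R w) (h *\<^sub>R w))) (at q)"
      unfolding l_def
      by (rule has_derivative_compose[of "\<lambda>q. x + p *\<^sub>R v + q *\<^sub>R w", OF _ smooth_on_has_derivative[OF sm i]])
         (auto intro!: derivative_eq_intros)
    then show ?thesis using smooth_on_fd_linear[OF sm i] by (simp add: linear_cmul)
  qed
  have "continuous_on {0..s} l"
    using has_derivative_continuous[OF l] by (intro continuous_at_imp_continuous_on) simp
  from mvt[OF assms(3) this l]
  obtain q where q: "0 < q" "q < s" "l s - l 0 = s * fd (\<lambda>y. fd f y v) (x + p *\<^sub>R v + q *\<^sub>R w) w"
    by simp metis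
  have "dist x (x + p *\<^sub>R v + q *\<^sub>R w) \<le> s * (norm v + norm w)"
    using sc[of p q] p q by (metis add.assoc add_diff_cancel_left' dist_commute dist_norm less_imp_le)
  moreover have "k s - k 0 = s * (l s - l 0)" using p(3) by (simp add: l_def)
  ultimately show ?thesis using q(3) by (intro exI[of _ "x + p *\<^sub>R v + q *\<^sub>R w"]) (simp add: k_def)
qed

lemma mixed_derivatives_commute_real:
  fixes f :: "'a::euclidean_space \<Rightarrow> real"
  assumes "open S" "smooth_on S f" "x \<in> S"
  shows "fd (\<lambda>y. fd f y v) x w = fd (\<lambda>y. fd f y w) x v"
proof -
  obtain r where r: "r > 0" "ball x r \<subseteq> S" using assms(1,3) open_contains_ball by blast
  (* side lengths that tend to 0 and keep the parallelograms inside the ball *)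
  define s where "s n = r / (norm v + norm w + 1) / real (n + 2)" for n
  have s: "s n > 0" "s n * (norm v + norm w) < r" for n
  proof -
    show pos: "s n > 0" using r by (simp add: s_def add_nonneg_pos divide_pos_pos)
    have "s n * (norm v + norm w) < s n * (norm v + norm w + 1)" using pos by simp
    also have "\<dots> = r / real (n + 2)"
      using add_nonneg_pos[of "norm v + norm w" 1] by (simp add: s_def del: of_nat_add)
    also have "\<dots> \<le> r" using r by (simp add: field_simps)
    finally show "s n * (norm v + norm w) < r" .
  qed
  have "s \<longlonglongrightarrow> 0"
    unfolding s_def using LIMSEQ_ignore_initial_segment[OF tendsto_divide_0[OF tendsto_const filterlim_at_top_imp_at_infinity[OF filterlim_real_sequentially]], of _ 2]
    by blast
  then have s0: "(\<lambda>n. s n * (norm v + norm w)) \<longlonglongrightarrow> 0" by (simp add: tendsto_mult_left_zero)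
  obtain \<xi> where \<xi>: "dist x (\<xi> n) \<le> s n * (norm v + norm w)"
      "f (x + s n *\<^sub>R v + s n *\<^sub>R w) - f (x + s n *\<^sub>R v) - f (x + s n *\<^sub>R w) + f x
        = s n * s n * fd (\<lambda>y. fd f y v) (\<xi> n) w" for n
    using mixed_derivatives_near[OF r(2) assms(2) s(1) s(2)] by metis
  have s': "s n * (norm w + norm v) < r" for n using s(2)[of n] by (simp add: add.commute)
  obtain \<eta> where \<eta>: "dist x (\<eta> n) \<le> s n * (norm w + norm v)"
      "f (x + s n *\<^sub>R w + s n *\<^sub>R v) - f (x + s n *\<^sub>R w) - f (x + s n *\<^sub>R v) + f x
        = s n * s n * fd (\<lambda>y. fd f y w) (\<eta> n) v" for n
    using mixed_derivatives_near[OF r(2) assms(2) s(1) s'] by metis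
  have eq: "fd (\<lambda>y. fd f y v) (\<xi> n) w = fd (\<lambda>y. fd f y w) (\<eta> n) v" for n
  proof -
    have "s n * s n * fd (\<lambda>y. fd f y v) (\<xi> n) w = s n * s n * fd (\<lambda>y. fd f y w) (\<eta> n) v"
      using \<xi>(2)[of n] \<eta>(2)[of n] by (simp only: add.assoc add.commute[of "s n *\<^sub>R v"])
    then show ?thesis using s(1)[of n] by simp
  qed
  have lim: "\<zeta> \<longlonglongrightarrow> x" if "\<And>n. dist x (\<zeta> n) \<le> s n * (norm v + norm w)" for \<zeta>
    by (rule iffD2[OF tendsto_dist_iff], rule tendsto_sandwich[OF _ _ tendsto_const s0])
       (use that in \<open>simp_all add: dist_commute\<close>)
  have cont: "isCont (\<lambda>y. fd (\<lambda>y. fd f y v) y w) x" for v w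
    using smooth_on_continuous[OF smooth_on_fd[OF smooth_on_fd[OF assms(2)]]] assms(1,3)
    by (simp add: continuous_on_eq_continuous_at)
  have "(\<lambda>n. fd (\<lambda>y. fd f y v) (\<xi> n) w) \<longlonglongrightarrow> fd (\<lambda>y. fd f y v) x w"
    using isCont_tendsto_compose[OF cont lim] \<xi>(1) by blast
  moreover have "(\<lambda>n. fd (\<lambda>y. fd f y w) (\<eta> n) v) \<longlonglongrightarrow> fd (\<lambda>y. fd f y w) x v"
    using isCont_tendsto_compose[OF cont lim] \<eta>(1) by (simp add: add.commute)
  ultimately show ?thesis unfolding eq by (rule LIMSEQ_unique)
qed

lemma mixed_derivatives_commute:
  fixes f :: "'a::euclidean_space \<Rightarrow> 'b::euclidean_space"
  assumes "open S" "smooth_on S f" "x \<in> S"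
  shows "fd (\<lambda>y. fd f y v) x w = fd (\<lambda>y. fd f y w) x v"
proof (rule euclidean_eqI)
  fix b :: 'b
  assume "b \<in> Basis"
  note bl = bounded_linear_inner_left[of b]
  have 1: "fd (\<lambda>y. g y \<bullet> b) z u = fd g z u \<bullet> b" if "smooth_on S g" "z \<in> S" for g z u
    by (rule fd_eqI, rule bounded_linear.has_derivative[OF bl smooth_on_has_derivative[OF that]])
  have 2: "fd (\<lambda>y. fd (\<lambda>y. f y \<bullet> b) y v) x w = fd (\<lambda>y. fd f y v) x w \<bullet> b" for v w
  proof -
    have "fd (\<lambda>y. fd (\<lambda>y. f y \<bullet> b) y v) x = fd (\<lambda>y. fd f y v \<bullet> b) x"
      using smooth_on_fd[OF smooth_on_bounded_linear[OF bl assms(1,2)]] assms 1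
      by (intro fd_cong[of S]) (auto intro: smooth_on_differentiable)
    then show ?thesis using 1[OF smooth_on_fd[OF assms(2)] assms(3)] by simp
  qed
  from mixed_derivatives_commute_real[OF assms(1) smooth_on_bounded_linear[OF bl assms(1,2)] assms(3), of v w]
  show "fd (\<lambda>y. fd f y v) x w \<bullet> b = fd (\<lambda>y. fd f y w) x v \<bullet> b"
    by (simp add: 2)
qed

lemma linear_expand_Basis:
  fixes w :: "'b::euclidean_space"
  assumes "linear A"
  shows "A w = (\<Sum>b\<in>Basis. (w \<bullet> b) *\<^sub>R A b)"
proof -
  have "A w = A (\<Sum>b\<in>Basis. (w \<bullet> b) *\<^sub>R b)" by (simp add: euclidean_representation)
  then show ?thesis using assms by (simp add: linear_sum linear_cmul)
qed

text \<open>The product rule for evaluating a differentiable family of linear maps at a differentiable argument.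
The family is differentiated only at fixed arguments, as are metrics and differentials below;
expanding \<open>W x\<close> in a basis turns the evaluation into a finite sum of products.\<close>

lemma has_derivative_linear_family:
  fixes A :: "'a::real_normed_vector \<Rightarrow> 'b::euclidean_space \<Rightarrow> 'c::real_normed_vector"
  assumes U: "open U" "y \<in> U" and lin: "\<And>x. x \<in> U \<Longrightarrow> linear (A x)"
    and A': "\<And>w. ((\<lambda>x. A x w) has_derivative (\<lambda>v. A' v w)) (at y)"
    and W: "(W has_derivative W') (at y)"
  shows "((\<lambda>x. A x (W x)) has_derivative (\<lambda>v. A' v (W y) + A y (W' v))) (at y)"
proof -
  have A'_expand: "A' v w = (\<Sum>b\<in>Basis. (w \<bullet> b) *\<^sub>R A' v b)" for v w
  proof -
    have "((\<lambda>x. \<Sum>b\<in>Basis. (w \<bullet> b) *\<^sub>R A x b) has_derivative (\<lambda>v. \<Sum>b\<in>Basis. (w \<bullet> b) *\<^sub>R A' v b)) (at y)"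
      by (intro has_derivative_sum has_derivative_scaleR_right A')
    then have "((\<lambda>x. A x w) has_derivative (\<lambda>v. \<Sum>b\<in>Basis. (w \<bullet> b) *\<^sub>R A' v b)) (at y)"
      using has_derivative_transform_within_open[OF _ U] linear_expand_Basis[OF lin] by fastforce
    from has_derivative_unique[OF A' this] show ?thesis by meson
  qed
  have "((\<lambda>x. \<Sum>b\<in>Basis. (W x \<bullet> b) *\<^sub>R A x b) has_derivative
      (\<lambda>v. \<Sum>b\<in>Basis. (W y \<bullet> b) *\<^sub>R A' v b + (W' v \<bullet> b) *\<^sub>R A y b)) (at y)"
    by (intro has_derivative_sum has_derivative_scaleR A' has_derivative_inner_left W)
  then have "((\<lambda>x. A x (W x)) has_derivative
      (\<lambda>v. \<Sum>b\<in>Basis. (W y \<bullet> b) *\<^sub>R A' v b + (W' v \<bullet> b) *\<^sub>R A y b)) (at y)"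
    using has_derivative_transform_within_open[OF _ U] linear_expand_Basis[OF lin] by fastforce
  moreover have "(\<Sum>b\<in>Basis. (W y \<bullet> b) *\<^sub>R A' v b + (W' v \<bullet> b) *\<^sub>R A y b) = A' v (W y) + A y (W' v)" for v
    unfolding sum.distrib using A'_expand linear_expand_Basis[OF lin[OF U(2)]] by metis
  ultimately show ?thesis by simp
qed

lemma has_derivative_bilinear_family:
  fixes B :: "'a::real_normed_vector \<Rightarrow> 'b::euclidean_space \<Rightarrow> 'b \<Rightarrow> real"
  assumes U: "open U" "y \<in> U" and bil: "\<And>x. x \<in> U \<Longrightarrow> bilinear (B x)"
    and B': "\<And>v w. ((\<lambda>x. B x v w) has_derivative (\<lambda>z. B' z v w)) (at y)"
    and V: "(V has_derivative V') (at y)" and W: "(W has_derivative W') (at y)"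
  shows "((\<lambda>x. B x (V x) (W x)) has_derivative
    (\<lambda>z. B' z (V y) (W y) + B y (V' z) (W y) + B y (V y) (W' z))) (at y)"
proof -
  have 1: "((\<lambda>x. B x (V x) w) has_derivative (\<lambda>z. B' z (V y) w + B y (V' z) w)) (at y)" for w
    by (rule has_derivative_linear_family[OF U _ _ V, of "\<lambda>x v. B x v w"])
       (use bil B' in \<open>auto simp: bilinear_def\<close>)
  show ?thesis
    using has_derivative_linear_family[where A = "\<lambda>x. B x (V x)", OF U _ 1 W] bil by (simp add: bilinear_def)
qed

lemma has_derivative_real_chain:
  assumes "(F has_real_derivative F') (at (u x))" "(u has_derivative u') (at x)"
  shows "((\<lambda>x. F (u x)) has_derivative (\<lambda>v. F' * u' v)) (at x)"
  using has_derivative_compose[OF assms(2) assms(1)[unfolded has_field_derivative_def]] by simp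

lemma fd_fd_compose_real:
  fixes u :: "'e::euclidean_space \<Rightarrow> real"
  assumes "open U" "y \<in> U" "smooth_on U u"
    and F: "\<And>t. (F has_real_derivative F' t) (at t)" "\<And>t. (F' has_real_derivative F'' t) (at t)"
  shows "((\<lambda>x. fd (\<lambda>x. F (u x)) x w) has_derivative
    (\<lambda>v. F' (u y) * fd (\<lambda>x. fd u x w) y v + F'' (u y) * (fd u y v * fd u y w))) (at y)"
proof -
  have 1: "((\<lambda>x. F' (u x) * fd u x w) has_derivative
      (\<lambda>v. F' (u y) * fd (\<lambda>x. fd u x w) y v + (F'' (u y) * fd u y v) * fd u y w)) (at y)"
    by (intro has_derivative_mult has_derivative_real_chain F smooth_on_has_derivative[OF assms(3,2)]
        smooth_on_has_derivative[OF smooth_on_fd[OF assms(3)] assms(2)])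
  have 2: "F' (u x) * fd u x w = fd (\<lambda>x. F (u x)) x w" if "x \<in> U" for x
    using fd_eqI[OF has_derivative_real_chain[OF F(1) smooth_on_has_derivative[OF assms(3) that]]] by simp
  show ?thesis
    using has_derivative_transform_within_open[OF 1 assms(1,2) 2] by (simp add: mult.assoc)
qed

lemma smooth_on_UNIV_real:
  fixes f :: "real \<Rightarrow> real"
  assumes "smooth_on UNIV f"
  shows "(f has_real_derivative deriv f t) (at t)" "smooth_on UNIV (deriv f)"
proof -
  have "fd f t v = fd f t 1 * v" for t v
    using linear_cmul[OF smooth_on_fd_linear[OF assms UNIV_I], of t v 1] by simp
  then have "(f has_real_derivative fd f t 1) (at t)" for t
    unfolding has_field_derivative_def using smooth_on_has_derivative[OF assms UNIV_I, of t] by (metis ext)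
  moreover from this have "deriv f = (\<lambda>t. fd f t 1)" using DERIV_imp_deriv by blast
  ultimately have "deriv f = (\<lambda>t. fd f t 1)" "(f has_real_derivative deriv f t) (at t)" by auto
  then show "(f has_real_derivative deriv f t) (at t)" "smooth_on UNIV (deriv f)"
    using smooth_on_fd[OF assms] by auto
qed

lemma C2_compose_real:
  fixes u :: "'e::euclidean_space \<Rightarrow> real"
  assumes U: "open U" and u: "smooth_on U u"
    and F: "\<And>t. (F has_real_derivative F' t) (at t)" "\<And>t. (F' has_real_derivative F'' t) (at t)"
      "continuous_on UNIV F''"
  shows "Ck_on 2 U (\<lambda>x. F (u x))"
proof -
  have "continuous_on UNIV F'" using DERIV_isCont[OF F(2)] by (simp add: continuous_at_imp_continuous_on)
  then have "continuous_on U (\<lambda>x. F' (u x))" "continuous_on U (\<lambda>x. F'' (u x))"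
    using continuous_on_compose2[OF _ smooth_on_continuous[OF u]] F(3) by blast+
  then have "continuous_on U (\<lambda>x. F' (u x) * fd (\<lambda>x. fd u x v) x w + F'' (u x) * (fd u x w * fd u x v))" for v w
    by (intro continuous_on_add continuous_on_mult) (auto intro!: smooth_on_continuous u smooth_on_fd)
  then have "continuous_on U (\<lambda>x. fd (\<lambda>x. fd (\<lambda>x. F (u x)) x v) x w)" for v w
    by (rule continuous_on_eq) (simp add: fd_eqI[OF fd_fd_compose_real[OF U _ u F(1,2)]])
  moreover have "(\<lambda>x. F (u x)) differentiable at x" if "x \<in> U" for x
    using has_derivative_real_chain[OF F(1) smooth_on_has_derivative[OF u that]] by (auto simp: differentiable_def)
  moreover have "(\<lambda>x. fd (\<lambda>x. F (u x)) x v) differentiable at x" if "x \<in> U" for x v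
    using fd_fd_compose_real[OF U that u F(1,2)] by (auto simp: differentiable_def)
  ultimately show ?thesis by (simp add: numeral_2_eq_2)
qed

section \<open>Riemannian geometry in coordinates\<close>

definition inner_form :: "('e::euclidean_space \<Rightarrow> 'e \<Rightarrow> real) \<Rightarrow> bool" where
  "inner_form G \<longleftrightarrow> bilinear G \<and> (\<forall>v w. G v w = G w v) \<and> (\<forall>v. v \<noteq> 0 \<longrightarrow> 0 < G v v)"

lemma inner_form_sym: "inner_form G \<Longrightarrow> G v w = G w v"
  by (simp add: inner_form_def)

lemma inner_form_bilinear:
  assumes "inner_form G"
  shows "G (u + v) w = G u w + G v w" "G w (u + v) = G w u + G w v"
    "G (u - v) w = G u w - G v w" "G w (u - v) = G w u - G w v"
    "G (c *\<^sub>R u) w = c * G u w" "G w (c *\<^sub>R u) = c * G w u" "G 0 w = 0" "G w 0 = 0"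
  using assms unfolding inner_form_def
  by (auto simp: bilinear_ladd bilinear_radd bilinear_lsub bilinear_rsub bilinear_lmul bilinear_rmul bilinear_lzero bilinear_rzero)

lemma inner_form_linear: "inner_form G \<Longrightarrow> linear (G v)" "inner_form G \<Longrightarrow> linear (\<lambda>v. G v w)"
  by (auto simp: inner_form_def bilinear_def)

lemma inner_form_eq_0_iff: "inner_form G \<Longrightarrow> G v v = 0 \<longleftrightarrow> v = 0"
  using inner_form_bilinear(7)[of G v] by (auto simp: inner_form_def)

lemma inner_form_nonneg: "inner_form G \<Longrightarrow> 0 \<le> G v v"
  using inner_form_bilinear(7)[of G 0] by (cases "v = 0") (auto simp: inner_form_def intro: less_imp_le)

lemma inner_form_eqI:
  assumes G: "inner_form G" and "\<And>z. G u z = G u' z"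
  shows "u = u'"
proof -
  have "G (u - u') (u - u') = 0" using assms by (simp add: inner_form_bilinear)
  then show ?thesis using inner_form_eq_0_iff[OF G] by simp
qed

lemma sharp_unique:
  assumes "inner_form G" "\<And>z. G u z = \<phi> z"
  shows "sharp G \<phi> = u"
  unfolding sharp_def using assms inner_form_eqI[OF assms(1)] by (intro the_equality) auto

text \<open>By positivity \<open>u \<mapsto> G u\<close> is injective, hence onto the dual space, which has the same dimension.\<close>

lemma sharp_works:
  fixes G :: "'e::euclidean_space \<Rightarrow> 'e \<Rightarrow> real"
  assumes G: "inner_form G" and "linear \<phi>"
  shows "G (sharp G \<phi>) z = \<phi> z"
proof -
  define T where "T u = (\<Sum>b\<in>Basis. G u b *\<^sub>R b)" for u
  have T: "T u \<bullet> b = G u b" if "b \<in> Basis" for u b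
    using that by (simp add: T_def inner_sum_left inner_Basis if_distrib cong: if_cong)
  have lin: "linear T"
    by (rule linearI; rule euclidean_eqI) (simp_all add: T inner_form_bilinear[OF G] inner_add_left)
  have "u = 0" if "T u = 0" for u
  proof -
    have "G u b = 0" if "b \<in> Basis" for b using T[OF that, of u] \<open>T u = 0\<close> by simp
    then have "G u u = 0" using linear_expand_Basis[OF inner_form_linear(1)[OF G], of u u] by simp
    then show ?thesis using inner_form_eq_0_iff[OF G] by simp
  qed
  then have "inj T" using lin by (simp add: linear_injective_0)
  then have "surj T" using lin by (simp add: linear_injective_imp_surjective)
  then obtain u where u: "T u = (\<Sum>b\<in>Basis. \<phi> b *\<^sub>R b)" by (metis surjD)
  have "G u b = \<phi> b" if "b \<in> Basis" for b
    using T[OF that, of u] that by (simp add: u inner_sum_left inner_Basis if_distrib cong: if_cong)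
  then have "G u z = \<phi> z" for z
    using linear_expand_Basis[OF inner_form_linear(1)[OF G], of u z] linear_expand_Basis[OF assms(2), of z] by simp
  then show ?thesis using sharp_unique[OF G] by blast
qed

text \<open>The trace of \<open>G\<close> is the dimension, and that of \<open>\<phi> \<otimes> \<phi>\<close> is the squared length of \<open>\<phi>\<close> with respect to \<open>G\<close>.
The Hessians of all functions of the height have this form.\<close>

lemma metric_trace_combination:
  fixes G :: "'e::euclidean_space \<Rightarrow> 'e \<Rightarrow> real"
  assumes G: "inner_form G" and \<phi>: "linear \<phi>"
  shows "metric_trace G (\<lambda>v w. c * G v w + d * (\<phi> v * \<phi> w)) = c * DIM('e) + d * \<phi> (sharp G \<phi>)"
proof -
  have "sharp G (\<lambda>w. c * G v w + d * (\<phi> v * \<phi> w)) = c *\<^sub>R v + (d * \<phi> v) *\<^sub>R sharp G \<phi>" for v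
    by (rule sharp_unique[OF G]) (simp add: inner_form_bilinear[OF G] sharp_works[OF G \<phi>])
  moreover have "\<phi> (sharp G \<phi>) = (\<Sum>b\<in>Basis. \<phi> b * (sharp G \<phi> \<bullet> b))"
    using linear_expand_Basis[OF \<phi>, of "sharp G \<phi>"] by (simp add: mult.commute)
  ultimately show ?thesis
    by (simp add: metric_trace_def endo_trace_def inner_add_left sum.distrib sum_distrib_left mult.assoc
        flip: sum_distrib_left)
qed

definition metric_on :: "'e::euclidean_space set \<Rightarrow> ('e \<Rightarrow> 'e \<Rightarrow> 'e \<Rightarrow> real) \<Rightarrow> bool" where
  "metric_on U G \<longleftrightarrow> open U \<and> (\<forall>x\<in>U. inner_form (G x)) \<and> (\<forall>x\<in>U. \<forall>v w. (\<lambda>x. G x v w) differentiable (at x))"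

text \<open>The value of \<open>G (\<nabla>\<^sub>v w) z\<close> for fields with constant components.\<close>

definition koszul :: "('e::euclidean_space \<Rightarrow> 'e \<Rightarrow> 'e \<Rightarrow> real) \<Rightarrow> 'e \<Rightarrow> 'e \<Rightarrow> 'e \<Rightarrow> 'e \<Rightarrow> real" where
  "koszul G y v w z = (fd (\<lambda>x. G x w z) y v + fd (\<lambda>x. G x v z) y w - fd (\<lambda>x. G x v w) y z) / 2"

definition coord_christoffel :: "('e::euclidean_space \<Rightarrow> 'e \<Rightarrow> 'e \<Rightarrow> real) \<Rightarrow> 'e \<Rightarrow> 'e \<Rightarrow> 'e \<Rightarrow> 'e" where
  "coord_christoffel G y v w = sharp (G y) (koszul G y v w)"

definition coord_sff :: "('e::euclidean_space \<Rightarrow> 'e \<Rightarrow> 'e \<Rightarrow> real) \<Rightarrow> ('d::euclidean_space \<Rightarrow> 'd \<Rightarrow> 'd \<Rightarrow> real) \<Rightarrow>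
    ('e \<Rightarrow> 'd) \<Rightarrow> 'e \<Rightarrow> 'e \<Rightarrow> 'e \<Rightarrow> 'd" where
  "coord_sff G H \<Phi> y v w = fd (\<lambda>x. fd \<Phi> x w) y v
     + coord_christoffel H (\<Phi> y) (fd \<Phi> y v) (fd \<Phi> y w) - fd \<Phi> y (coord_christoffel G y v w)"

lemma metric_on_D:
  assumes "metric_on U G"
  shows "open U" "x \<in> U \<Longrightarrow> inner_form (G x)" "x \<in> U \<Longrightarrow> (\<lambda>x. G x v w) differentiable (at x)"
  using assms by (auto simp: metric_on_def)

lemma metric_on_cong:
  assumes "metric_on U G" "\<And>x v w. x \<in> U \<Longrightarrow> G x v w = G' x v w"
  shows "metric_on U G'"
proof -
  note G = metric_on_D[OF assms(1)]
  have "(\<lambda>x. G' x v w) differentiable (at x)" if "x \<in> U" for x v w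
    using assms(2) by (intro differentiable_transform_open[OF G(3)[OF that] G(1) that])
  moreover have "G' x = G x" if "x \<in> U" for x using assms(2)[OF that] by (simp add: fun_eq_iff)
  ultimately show ?thesis using G by (simp add: metric_on_def)
qed

lemma metric_on_subset: "metric_on U G \<Longrightarrow> V \<subseteq> U \<Longrightarrow> open V \<Longrightarrow> metric_on V G"
  by (auto simp: metric_on_def)

lemma fd_metric_linear:
  assumes "metric_on U G" "y \<in> U"
  shows "linear (\<lambda>z. fd (\<lambda>x. G x w z) y v)"
proof -
  note U = metric_on_D[OF assms(1)]
  have der: "((\<lambda>x. G x w z) has_derivative fd (\<lambda>x. G x w z) y) (at y)" for z
    using U(3)[OF assms(2)] frechet_derivative_works by blast
  show ?thesis
  proof (rule linearI)
    fix z z'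
    have "((\<lambda>x. G x w z + G x w z') has_derivative (\<lambda>v. fd (\<lambda>x. G x w z) y v + fd (\<lambda>x. G x w z') y v)) (at y)"
      by (intro has_derivative_add der)
    then have "((\<lambda>x. G x w (z + z')) has_derivative (\<lambda>v. fd (\<lambda>x. G x w z) y v + fd (\<lambda>x. G x w z') y v)) (at y)"
      by (rule has_derivative_transform_within_open[OF _ U(1) assms(2)]) (simp add: inner_form_bilinear[OF U(2)])
    then show "fd (\<lambda>x. G x w (z + z')) y v = fd (\<lambda>x. G x w z) y v + fd (\<lambda>x. G x w z') y v"
      by (rule fd_eqI)
  next
    fix c z
    have "((\<lambda>x. c * G x w z) has_derivative (\<lambda>v. c * fd (\<lambda>x. G x w z) y v)) (at y)"
      by (intro has_derivative_mult_right der)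
    then have "((\<lambda>x. G x w (c *\<^sub>R z)) has_derivative (\<lambda>v. c * fd (\<lambda>x. G x w z) y v)) (at y)"
      by (rule has_derivative_transform_within_open[OF _ U(1) assms(2)]) (simp add: inner_form_bilinear[OF U(2)])
    then show "fd (\<lambda>x. G x w (c *\<^sub>R z)) y v = c *\<^sub>R fd (\<lambda>x. G x w z) y v"
      by (auto dest: fd_eqI)
  qed
qed

lemma koszul_linear:
  assumes "metric_on U G" "y \<in> U"
  shows "linear (koszul G y v w)"
proof -
  have "linear (fd (\<lambda>x. G x v w) y)" by (rule fd_linear[OF metric_on_D(3)[OF assms]])
  then show ?thesis
    unfolding koszul_def
    by (intro linearI)
      (simp_all add: linear_add linear_cmul linear_add[OF fd_metric_linear[OF assms]]
        linear_cmul[OF fd_metric_linear[OF assms]] algebra_simps add_divide_distrib diff_divide_distrib)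
qed

lemma coord_christoffel_works:
  assumes "metric_on U G" "y \<in> U"
  shows "G y (coord_christoffel G y v w) z = koszul G y v w z"
  unfolding coord_christoffel_def
  by (rule sharp_works[OF metric_on_D(2)[OF assms] koszul_linear[OF assms]])

lemma fd_pullback_metric:
  assumes G: "metric_on U G" and H: "metric_on V H" and y: "y \<in> U" and \<Phi>: "smooth_on U \<Phi>" "\<Phi> ` U \<subseteq> V"
    and iso: "\<And>x v w. x \<in> U \<Longrightarrow> G x v w = H (\<Phi> x) (fd \<Phi> x v) (fd \<Phi> x w)"
  shows "fd (\<lambda>x. G x v w) y z = fd (\<lambda>x. H x (fd \<Phi> y v) (fd \<Phi> y w)) (\<Phi> y) (fd \<Phi> y z)
    + H (\<Phi> y) (fd (\<lambda>x. fd \<Phi> x v) y z) (fd \<Phi> y w) + H (\<Phi> y) (fd \<Phi> y v) (fd (\<lambda>x. fd \<Phi> x w) y z)"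
proof (rule fd_eqI)
  note U = metric_on_D(1)[OF G]
  have \<Phi>y: "\<Phi> y \<in> V" using \<Phi>(2) y by blast
  have "((\<lambda>x. H (\<Phi> x) v w) has_derivative (\<lambda>z. fd (\<lambda>x. H x v w) (\<Phi> y) (fd \<Phi> y z))) (at y)" for v w
    by (rule has_derivative_compose[OF smooth_on_has_derivative[OF \<Phi>(1) y]])
       (use metric_on_D(3)[OF H \<Phi>y] frechet_derivative_works in blast)
  from has_derivative_bilinear_family[where B = "\<lambda>x. H (\<Phi> x)", OF U y _ this smooth_on_has_derivative[OF smooth_on_fd[OF \<Phi>(1), of v] y]
      smooth_on_has_derivative[OF smooth_on_fd[OF \<Phi>(1), of w] y]]
  have "((\<lambda>x. H (\<Phi> x) (fd \<Phi> x v) (fd \<Phi> x w)) has_derivative (\<lambda>z. fd (\<lambda>x. H x (fd \<Phi> y v) (fd \<Phi> y w)) (\<Phi> y) (fd \<Phi> y z)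
    + H (\<Phi> y) (fd (\<lambda>x. fd \<Phi> x v) y z) (fd \<Phi> y w) + H (\<Phi> y) (fd \<Phi> y v) (fd (\<lambda>x. fd \<Phi> x w) y z))) (at y)"
    using metric_on_D(2)[OF H] \<Phi>(2) by (auto simp: inner_form_def)
  then show "((\<lambda>x. G x v w) has_derivative (\<lambda>z. fd (\<lambda>x. H x (fd \<Phi> y v) (fd \<Phi> y w)) (\<Phi> y) (fd \<Phi> y z)
    + H (\<Phi> y) (fd (\<lambda>x. fd \<Phi> x v) y z) (fd \<Phi> y w) + H (\<Phi> y) (fd \<Phi> y v) (fd (\<lambda>x. fd \<Phi> x w) y z))) (at y)"
    by (rule has_derivative_transform_within_open[OF _ U y]) (simp add: iso)
qed

text \<open>The second fundamental form is normal. The product rule expresses the Koszul formula of the induced metric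
\<open>G\<close> by that of \<open>H\<close> along \<open>\<Phi>\<close> and by six terms with second derivatives of \<open>\<Phi>\<close>. By the symmetry of
second derivatives, four of these cancel and the other two agree.\<close>

lemma coord_sff_normal:
  assumes G: "metric_on U G" and H: "metric_on V H" and y: "y \<in> U" and \<Phi>: "smooth_on U \<Phi>" "\<Phi> ` U \<subseteq> V"
    and iso: "\<And>x v w. x \<in> U \<Longrightarrow> G x v w = H (\<Phi> x) (fd \<Phi> x v) (fd \<Phi> x w)"
  shows "H (\<Phi> y) (coord_sff G H \<Phi> y v w) (fd \<Phi> y z) = 0"
proof -
  have \<Phi>y: "\<Phi> y \<in> V" using \<Phi>(2) y by blast
  note Hy = metric_on_D(2)[OF H \<Phi>y]
  note sym = mixed_derivatives_commute[OF metric_on_D(1)[OF G] \<Phi>(1) y]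
  have pull: "fd (\<lambda>x. G x v w) y z = fd (\<lambda>x. H x (fd \<Phi> y v) (fd \<Phi> y w)) (\<Phi> y) (fd \<Phi> y z)
    + H (\<Phi> y) (fd (\<lambda>x. fd \<Phi> x v) y z) (fd \<Phi> y w) + H (\<Phi> y) (fd \<Phi> y v) (fd (\<lambda>x. fd \<Phi> x w) y z)" for v w z
    by (rule fd_pullback_metric[OF G H y \<Phi>]) (rule iso)
  have "H (\<Phi> y) (fd \<Phi> y (coord_christoffel G y v w)) (fd \<Phi> y z) = koszul G y v w z"
    using coord_christoffel_works[OF G y] iso[OF y] by simp
  also have "\<dots> = koszul H (\<Phi> y) (fd \<Phi> y v) (fd \<Phi> y w) (fd \<Phi> y z) + H (\<Phi> y) (fd (\<lambda>x. fd \<Phi> x w) y v) (fd \<Phi> y z)"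
    unfolding koszul_def pull sym[of z w] sym[of z v] sym[of v w]
    by (simp add: inner_form_sym[OF Hy, of "fd \<Phi> y _"] add_divide_distrib diff_divide_distrib)
  finally show ?thesis
    unfolding coord_sff_def using coord_christoffel_works[OF H \<Phi>y] by (simp add: inner_form_bilinear[OF Hy])
qed

text \<open>The second fundamental form of a composition is \<open>d\<Phi>(II\<^sub>\<alpha>) + II\<^sub>\<Phi>(d\<alpha>, d\<alpha>)\<close>. This is the chain rule for second
derivatives; the Christoffel symbols of the intermediate metric \<open>H\<close> enter with opposite signs.\<close>

lemma coord_sff_compose:
  assumes U: "open U" "y \<in> U" and \<alpha>: "smooth_on U \<alpha>" "\<alpha> ` U \<subseteq> V" and V: "open V" and \<Phi>: "smooth_on V \<Phi>"
  shows "coord_sff G K (\<lambda>x. \<Phi> (\<alpha> x)) y v w =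
    fd \<Phi> (\<alpha> y) (coord_sff G H \<alpha> y v w) + coord_sff H K \<Phi> (\<alpha> y) (fd \<alpha> y v) (fd \<alpha> y w)"
proof -
  have \<alpha>V: "\<alpha> x \<in> V" if "x \<in> U" for x using \<alpha>(2) that by blast
  have 1: "fd (\<lambda>x. \<Phi> (\<alpha> x)) x w = fd \<Phi> (\<alpha> x) (fd \<alpha> x w)" if "x \<in> U" for x w
    using that by (intro fd_compose) (auto intro: smooth_on_differentiable \<alpha> \<Phi> \<alpha>V)
  have "((\<lambda>x. fd \<Phi> (\<alpha> x) (fd \<alpha> x w)) has_derivative
      (\<lambda>v. fd (\<lambda>x. fd \<Phi> x (fd \<alpha> y w)) (\<alpha> y) (fd \<alpha> y v) + fd \<Phi> (\<alpha> y) (fd (\<lambda>x. fd \<alpha> x w) y v))) (at y)"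
    by (rule has_derivative_linear_family[OF U, of "\<lambda>x. fd \<Phi> (\<alpha> x)" "\<lambda>v u. fd (\<lambda>x. fd \<Phi> x u) (\<alpha> y) (fd \<alpha> y v)"])
       (auto intro!: smooth_on_fd_linear[OF \<Phi>] \<alpha>V has_derivative_compose[OF smooth_on_has_derivative[OF \<alpha>(1) U(2)]]
         smooth_on_has_derivative smooth_on_fd \<Phi> \<alpha> U)
  then have "((\<lambda>x. fd (\<lambda>x. \<Phi> (\<alpha> x)) x w) has_derivative
      (\<lambda>v. fd (\<lambda>x. fd \<Phi> x (fd \<alpha> y w)) (\<alpha> y) (fd \<alpha> y v) + fd \<Phi> (\<alpha> y) (fd (\<lambda>x. fd \<alpha> x w) y v))) (at y)"
    by (rule has_derivative_transform_within_open[OF _ U]) (simp add: 1)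
  then have "fd (\<lambda>x. fd (\<lambda>x. \<Phi> (\<alpha> x)) x w) y v =
      fd (\<lambda>x. fd \<Phi> x (fd \<alpha> y w)) (\<alpha> y) (fd \<alpha> y v) + fd \<Phi> (\<alpha> y) (fd (\<lambda>x. fd \<alpha> x w) y v)"
    by (rule fd_eqI)
  then show ?thesis
    unfolding coord_sff_def using smooth_on_fd_linear[OF \<Phi> \<alpha>V[OF U(2)]] U
    by (simp add: 1 linear_add linear_diff algebra_simps)
qed

definition coord_hess :: "('e::euclidean_space \<Rightarrow> 'e \<Rightarrow> 'e \<Rightarrow> real) \<Rightarrow> ('e \<Rightarrow> real) \<Rightarrow> 'e \<Rightarrow> 'e \<Rightarrow> 'e \<Rightarrow> real" where
  "coord_hess G u y v w = fd (\<lambda>x. fd u x w) y v - fd u y (coord_christoffel G y v w)"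

lemma coord_hess_compose:
  fixes u :: "'e::euclidean_space \<Rightarrow> real"
  assumes "open U" "y \<in> U" "smooth_on U u"
    and F: "\<And>t. (F has_real_derivative F' t) (at t)" "\<And>t. (F' has_real_derivative F'' t) (at t)"
  shows "coord_hess G (\<lambda>x. F (u x)) y v w =
    F' (u y) * coord_hess G u y v w + F'' (u y) * (fd u y v * fd u y w)"
  unfolding coord_hess_def
  using fd_eqI[OF fd_fd_compose_real[OF assms]]
    fd_eqI[OF has_derivative_real_chain[OF F(1) smooth_on_has_derivative[OF assms(3,2)]]]
  by (simp add: algebra_simps)

definition warp :: "(real \<Rightarrow> real) \<Rightarrow> ('e \<Rightarrow> 'e \<Rightarrow> 'e \<Rightarrow> real) \<Rightarrow> real \<times> 'e \<Rightarrow> real \<times> 'e \<Rightarrow> real \<times> 'e \<Rightarrow> real" where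
  "warp f P p v w = fst v * fst w + (f (fst p))\<^sup>2 * P (snd p) (snd v) (snd w)"

lemma has_derivative_warp:
  assumes P: "metric_on V P" and x: "x \<in> V" and f: "\<And>t. (f has_real_derivative f' t) (at t)"
  shows "((\<lambda>p. warp f P p v w) has_derivative
    (\<lambda>z. (f t)\<^sup>2 * fd (\<lambda>x. P x (snd v) (snd w)) x (snd z) + 2 * f t * f' t * fst z * P x (snd v) (snd w))) (at (t, x))"
proof -
  have P': "((\<lambda>p. P (snd p) (snd v) (snd w)) has_derivative (\<lambda>z. fd (\<lambda>x. P x (snd v) (snd w)) x (snd z))) (at (t, x))"
    by (rule has_derivative_compose[OF has_derivative_snd[OF has_derivative_ident]])
       (use metric_on_D(3)[OF P x] frechet_derivative_works in auto)
  have f': "((\<lambda>p. f (fst p)) has_derivative (\<lambda>z. f' t * fst z)) (at (t, x))"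
    using has_derivative_real_chain[OF f has_derivative_fst[OF has_derivative_ident], of "(t, x)"] by simp
  show ?thesis
    unfolding warp_def power2_eq_square
    by (rule has_derivative_eq_rhs, rule has_derivative_add[OF has_derivative_const
        has_derivative_mult[OF has_derivative_mult[OF f' f'] P']]) (auto simp: algebra_simps)
qed

lemma metric_on_warp:
  assumes P: "metric_on V P" and f: "\<And>t. (f has_real_derivative f' t) (at t)" "\<And>t. 0 < f t"
  shows "metric_on (UNIV \<times> V) (warp f P)"
  unfolding metric_on_def
proof (intro conjI ballI allI)
  note V = metric_on_D[OF P]
  show "open (UNIV \<times> V)" using V(1) by (simp add: open_Times)
  fix p :: "real \<times> 'a" assume p: "p \<in> UNIV \<times> V"
  then have x: "snd p \<in> V" by auto
  note I = V(2)[OF x]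
  show "inner_form (warp f P p)"
    unfolding inner_form_def
  proof (intro conjI allI impI)
    show "bilinear (warp f P p)"
      unfolding bilinear_def by (auto intro!: linearI simp: warp_def inner_form_bilinear[OF I] algebra_simps)
    show "warp f P p v w = warp f P p w v" for v w
      using inner_form_sym[OF I] by (simp add: warp_def)
    show "0 < warp f P p v v" if "v \<noteq> 0" for v
    proof (cases "snd v = 0")
      case True
      then have "fst v \<noteq> 0" using that by (simp add: prod_eq_iff)
      then have "0 < fst v * fst v" by (metis not_real_square_gt_zero)
      then show ?thesis using True by (simp add: warp_def inner_form_bilinear[OF I])
    next
      case False
      then have "0 < (f (fst p))\<^sup>2 * P (snd p) (snd v) (snd v)"
        using I f(2)[of "fst p"] by (simp add: inner_form_def)
      then show ?thesis by (simp add: warp_def add_nonneg_pos)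
    qed
  qed
  show "(\<lambda>p. warp f P p v w) differentiable (at p)" for v w
    using has_derivative_warp[OF P x f(1), of v w "fst p"] unfolding differentiable_def by auto
qed

text \<open>The slices of a warped product are umbilical: pairing with \<open>\<partial>\<^sub>t = (1, 0)\<close> in the Koszul formula leaves only the
\<open>t\<close>-derivative of the factor \<open>f\<^sup>2\<close>.\<close>

lemma fst_christoffel_warp:
  assumes P: "metric_on V P" and x: "x \<in> V" and f: "\<And>t. (f has_real_derivative f' t) (at t)" "\<And>t. 0 < f t"
    and K: "\<And>p v w. p \<in> UNIV \<times> V \<Longrightarrow> K p v w = warp f P p v w"
  shows "fst (coord_christoffel K (t, x) v w) = - (f t * f' t * P x (snd v) (snd w))"
proof -
  note I = metric_on_D(2)[OF P]
  have U: "open (UNIV \<times> V)" "(t, x) \<in> UNIV \<times> V"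
    using metric_on_D(1)[OF P] x by (auto simp: open_Times)
  have met: "metric_on (UNIV \<times> V) K"
    by (rule metric_on_cong[OF metric_on_warp[OF P f]]) (simp add: K)
  have der: "((\<lambda>p. K p v w) has_derivative
    (\<lambda>z. (f t)\<^sup>2 * fd (\<lambda>x. P x (snd v) (snd w)) x (snd z) + 2 * f t * f' t * fst z * P x (snd v) (snd w))) (at (t, x))" for v w
    by (rule has_derivative_transform_within_open[OF has_derivative_warp[OF P x f(1)] U]) (simp add: K)
  have const: "fd (\<lambda>p. K p w (1, 0)) (t, x) z = 0" for w z
  proof -
    have "((\<lambda>p. K p w (1, 0)) has_derivative (\<lambda>z. 0)) (at (t, x))"
      by (rule has_derivative_transform_within_open[OF has_derivative_const[of "fst w"] U])
         (auto simp: K warp_def inner_form_bilinear[OF I])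
    then show ?thesis by (rule fd_eqI)
  qed
  have lin: "linear (fd (\<lambda>x. P x (snd v) (snd w)) x)"
    using fd_linear metric_on_D(3)[OF P x] by blast
  have "fst (coord_christoffel K (t, x) v w) = K (t, x) (coord_christoffel K (t, x) v w) (1, 0)"
    using U(2) by (simp add: K warp_def inner_form_bilinear[OF I[OF x]])
  also have "\<dots> = koszul K (t, x) v w (1, 0)"
    by (rule coord_christoffel_works[OF met U(2)])
  also have "\<dots> = - (f t * f' t * P x (snd v) (snd w))"
    unfolding koszul_def const fd_eqI[OF der] by (simp add: linear_0[OF lin])
  finally show ?thesis .
qed

text \<open>For a totally geodesic map \<open>\<alpha>\<close> into the warped product, the first component of the equation \<open>II\<^sub>\<alpha> = 0\<close> gives the
Hessian of the height as minus the \<open>t\<close>-component of the ambient Christoffel symbols. The metric of \<open>P\<close> is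
then eliminated by \<open>f\<^sup>2 P = G - dh \<otimes> dh\<close>.\<close>

lemma coord_hess_height:
  fixes \<alpha> :: "'l::euclidean_space \<Rightarrow> real \<times> 'e::euclidean_space"
  assumes P: "metric_on V P" and f: "\<And>t. (f has_real_derivative f' t) (at t)" "\<And>t. 0 < f t"
    and K: "\<And>p v w. p \<in> UNIV \<times> V \<Longrightarrow> K p v w = warp f P p v w"
    and \<alpha>: "open U" "y \<in> U" "smooth_on U \<alpha>" "\<alpha> ` U \<subseteq> UNIV \<times> V"
    and iso: "\<And>v w. G y v w = K (\<alpha> y) (fd \<alpha> y v) (fd \<alpha> y w)"
    and sff: "coord_sff G K \<alpha> y v w = 0"
  shows "coord_hess G (\<lambda>x. fst (\<alpha> x)) y v w = f' (fst (\<alpha> y)) / f (fst (\<alpha> y)) *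
    (G y v w - fd (\<lambda>x. fst (\<alpha> x)) y v * fd (\<lambda>x. fst (\<alpha> x)) y w)"
proof -
  obtain t x where tx: "\<alpha> y = (t, x)" by (cases "\<alpha> y")
  have x: "x \<in> V" "(t, x) \<in> UNIV \<times> V" using \<alpha>(2,4) tx by auto
  have fst': "fd (\<lambda>x. fst (\<beta> x)) z v = fst (fd \<beta> z v)" if "smooth_on U \<beta>" "z \<in> U" for \<beta> :: "'l \<Rightarrow> real \<times> 'e" and z v
    by (rule fd_eqI[OF has_derivative_fst[OF smooth_on_has_derivative[OF that]]])
  have sm: "smooth_on U (\<lambda>x. fd \<alpha> x w)" by (rule smooth_on_fd[OF \<alpha>(3)])
  have "fd (\<lambda>x. fst (fd \<alpha> x w)) y = fd (\<lambda>x. fd (\<lambda>x. fst (\<alpha> x)) x w) y"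
    by (rule fd_cong[OF \<alpha>(1,2)])
      (use fst'[OF \<alpha>(3)] smooth_on_differentiable[OF smooth_on_bounded_linear[OF bounded_linear_fst \<alpha>(1) sm] \<alpha>(2)] in auto)
  then have "fd (\<lambda>x. fd (\<lambda>x. fst (\<alpha> x)) x w) y v = fst (fd (\<lambda>x. fd \<alpha> x w) y v)"
    using fst'[OF sm \<alpha>(2)] by metis
  then have "coord_hess G (\<lambda>x. fst (\<alpha> x)) y v w
      = fst (coord_sff G K \<alpha> y v w - coord_christoffel K (\<alpha> y) (fd \<alpha> y v) (fd \<alpha> y w))"
    unfolding coord_hess_def coord_sff_def by (simp add: fst'[OF \<alpha>(3,2)])
  also have "\<dots> = f t * f' t * P x (snd (fd \<alpha> y v)) (snd (fd \<alpha> y w))"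
    using fst_christoffel_warp[OF P x(1) f K] by (simp add: sff tx)
  also have "\<dots> = f' t / f t * (G y v w - fst (fd \<alpha> y v) * fst (fd \<alpha> y w))"
    using f(2)[of t] K[OF x(2)] by (simp add: iso tx warp_def power2_eq_square)
  finally show ?thesis by (simp add: tx fst'[OF \<alpha>(3,2)])
qed

section \<open>Charts\<close>

definition is_chart :: "('p::topological_space, 'e::euclidean_space) chart \<Rightarrow> bool" where
  "is_chart c \<longleftrightarrow> open (dom c) \<and> open (coord c ` dom c) \<and>
     homeomorphism (dom c) (coord c ` dom c) (coord c) (coord_inv c)"

lemma is_chart_D:
  assumes "is_chart c"
  shows "open (dom c)" "open (coord c ` dom c)"
    "p \<in> dom c \<Longrightarrow> coord_inv c (coord c p) = p"
    "x \<in> coord c ` dom c \<Longrightarrow> coord c (coord_inv c x) = x"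
    "x \<in> coord c ` dom c \<Longrightarrow> coord_inv c x \<in> dom c"
    "continuous_on (dom c) (coord c)" "continuous_on (coord c ` dom c) (coord_inv c)"
  using assms unfolding is_chart_def homeomorphism_def by auto

lemma smooth_atlas_is_chart: "smooth_atlas A \<Longrightarrow> c \<in> A \<Longrightarrow> is_chart c"
  by (auto simp: smooth_atlas_def is_chart_def)

lemma smooth_atlas_cover:
  assumes "smooth_atlas A"
  obtains c where "c \<in> A" "p \<in> dom c" "is_chart c"
proof -
  have "p \<in> (\<Union>c\<in>A. dom c)" using assms by (simp add: smooth_atlas_def)
  then show ?thesis using that smooth_atlas_is_chart[OF assms] by blast
qed

lemma open_chart_image:
  assumes "is_chart c" "open T"
  shows "open (coord c ` (dom c \<inter> T))"
proof -
  have "coord c ` (dom c \<inter> T) = coord c ` dom c \<inter> coord_inv c -` T"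
    using is_chart_D(3-5)[OF assms(1)] by (auto intro!: image_eqI)
  then show ?thesis
    using is_chart_D(2,7)[OF assms(1)] assms(2) by (metis continuous_on_open_vimage inf_commute)
qed

lemma is_chart_cylinder:
  assumes "is_chart c"
  shows "is_chart (cylinder_chart c)"
    "x \<in> coord c ` dom c \<Longrightarrow> coord_inv (cylinder_chart c) (t, x) = (t, coord_inv c x)"
    "coord (cylinder_chart c) ` dom (cylinder_chart c) = UNIV \<times> coord c ` dom c"
proof -
  note c = is_chart_D[OF assms]
  let ?d = "cylinder_chart c"
  show im: "coord ?d ` dom ?d = UNIV \<times> coord c ` dom c"
    unfolding cylinder_chart_def by (simp add: map_prod_surj_on)
  have inj: "inj_on (coord ?d) (dom ?d)"
    using c(3) unfolding cylinder_chart_def by (auto intro!: inj_onI) metis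
  have inv: "coord_inv ?d (t, x) = (t, coord_inv c x)" if "x \<in> coord c ` dom c" for t x
  proof -
    have "coord ?d (t, coord_inv c x) = (t, x)" "(t, coord_inv c x) \<in> dom ?d"
      using c(4,5)[OF that] by (auto simp: cylinder_chart_def)
    then show ?thesis using inv_into_f_f[OF inj] by (metis coord_inv_def)
  qed
  show "x \<in> coord c ` dom c \<Longrightarrow> coord_inv (cylinder_chart c) (t, x) = (t, coord_inv c x)"
    by (rule inv)
  have "continuous_on (UNIV \<times> coord c ` dom c) (\<lambda>p. (fst p, coord_inv c (snd p)))"
    by (intro continuous_intros continuous_on_compose2[OF c(7)]) auto
  then have ci: "continuous_on (UNIV \<times> coord c ` dom c) (coord_inv ?d)"
    by (rule continuous_on_eq) (auto simp: inv)
  have "continuous_on (UNIV \<times> dom c) (\<lambda>p. (fst p, coord c (snd p)))"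
    by (intro continuous_intros continuous_on_compose2[OF c(6)]) auto
  then have cc: "continuous_on (dom ?d) (coord ?d)"
    unfolding cylinder_chart_def by (auto simp: map_prod_def split_beta)
  have 1: "coord_inv ?d (coord ?d p) = p" if "p \<in> dom ?d" for p
    using that inv c(3) by (auto simp: cylinder_chart_def)
  show "is_chart ?d"
    unfolding is_chart_def homeomorphism_def
  proof (intro conjI ballI)
    show "open (dom ?d)" using c(1) by (simp add: cylinder_chart_def open_Times)
    show "open (coord ?d ` dom ?d)" using c(2) im by (simp add: open_Times)
    show "coord_inv ?d ` coord ?d ` dom ?d = dom ?d" using 1 by force
    show "continuous_on (coord ?d ` dom ?d) (coord_inv ?d)" using ci im by simp
  qed (use 1 cc in auto)
qed

definition chart_metric :: "('p, 'e::euclidean_space) metric \<Rightarrow> ('p, 'e) chart \<Rightarrow> 'e \<Rightarrow> 'e \<Rightarrow> 'e \<Rightarrow> real" where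
  "chart_metric g c x = g c (coord_inv c x)"

lemma metric_on_chart_metric:
  assumes "riemannian_metric A g" "c \<in> A" "is_chart c"
  shows "metric_on (coord c ` dom c) (chart_metric g c)"
  unfolding metric_on_def
proof (intro conjI ballI allI)
  show "open (coord c ` dom c)" by (rule is_chart_D(2)[OF assms(3)])
  fix x assume x: "x \<in> coord c ` dom c"
  show "inner_form (chart_metric g c x)"
    using assms(1,2) is_chart_D(5)[OF assms(3) x]
    unfolding inner_form_def chart_metric_def riemannian_metric_def by blast
  show "(\<lambda>x. chart_metric g c x v w) differentiable (at x)" for v w
    using assms(1,2) smooth_on_differentiable[OF _ x] unfolding chart_metric_def riemannian_metric_def by blast
qed

lemma chart_metric_warped:
  assumes "is_chart c" "x \<in> coord c ` dom c"
  shows "chart_metric (warped_metric f g) (cylinder_chart c) (t, x) v w = warp f (chart_metric g c) (t, x) v w"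
  using is_chart_cylinder(2)[OF assms]
  by (simp add: chart_metric_def warped_metric_def warp_def split_beta)

lemma christoffel_coord:
  assumes "is_chart c" "p \<in> dom c"
  shows "christoffel g c p v w = coord_christoffel (chart_metric g c) (coord c p) v w"
  using is_chart_D(3)[OF assms]
  by (simp add: christoffel_def coord_christoffel_def koszul_def[abs_def] chart_metric_def dir_deriv_def o_def)

lemma local_rep_apply: "local_rep c d F x = coord d (F (coord_inv c x))"
  by (simp add: local_rep_def)

text \<open>Covariant derivatives on a manifold differentiate functions of the points that depend on a point through its
coordinates. Read in the chart, such a function agrees with \<open>H\<close> only on the image of the chart; being open, the image
determines the derivative.\<close>

lemma fd_chart_cong:
  assumes c: "is_chart c" "p \<in> dom c" and "(\<lambda>x. H x) differentiable (at (coord c p))"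
  shows "fd ((\<lambda>q. H (coord c q)) \<circ> coord_inv c) (coord c p) = fd H (coord c p)"
proof -
  have "fd H (coord c p) = fd ((\<lambda>q. H (coord c q)) \<circ> coord_inv c) (coord c p)"
    by (rule fd_cong[OF is_chart_D(2)[OF c(1)]]) (use assms is_chart_D(4)[OF c(1)] in auto)
  then show ?thesis by simp
qed

lemma second_fundamental_form_coord:
  assumes c: "is_chart c" and d: "is_chart d" and p: "p \<in> dom c" "F p \<in> dom d"
    and sm: "smooth_on U (local_rep c d F)" "coord c p \<in> U"
  shows "second_fundamental_form g h c d F p v w =
    coord_sff (chart_metric g c) (chart_metric h d) (local_rep c d F) (coord c p) v w"
proof -
  have "fd ((\<lambda>q. fd (local_rep c d F) (coord c q) w) \<circ> coord_inv c) (coord c p) = fd (\<lambda>x. fd (local_rep c d F) x w) (coord c p)"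
    using fd_chart_cong[OF c p(1)] smooth_on_differentiable[OF smooth_on_fd[OF sm(1)] sm(2)] by blast
  moreover have "local_rep c d F (coord c p) = coord d (F p)"
    using is_chart_D(3)[OF c p(1)] by (simp add: local_rep_apply)
  ultimately show ?thesis
    unfolding second_fundamental_form_def coord_sff_def dir_deriv_def differential_def
    using christoffel_coord[OF d p(2)] christoffel_coord[OF c p(1)] by simp
qed

lemma hessian_coord:
  assumes c: "is_chart c" "p \<in> dom c"
    and "\<And>w. (\<lambda>x. fd (u \<circ> coord_inv c) x w) differentiable (at (coord c p))"
  shows "hessian g c u p v w = coord_hess (chart_metric g c) (u \<circ> coord_inv c) (coord c p) v w"
  unfolding hessian_def coord_hess_def dir_deriv_def
  using fd_chart_cong[OF c assms(3)] christoffel_coord[OF c] by simp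

abbreviation overlap :: "('p, 'e) chart \<Rightarrow> ('q, 'd) chart \<Rightarrow> ('p \<Rightarrow> 'q) \<Rightarrow> 'e set" where
  "overlap c d F \<equiv> coord c ` (dom c \<inter> F -` dom d)"

lemma open_overlap:
  assumes "is_chart c" "is_chart d" "continuous_on UNIV F"
  shows "open (overlap c d F)"
  using open_chart_image[OF assms(1)] open_vimage[OF is_chart_D(1)[OF assms(2)] assms(3)] by blast

lemma local_rep_compose:
  assumes "is_chart c" "is_chart d" "x \<in> overlap c d F"
  shows "local_rep c e (G \<circ> F) x = local_rep d e G (local_rep c d F x)"
  using assms(3) is_chart_D(3)[OF assms(1)] is_chart_D(3)[OF assms(2)] by (auto simp: local_rep_apply)

lemma local_rep_in_overlap:
  assumes "is_chart c" "is_chart d" "x \<in> overlap c d F" "x \<in> overlap c e (G \<circ> F)"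
  shows "local_rep c d F x \<in> overlap d e G"
proof -
  obtain p where p: "x = coord c p" "p \<in> dom c" "F p \<in> dom d" using assms(3) by auto
  obtain q where q: "x = coord c q" "q \<in> dom c" "G (F q) \<in> dom e" using assms(4) by auto
  have "p = q" using is_chart_D(3)[OF assms(1)] p q by metis
  then show ?thesis using is_chart_D(3)[OF assms(1) p(2)] p q by (auto simp: local_rep_apply)
qed

lemma local_rep_in_chart:
  assumes "is_chart c" "x \<in> overlap c d F"
  shows "local_rep c d F x \<in> coord d ` dom d"
  using assms is_chart_D(3)[OF assms(1)] by (auto simp: local_rep_apply)

lemma local_rep_coord: "is_chart c \<Longrightarrow> p \<in> dom c \<Longrightarrow> local_rep c d F (coord c p) = coord d (F p)"
  by (simp add: local_rep_apply is_chart_D(3))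

lemma smooth_map_D:
  assumes "smooth_map A B F"
  shows "continuous_on UNIV F" "c \<in> A \<Longrightarrow> d \<in> B \<Longrightarrow> smooth_on (overlap c d F) (local_rep c d F)"
  using assms by (auto simp: smooth_map_def)

lemma coord_sff_cong:
  assumes "open U" "y \<in> U" "smooth_on U \<Phi>" "\<And>x. x \<in> U \<Longrightarrow> \<Phi> x = \<Psi> x"
  shows "coord_sff G H \<Phi> y v w = coord_sff G H \<Psi> y v w"
proof -
  have 1: "fd \<Phi> x = fd \<Psi> x" if "x \<in> U" for x
    by (rule fd_cong[OF assms(1) that assms(4) smooth_on_differentiable[OF assms(3) that]])
  have "fd (\<lambda>x. fd \<Phi> x w) y = fd (\<lambda>x. fd \<Psi> x w) y"
    by (rule fd_cong[OF assms(1,2) _ smooth_on_differentiable[OF smooth_on_fd[OF assms(3)] assms(2)]]) (simp add: 1)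
  then show ?thesis using 1[OF assms(2)] assms(2,4) by (simp add: coord_sff_def)
qed

lemma differential_compose:
  assumes c: "is_chart c" and d: "is_chart d" and F: "continuous_on UNIV F"
    and p: "p \<in> dom c" "F p \<in> dom d" "G (F p) \<in> dom e"
    and sm: "smooth_on (overlap c d F) (local_rep c d F)" "smooth_on (overlap d e G) (local_rep d e G)"
  shows "differential c e (G \<circ> F) p v = differential d e G (F p) (differential c d F p v)"
proof -
  have x: "coord c p \<in> overlap c d F" "coord d (F p) \<in> overlap d e G" using p by auto
  have diff: "local_rep d e G differentiable at (local_rep c d F (coord c p))"
    using smooth_on_differentiable[OF sm(2) x(2)] local_rep_coord[OF c p(1)] by metis
  have diff': "local_rep c d F differentiable at (coord c p)"
    by (rule smooth_on_differentiable[OF sm(1) x(1)])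
  have "fd (\<lambda>x. local_rep d e G (local_rep c d F x)) (coord c p) = fd (local_rep c e (G \<circ> F)) (coord c p)"
    by (rule fd_cong[OF open_overlap[OF c d F] x(1)], erule local_rep_compose[OF c d, symmetric])
       (use differentiable_chain_at[OF diff' diff] in \<open>simp add: o_def\<close>)
  then show ?thesis
    using fd_compose[OF diff diff'] by (simp add: differential_def local_rep_coord[OF c p(1)])
qed

lemma isometric_immersion_D:
  assumes "isometric_immersion A g B h F" "c \<in> A" "d \<in> B" "p \<in> dom c" "F p \<in> dom d"
  shows "g c p v w = h d (F p) (differential c d F p v) (differential c d F p w)"
  using assms by (auto simp: isometric_immersion_def)

lemma isometric_immersion_chart_metric:
  assumes "isometric_immersion A g B h F" "c \<in> A" "d \<in> B" "is_chart c" "is_chart d" "x \<in> overlap c d F"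
  shows "chart_metric g c x v w =
    chart_metric h d (local_rep c d F x) (fd (local_rep c d F) x v) (fd (local_rep c d F) x w)"
  using isometric_immersion_D[OF assms(1-3)] assms(6) is_chart_D(3)[OF assms(4)] is_chart_D(3)[OF assms(5)]
  by (auto simp: chart_metric_def differential_def local_rep_apply)

lemma laplacian_const:
  assumes "inner_form (g c p)"
  shows "laplacian g c (\<lambda>s. k) p = 0"
proof -
  have "hessian g c (\<lambda>s. k) p = (\<lambda>v w. 0 * g c p v w + 0 * (0 * 0))"
    by (simp add: hessian_def dir_deriv_def o_def fun_eq_iff)
  then show ?thesis
    using metric_trace_combination[OF assms, of "\<lambda>_. 0" 0 0] by (simp add: laplacian_def linear_zero)
qed

section \<open>The intersection is totally geodesic\<close>

text \<open>The hypotheses that make \<open>\<Sigma>\<close> totally geodesic. Parabolicity, monotonicity of \<open>f'/f\<close>, the bound of the height, and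
completeness appear in the lemmas that depend on them.\<close>

locale warped_intersection =
  fixes AQ :: "('q::{t2_space,second_countable_topology}, 'd::euclidean_space) atlas"
    and gQ :: "('q, 'd) metric"
    and AN :: "('n::{t2_space,second_countable_topology}, 'k::euclidean_space) atlas"
    and gN :: "('n, 'k) metric"
    and AP :: "('p::{t2_space,second_countable_topology}, 'e::euclidean_space) atlas"
    and gP :: "('p, 'e) metric"
    and AS :: "('s::{t2_space,second_countable_topology}, 'l::euclidean_space) atlas"
    and gS :: "('s, 'l) metric"
    and f :: "real \<Rightarrow> real"
    and \<phi> :: "real \<times> 'p \<Rightarrow> 'q"
    and \<psi> :: "'n \<Rightarrow> 'q"
    and a :: "'s \<Rightarrow> real \<times> 'p"
    and b :: "'s \<Rightarrow> 'n"
  assumes Q: "riemannian_manifold AQ gQ"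
    and N: "riemannian_manifold AN gN" "isometric_immersion AN gN AQ gQ \<psi>"
      "totally_geodesic AN gN AQ gQ \<psi>"
    and P: "riemannian_manifold AP gP"
    and f: "smooth_on UNIV f" "\<And>t. f t > 0"
    and M: "isometric_immersion (cylinder_atlas AP) (warped_metric f gP) AQ gQ \<phi>"
    and normal: "normal_submanifolds (cylinder_atlas AP) AN AS AQ gQ \<phi> \<psi> a b"
    and S: "riemannian_manifold AS gS" "isometric_immersion AS gS AQ gQ (\<phi> \<circ> a)"
begin

abbreviation gM where "gM \<equiv> warped_metric f gP"

lemma atlases: "smooth_atlas AQ" "smooth_atlas AN" "smooth_atlas AP" "smooth_atlas AS"
  and metrics: "riemannian_metric AQ gQ" "riemannian_metric AN gN" "riemannian_metric AP gP" "riemannian_metric AS gS"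
  using Q N P S by (auto simp: riemannian_manifold_def)

lemma charts: "c \<in> AQ \<Longrightarrow> is_chart c" "c' \<in> AN \<Longrightarrow> is_chart c'" "cS \<in> AS \<Longrightarrow> is_chart cS" "cP \<in> AP \<Longrightarrow> is_chart cP"
  "cM \<in> cylinder_atlas AP \<Longrightarrow> is_chart cM"
  using atlases by (auto simp: cylinder_atlas_def intro: smooth_atlas_is_chart is_chart_cylinder(1))

lemma maps: "smooth_map AN AQ \<psi>" "smooth_map (cylinder_atlas AP) AQ \<phi>" "smooth_map AS AQ (\<phi> \<circ> a)"
  "smooth_map AS (cylinder_atlas AP) a" "smooth_map AS AN b"
  using N M S normal
  by (auto simp: isometric_immersion_def immersion_def normal_submanifolds_def intersection_submanifold_def)

lemma \<phi>_a_eq_\<psi>_b: "\<phi> (a s) = \<psi> (b s)"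
proof -
  have "(\<lambda>s. (a s, b s)) ` UNIV = {(x, y). \<phi> x = \<psi> y}"
    using normal unfolding normal_submanifolds_def intersection_submanifold_def bij_betw_def by blast
  then show ?thesis by auto
qed

lemma metric_on_M:
  assumes "cP \<in> AP"
  shows "metric_on (UNIV \<times> coord cP ` dom cP) (chart_metric gM (cylinder_chart cP))"
proof (rule metric_on_cong)
  note c = charts(4)[OF assms]
  show "metric_on (UNIV \<times> coord cP ` dom cP) (warp f (chart_metric gP cP))"
    by (rule metric_on_warp[OF metric_on_chart_metric[OF metrics(3) assms c] smooth_on_UNIV_real(1)[OF f(1)] f(2)])
  show "warp f (chart_metric gP cP) x v w = chart_metric gM (cylinder_chart cP) x v w"
    if "x \<in> UNIV \<times> coord cP ` dom cP" for x v w
    using that by (cases x) (simp add: chart_metric_warped[OF c])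
qed

lemma a_isometric:
  assumes c: "c \<in> AS" "cM \<in> cylinder_atlas AP" and p: "p \<in> dom c" "a p \<in> dom cM"
  shows "gS c p v w = gM cM (a p) (differential c cM a p v) (differential c cM a p w)"
proof -
  obtain d where d: "d \<in> AQ" "\<phi> (a p) \<in> dom d" "is_chart d" using smooth_atlas_cover[OF atlases(1)] .
  have "gS c p v w = gQ d (\<phi> (a p)) (differential c d (\<phi> \<circ> a) p v) (differential c d (\<phi> \<circ> a) p w)"
    using isometric_immersion_D[OF S(2) c(1) d(1) p(1)] d(2) by simp
  also have "\<dots> = gQ d (\<phi> (a p)) (differential cM d \<phi> (a p) (differential c cM a p v))
      (differential cM d \<phi> (a p) (differential c cM a p w))"
    using differential_compose[OF charts(3)[OF c(1)] charts(5)[OF c(2)] smooth_map_D(1)[OF maps(4)] p d(2)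
        smooth_map_D(2)[OF maps(4) c] smooth_map_D(2)[OF maps(2) c(2) d(1)]] by simp
  also have "\<dots> = gM cM (a p) (differential c cM a p v) (differential c cM a p w)"
    using isometric_immersion_D[OF M c(2) d(1) p(2) d(2)] by simp
  finally show ?thesis .
qed

text \<open>The vector \<open>Z = d\<phi>(II\<^sub>a(v, w))\<close> is tangent to \<open>M\<close> and normal to \<open>\<Sigma>\<close>, hence normal to \<open>N\<close>. The second fundamental form
of \<open>\<phi> \<circ> a = \<psi> \<circ> b\<close>, decomposed through \<open>M\<close> and through \<open>N\<close>, yields
\<open>Z + II\<^sub>\<phi>(da v, da w) = d\<psi>(II\<^sub>b(v, w))\<close>, since \<open>II\<^sub>\<psi> = 0\<close>. The right-hand side is tangent to \<open>N\<close> and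
\<open>II\<^sub>\<phi>\<close> is normal to \<open>M\<close>. So pairing with \<open>Z\<close> gives \<open>|Z|\<^sup>2 = 0\<close>.\<close>

lemma second_fundamental_form_a:
  assumes c: "c \<in> AS" "cM \<in> cylinder_atlas AP" and p: "p \<in> dom c" "a p \<in> dom cM"
  shows "second_fundamental_form gS gM c cM a p v w = 0"
proof -
  obtain d where d: "d \<in> AQ" "\<phi> (a p) \<in> dom d" "is_chart d" using smooth_atlas_cover[OF atlases(1)] .
  obtain cN where cN: "cN \<in> AN" "b p \<in> dom cN" "is_chart cN" using smooth_atlas_cover[OF atlases(2)] .
  obtain cP where cP: "cP \<in> AP" "cM = cylinder_chart cP" using c(2) by (auto simp: cylinder_atlas_def)
  note cS = charts(3)[OF c(1)] and cM = charts(5)[OF c(2)]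
  define y where "y = coord c p"
  define \<alpha> where "\<alpha> = local_rep c cM a"
  define \<beta> where "\<beta> = local_rep c cN b"
  define \<Phi> where "\<Phi> = local_rep cM d \<phi>"
  define \<Psi> where "\<Psi> = local_rep cN d \<psi>"
  note defs = y_def \<alpha>_def \<beta>_def \<Phi>_def \<Psi>_def
  define GS where "GS = chart_metric gS c"
  define GM where "GM = chart_metric gM cM"
  define GQ where "GQ = chart_metric gQ d"
  define GN where "GN = chart_metric gN cN"
  note Gdefs = GS_def GM_def GQ_def GN_def
  note ca = smooth_map_D(1)[OF maps(4)] and cb = smooth_map_D(1)[OF maps(5)]
    and c\<phi> = smooth_map_D(1)[OF maps(2)] and c\<psi> = smooth_map_D(1)[OF maps(1)]
  have sm: "smooth_on (overlap c cM a) \<alpha>" "smooth_on (overlap c cN b) \<beta>"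
      "smooth_on (overlap cM d \<phi>) \<Phi>" "smooth_on (overlap cN d \<psi>) \<Psi>"
    unfolding defs using smooth_map_D(2) maps c d cN by blast+
  have y: "y \<in> overlap c cM a" "y \<in> overlap c cN b" "y \<in> overlap c d (\<phi> \<circ> a)" "y \<in> overlap c d (\<psi> \<circ> b)"
    using p d cN \<phi>_a_eq_\<psi>_b by (auto simp: defs)
  (* the domain on which both factorizations of the inclusion of the intersection are defined *)
  define U where "U = overlap c cM a \<inter> overlap c cN b \<inter> overlap c d (\<phi> \<circ> a)"
  have eqc: "\<phi> \<circ> a = \<psi> \<circ> b" using \<phi>_a_eq_\<psi>_b by (auto simp: fun_eq_iff)
  have U: "open U" "y \<in> U"
    using open_overlap[OF cS cM ca] open_overlap[OF cS cN(3) cb] open_overlap[OF cS d(3) smooth_map_D(1)[OF maps(3)]] y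
    by (auto simp: U_def)
  have \<alpha>U: "\<alpha> ` U \<subseteq> overlap cM d \<phi>"
    unfolding \<alpha>_def U_def by (rule image_subsetI, rule local_rep_in_overlap[OF cS cM]) blast+
  have \<beta>U: "\<beta> ` U \<subseteq> overlap cN d \<psi>"
    unfolding \<beta>_def U_def eqc by (rule image_subsetI, rule local_rep_in_overlap[OF cS cN(3)]) blast+
  have y_im: "\<alpha> y = coord cM (a p)" "\<beta> y = coord cN (b p)" "\<Phi> (\<alpha> y) = coord d (\<phi> (a p))"
    by (simp_all add: defs local_rep_coord[OF cS p(1)] local_rep_coord[OF cM p(2)])
  have \<Phi>_y: "\<Phi> (coord cM (a p)) = coord d (\<phi> (a p))" using y_im by simp
  have eq: "\<Phi> (\<alpha> x) = \<Psi> (\<beta> x)" if "x \<in> U" for x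
    using that local_rep_compose[OF cS cM, of x a d \<phi>] local_rep_compose[OF cS cN(3), of x b d \<psi>]
    unfolding U_def defs eqc by (metis Int_iff)
  note sm\<alpha> = smooth_on_subset[OF sm(1), of U] and sm\<beta> = smooth_on_subset[OF sm(2), of U]
  have sm\<alpha>U: "smooth_on U \<alpha>" and sm\<beta>U: "smooth_on U \<beta>" using sm\<alpha> sm\<beta> by (auto simp: U_def)
  have smo: "smooth_on (overlap c d (\<phi> \<circ> a)) (local_rep c d (\<phi> \<circ> a))"
    using smooth_map_D(2)[OF maps(3) c(1) d(1)] .
  have sm\<Theta>: "smooth_on U (\<lambda>x. \<Phi> (\<alpha> x))"
    by (rule smooth_on_cong[OF U(1) _ smooth_on_subset[OF smo]])
      (use local_rep_compose[OF cS cM, of _ a d \<phi>] in \<open>unfold U_def defs, blast+\<close>)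
  define II where "II = coord_sff GS GM \<alpha> y v w"
  define II' where "II' = coord_sff GM GQ \<Phi> (\<alpha> y) (fd \<alpha> y v) (fd \<alpha> y w)"
  define Z where "Z = fd \<Phi> (\<alpha> y) II"
  have II0: "coord_sff GN GQ \<Psi> (\<beta> y) (fd \<beta> y v) (fd \<beta> y w) = 0"
  proof -
    have "second_fundamental_form gN gQ cN d \<psi> (b p) (fd \<beta> y v) (fd \<beta> y w) = 0"
      using N(3) cN(1,2) d(1,2) \<phi>_a_eq_\<psi>_b by (simp add: totally_geodesic_def)
    then show ?thesis
      using second_fundamental_form_coord[OF cN(3) d(3) cN(2) _ sm(4)[unfolded defs]] cN(2) d(2) \<phi>_a_eq_\<psi>_b
      by (auto simp: y_im Gdefs \<Psi>_def)
  qed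
  have sum: "Z + II' = fd \<Psi> (\<beta> y) (coord_sff GS GN \<beta> y v w)"
  proof -
    have "Z + II' = coord_sff GS GQ (\<lambda>x. \<Phi> (\<alpha> x)) y v w"
      unfolding Z_def II_def II'_def
      by (rule coord_sff_compose[symmetric, OF U sm\<alpha>U \<alpha>U open_overlap[OF cM d(3) c\<phi>] sm(3)])
    also have "\<dots> = coord_sff GS GQ (\<lambda>x. \<Psi> (\<beta> x)) y v w"
      by (rule coord_sff_cong[OF U sm\<Theta> eq])
    also have "\<dots> = fd \<Psi> (\<beta> y) (coord_sff GS GN \<beta> y v w) + coord_sff GN GQ \<Psi> (\<beta> y) (fd \<beta> y v) (fd \<beta> y w)"
      by (rule coord_sff_compose[OF U sm\<beta>U \<beta>U open_overlap[OF cN(3) d(3) c\<psi>] sm(4)])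
    finally show ?thesis by (simp add: II0)
  qed
  have metM: "metric_on (UNIV \<times> coord cP ` dom cP) GM"
    unfolding GM_def cP(2) by (rule metric_on_M[OF cP(1)])
  have metS: "metric_on (overlap c cM a) GS"
    using metric_on_chart_metric[OF metrics(4) c(1) cS] open_overlap[OF cS cM ca]
    by (auto simp: metric_on_def GS_def)
  have metQ: "metric_on (coord d ` dom d) GQ"
    unfolding GQ_def by (rule metric_on_chart_metric[OF metrics(1) d(1,3)])
  have imM: "coord cM ` dom cM = UNIV \<times> coord cP ` dom cP"
    using is_chart_cylinder(3)[OF charts(4)[OF cP(1)]] cP(2) by simp
  have metM': "metric_on (overlap cM d \<phi>) GM"
    by (rule metric_on_subset[OF metM _ open_overlap[OF cM d(3) c\<phi>]]) (use imM in blast)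
  have isoS: "GS x v w = GM (\<alpha> x) (fd \<alpha> x v) (fd \<alpha> x w)" if "x \<in> overlap c cM a" for x v w
    using a_isometric[OF c] that is_chart_D(3)[OF cS] is_chart_D(3)[OF cM]
    by (auto simp: Gdefs chart_metric_def defs differential_def local_rep_apply)
  have isoM: "GM x v w = GQ (\<Phi> x) (fd \<Phi> x v) (fd \<Phi> x w)" if "x \<in> overlap cM d \<phi>" for x v w
    unfolding Gdefs defs by (rule isometric_immersion_chart_metric[OF M c(2) d(1) cM d(3) that])
  have normalS: "GM (\<alpha> y) II (fd \<alpha> y z) = 0" for z
    unfolding II_def
    by (rule coord_sff_normal[OF metS metM y(1) sm(1) _ isoS])
      (unfold \<alpha>_def imM[symmetric], rule image_subsetI, rule local_rep_in_chart[OF cS])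
  have \<alpha>y: "\<alpha> y \<in> overlap cM d \<phi>" using \<alpha>U U(2) by blast
  have normalM: "GQ (\<Phi> (\<alpha> y)) II' (fd \<Phi> (\<alpha> y) z) = 0" for z
    unfolding II'_def
    by (rule coord_sff_normal[OF metM' metQ \<alpha>y sm(3) _ isoM])
      (unfold \<Phi>_def, rule image_subsetI, rule local_rep_in_chart[OF cM])
  have innerQ: "inner_form (GQ (\<Phi> (\<alpha> y)))"
    by (rule metric_on_D(2)[OF metQ]) (use d(2) in \<open>simp add: y_im \<Phi>_y\<close>)
  have GQ_gQ: "GQ (\<Phi> (\<alpha> y)) = gQ d (\<phi> (a p))"
    using is_chart_D(3)[OF d(3,2)] by (simp add: y_im \<Phi>_y GQ_def chart_metric_def)
  have "Z \<in> tangent_image cM d \<phi> (a p)"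
    by (simp add: Z_def tangent_image_def differential_def \<Phi>_def y_im)
  moreover have "Z \<in> normal_space c d gQ (\<phi> \<circ> a) p"
  proof -
    have "differential c d (\<phi> \<circ> a) p u = fd \<Phi> (\<alpha> y) (fd \<alpha> y u)" for u
      using differential_compose[OF cS cM ca p d(2) smooth_map_D(2)[OF maps(4) c] smooth_map_D(2)[OF maps(2) c(2) d(1)]]
      by (simp add: differential_def y_im(1) flip: defs)
    then show ?thesis
      using normalS isoM[OF \<alpha>y] inner_form_sym[OF innerQ]
      by (auto simp: normal_space_def tangent_image_def Z_def simp flip: GQ_gQ)
  qed
  ultimately have "Z \<in> normal_space cN d gQ \<psi> (b p)"
    using normal c cN(1,2) d(1,2) p unfolding normal_submanifolds_def by blast
  then have "GQ (\<Phi> (\<alpha> y)) (fd \<Psi> (\<beta> y) u) Z = 0" for u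
    using \<phi>_a_eq_\<psi>_b[of p]
    by (simp add: normal_space_def tangent_image_def differential_def GQ_gQ y_im(2)[symmetric] \<Psi>_def[symmetric])
  then have "GQ (\<Phi> (\<alpha> y)) (Z + II') Z = 0" using sum by simp
  moreover have "GQ (\<Phi> (\<alpha> y)) II' Z = 0" unfolding Z_def by (rule normalM)
  ultimately have "GQ (\<Phi> (\<alpha> y)) Z Z = 0" by (simp add: inner_form_bilinear[OF innerQ])
  then have "GM (\<alpha> y) II II = 0" using isoM[OF \<alpha>y] by (simp add: Z_def)
  moreover have "inner_form (GM (\<alpha> y))" by (rule metric_on_D(2)[OF metM' \<alpha>y])
  ultimately have "II = 0" using inner_form_eq_0_iff by blast
  then show ?thesis
    using second_fundamental_form_coord[where F = a, OF cS cM p sm(1)[unfolded defs]] y(1)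
    by (simp add: II_def Gdefs defs)
qed

lemma totally_geodesic_a: "totally_geodesic AS gS (cylinder_atlas AP) gM a"
  unfolding totally_geodesic_def using second_fundamental_form_a by blast

section \<open>The height is constant\<close>

lemma height_local:
  assumes "c \<in> AS" "p \<in> dom c"
  obtains cP where "cP \<in> AP" "coord c p \<in> overlap c (cylinder_chart cP) a"
    "height a \<circ> coord_inv c = (\<lambda>x. fst (local_rep c (cylinder_chart cP) a x))"
proof -
  obtain cP where cP: "cP \<in> AP" "snd (a p) \<in> dom cP" "is_chart cP" using smooth_atlas_cover[OF atlases(3)] .
  have "a p \<in> dom (cylinder_chart cP)"
    using cP(2) by (cases "a p") (simp add: cylinder_chart_def)
  then have "coord c p \<in> overlap c (cylinder_chart cP) a" using assms by blast
  then show ?thesis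
    using that[OF cP(1)] by (simp add: height_def local_rep_apply cylinder_chart_def fun_eq_iff)
qed

lemma smooth_height:
  assumes "c \<in> AS"
  shows "smooth_on (coord c ` dom c) (height a \<circ> coord_inv c)"
  unfolding smooth_on_def
proof (intro allI Ck_on_local)
  fix k x assume "x \<in> coord c ` dom c"
  then obtain p where p: "p \<in> dom c" "x = coord c p" by auto
  obtain cP where cP: "cP \<in> AP" "coord c p \<in> overlap c (cylinder_chart cP) a"
    "height a \<circ> coord_inv c = (\<lambda>x. fst (local_rep c (cylinder_chart cP) a x))"
    using height_local[OF assms p(1)] .
  let ?d = "cylinder_chart cP"
  have d: "?d \<in> cylinder_atlas AP" using cP(1) by (simp add: cylinder_atlas_def)
  have "open (overlap c ?d a)"
    by (rule open_overlap[OF charts(3)[OF assms] charts(5)[OF d] smooth_map_D(1)[OF maps(4)]])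
  moreover from this have "smooth_on (overlap c ?d a) (\<lambda>x. fst (local_rep c ?d a x))"
    by (rule smooth_on_bounded_linear[OF bounded_linear_fst _ smooth_map_D(2)[OF maps(4) assms d]])
  then have "Ck_on k (overlap c ?d a) (height a \<circ> coord_inv c)"
    unfolding cP(3) by (rule smooth_on_Ck)
  ultimately show "\<exists>T. open T \<and> x \<in> T \<and> Ck_on k T (height a \<circ> coord_inv c)"
    using cP(2) p(2) by blast
qed

lemma hessian_height:
  assumes c: "c \<in> AS" and p: "p \<in> dom c"
  defines "dh \<equiv> fd (height a \<circ> coord_inv c) (coord c p)"
  shows "coord_hess (chart_metric gS c) (height a \<circ> coord_inv c) (coord c p) v w =
    deriv f (height a p) / f (height a p) * (gS c p v w - dh v * dh w)"
proof -
  obtain cP where cP: "cP \<in> AP" "coord c p \<in> overlap c (cylinder_chart cP) a"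
    "height a \<circ> coord_inv c = (\<lambda>x. fst (local_rep c (cylinder_chart cP) a x))"
    using height_local[OF c p] .
  define d where "d = cylinder_chart cP"
  have d: "d \<in> cylinder_atlas AP" using cP(1) by (simp add: cylinder_atlas_def d_def)
  note cS = charts(3)[OF c] and cM = charts(5)[OF d]
  have ap: "a p \<in> dom d" using cP(2) is_chart_D(3)[OF cS] p unfolding d_def by auto metis
  have U: "open (overlap c d a)" "coord c p \<in> overlap c d a"
    using open_overlap[OF cS cM smooth_map_D(1)[OF maps(4)]] cP(2) by (auto simp: d_def)
  note sm = smooth_map_D(2)[OF maps(4) c d]
  have eq: "(height a \<circ> coord_inv c) = (\<lambda>x. fst (local_rep c d a x))"
    using cP(3) unfolding d_def .
  have y: "coord_inv c (coord c p) = p" by (rule is_chart_D(3)[OF cS p])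
  have h: "fst (local_rep c d a (coord c p)) = height a p" using fun_cong[OF eq, of "coord c p"] y by simp
  have im: "local_rep c d a ` overlap c d a \<subseteq> UNIV \<times> coord cP ` dom cP"
    using is_chart_cylinder(3)[OF charts(4)[OF cP(1)]] local_rep_in_chart[OF cS] unfolding d_def
    by (metis image_subsetI)
  have iso: "chart_metric gS c (coord c p) v w = chart_metric gM d (local_rep c d a (coord c p))
      (fd (local_rep c d a) (coord c p) v) (fd (local_rep c d a) (coord c p) w)" for v w
    using a_isometric[OF c d p ap] is_chart_D(3)[OF cM ap] y
    by (simp add: chart_metric_def differential_def local_rep_coord[OF cS p])
  have sff: "coord_sff (chart_metric gS c) (chart_metric gM d) (local_rep c d a) (coord c p) v w = 0"
    using second_fundamental_form_a[OF c d p ap] second_fundamental_form_coord[OF cS cM p ap sm U(2)] by simp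
  have K: "chart_metric gM d q v w = warp f (chart_metric gP cP) q v w"
    if "q \<in> UNIV \<times> coord cP ` dom cP" for q v w
    using that chart_metric_warped[OF charts(4)[OF cP(1)]] unfolding d_def by (cases q) simp
  have "coord_hess (chart_metric gS c) (\<lambda>x. fst (local_rep c d a x)) (coord c p) v w =
    deriv f (fst (local_rep c d a (coord c p))) / f (fst (local_rep c d a (coord c p))) *
    (chart_metric gS c (coord c p) v w - fd (\<lambda>x. fst (local_rep c d a x)) (coord c p) v * fd (\<lambda>x. fst (local_rep c d a x)) (coord c p) w)"
    by (rule coord_hess_height[OF metric_on_chart_metric[OF metrics(3) cP(1) charts(4)[OF cP(1)]]
        smooth_on_UNIV_real(1)[OF f(1)] f(2) K U sm im iso sff])
  then show ?thesis unfolding h dh_def eq by (simp add: chart_metric_def y)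
qed

text \<open>Here \<open>q\<close> is \<open>|\<nabla>h|\<^sup>2\<close>: the formula is the trace of \<open>Hess F(h) = F'(h) Hess h + F''(h) dh \<otimes> dh\<close>. It is applied with
\<open>F = f\<close> and with the identity as \<open>F\<close>.\<close>

lemma laplacian_function_of_height:
  assumes c: "c \<in> AS" and p: "p \<in> dom c"
  defines "h \<equiv> height a p"
  shows "\<exists>q\<ge>0. \<forall>F F' F''. (\<forall>t. (F has_real_derivative F' t) (at t)) \<longrightarrow> (\<forall>t. (F' has_real_derivative F'' t) (at t)) \<longrightarrow>
    laplacian gS c (\<lambda>s. F (height a s)) p =
      F' h * (deriv f h / f h) * DIM('l) + (F'' h - F' h * (deriv f h / f h)) * q"
proof -
  note cS = charts(3)[OF c]
  have U: "open (coord c ` dom c)" "coord c p \<in> coord c ` dom c"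
    using is_chart_D(2)[OF cS] p by auto
  define u where "u = height a \<circ> coord_inv c"
  have sm: "smooth_on (coord c ` dom c) u" unfolding u_def by (rule smooth_height[OF c])
  define dh where "dh = fd u (coord c p)"
  have lin: "linear dh" unfolding dh_def by (rule smooth_on_fd_linear[OF sm U(2)])
  have uy: "u (coord c p) = h" by (simp add: u_def h_def is_chart_D(3)[OF cS p])
  have G: "inner_form (gS c p)"
    using metric_on_D(2)[OF metric_on_chart_metric[OF metrics(4) c cS] U(2)]
    by (simp add: chart_metric_def is_chart_D(3)[OF cS p])
  show ?thesis
  proof (intro exI[of _ "dh (sharp (gS c p) dh)"] conjI allI impI)
    show "0 \<le> dh (sharp (gS c p) dh)"
      using inner_form_nonneg[OF G, of "sharp (gS c p) dh"] sharp_works[OF G lin] by simp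
    fix F F' F'' :: "real \<Rightarrow> real"
    assume F: "\<forall>t. (F has_real_derivative F' t) (at t)" "\<forall>t. (F' has_real_derivative F'' t) (at t)"
    have eq: "(\<lambda>s. F (height a s)) \<circ> coord_inv c = (\<lambda>x. F (u x))" by (simp add: u_def o_def)
    have "(\<lambda>x. fd (\<lambda>x. F (u x)) x w) differentiable (at (coord c p))" for w
      using fd_fd_compose_real[OF U sm, of F F' F''] F unfolding differentiable_def by blast
    then have "hessian gS c (\<lambda>s. F (height a s)) p v w = coord_hess (chart_metric gS c) (\<lambda>x. F (u x)) (coord c p) v w" for v w
      using hessian_coord[OF cS p, of "\<lambda>s. F (height a s)", unfolded eq] by blast
    also have "\<dots> v w = F' h * (deriv f h / f h * (gS c p v w - dh v * dh w)) + F'' h * (dh v * dh w)" for v w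
      unfolding dh_def
      using coord_hess_compose[OF U sm, of F F' F''] F hessian_height[OF c p] by (simp add: uy flip: u_def h_def)
    also have "\<dots> v w = (F' h * (deriv f h / f h)) * gS c p v w + (F'' h - F' h * (deriv f h / f h)) * (dh v * dh w)" for v w
      by (simp add: algebra_simps)
    finally have "hessian gS c (\<lambda>s. F (height a s)) p = (\<lambda>v w. (F' h * (deriv f h / f h)) * gS c p v w
        + (F'' h - F' h * (deriv f h / f h)) * (dh v * dh w))" by (simp add: fun_eq_iff)
    then show "laplacian gS c (\<lambda>s. F (height a s)) p =
      F' h * (deriv f h / f h) * DIM('l) + (F'' h - F' h * (deriv f h / f h)) * dh (sharp (gS c p) dh)"
      unfolding laplacian_def by (simp only: metric_trace_combination[OF G lin])
  qed
qed

lemma C2_function_of_height: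
  assumes "smooth_on UNIV F"
  shows "C2_function AS (\<lambda>s. F (height a s))"
  unfolding C2_function_def
proof
  fix c assume c: "c \<in> AS"
  note F = smooth_on_UNIV_real[OF assms]
  have "Ck_on 2 (coord c ` dom c) (\<lambda>x. F ((height a \<circ> coord_inv c) x))"
    by (rule C2_compose_real[OF is_chart_D(2)[OF charts(3)[OF c]] smooth_height[OF c] F(1) smooth_on_UNIV_real(1)[OF F(2)]
        smooth_on_continuous[OF smooth_on_UNIV_real(2)[OF F(2)]]])
  then show "Ck_on 2 (coord c ` dom c) ((\<lambda>s. F (height a s)) \<circ> coord_inv c)" by (simp add: o_def)
qed

text \<open>With \<open>H = f'/f\<close> and \<open>m = dim \<Sigma>\<close>, for \<open>F = f\<close> both terms of the Laplacian of \<open>F(h)\<close> are nonnegative: the first is \<open>m f H\<^sup>2\<close>, and the coefficient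
of \<open>|\<nabla>h|\<^sup>2\<close> in the second is \<open>f'' - f' H = f H'\<close>. When \<open>f(h)\<close> is constant, both vanish, so that \<open>f'(h) = 0\<close>; then
the formula for the identity shows that \<open>h\<close> is harmonic.\<close>

lemma height_constant:
  assumes H': "\<And>t. 0 \<le> deriv (log_deriv f) t" and parabolic: "parabolic AS gS"
    and bounded: "bounded (range (height a))"
  shows "\<exists>t. \<forall>s. height a s = t"
proof -
  note f1 = smooth_on_UNIV_real[OF f(1)]
  note f2 = smooth_on_UNIV_real(1)[OF f1(2)]
  have convex: "0 \<le> deriv (deriv f) t - deriv f t * (deriv f t / f t)" for t
  proof -
    have "((\<lambda>t. deriv f t / f t) has_real_derivative (deriv (deriv f) t * f t - deriv f t * deriv f t) / (f t * f t)) (at t)"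
      by (rule DERIV_divide[OF f2 f1(1)]) (use f(2)[of t] in simp)
    then have "deriv (log_deriv f) t = (deriv (deriv f) t * f t - deriv f t * deriv f t) / (f t * f t)"
      using DERIV_imp_deriv by (simp add: log_deriv_def[abs_def])
    then have "0 \<le> deriv (log_deriv f) t * f t"
      "deriv (log_deriv f) t * f t = deriv (deriv f) t - deriv f t * (deriv f t / f t)"
      using H'[of t] f(2)[of t] by (simp_all add: field_simps)
    then show ?thesis by simp
  qed
  have bdd: "bdd_above (range (\<lambda>s. F (height a s)))" if "continuous_on UNIV F" for F :: "real \<Rightarrow> real"
  proof -
    have "compact (F ` closure (range (height a)))"
      using bounded that by (intro compact_continuous_image continuous_on_subset[OF that]) auto
    then have "bdd_above (F ` closure (range (height a)))" by (simp add: bounded_imp_bdd_above compact_imp_bounded)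
    then show ?thesis by (rule bdd_above_mono) (use closure_subset in fastforce)
  qed
  have "\<exists>k. \<forall>s. f (height a s) = k"
  proof (rule parabolic[unfolded parabolic_def, rule_format], intro conjI ballI)
    show "C2_function AS (\<lambda>s. f (height a s))" by (rule C2_function_of_height[OF f(1)])
    show "bdd_above (range (\<lambda>s. f (height a s)))" by (rule bdd[OF smooth_on_continuous[OF f(1)]])
    fix c p assume "c \<in> AS" "p \<in> dom c"
    from laplacian_function_of_height[OF this] obtain q where q: "0 \<le> q"
      "laplacian gS c (\<lambda>s. f (height a s)) p = deriv f (height a p) * (deriv f (height a p) / f (height a p)) * DIM('l)
        + (deriv (deriv f) (height a p) - deriv f (height a p) * (deriv f (height a p) / f (height a p))) * q"
      using f1(1) f2 by blast
    show "0 \<le> laplacian gS c (\<lambda>s. f (height a s)) p"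
      unfolding q(2) using f(2)[of "height a p"]
      by (intro add_nonneg_nonneg mult_nonneg_nonneg[OF convex q(1)]) simp
  qed
  then obtain k where k: "\<And>s. f (height a s) = k" by blast
  have crit: "deriv f (height a p) = 0" for p
  proof -
    obtain c where c: "c \<in> AS" "p \<in> dom c" "is_chart c" using smooth_atlas_cover[OF atlases(4)] .
    have "inner_form (gS c p)"
      using metric_on_D(2)[OF metric_on_chart_metric[OF metrics(4) c(1,3)] imageI[OF c(2)]]
      by (simp add: chart_metric_def is_chart_D(3)[OF c(3,2)])
    then have 0: "laplacian gS c (\<lambda>s. f (height a s)) p = 0" using laplacian_const by (simp add: k)
    from laplacian_function_of_height[OF c(1,2)] obtain q where q: "0 \<le> q"
      "laplacian gS c (\<lambda>s. f (height a s)) p = deriv f (height a p) * (deriv f (height a p) / f (height a p)) * DIM('l)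
        + (deriv (deriv f) (height a p) - deriv f (height a p) * (deriv f (height a p) / f (height a p))) * q"
      using f1(1) f2 by blast
    have "0 \<le> deriv f (height a p) * (deriv f (height a p) / f (height a p)) * DIM('l)"
      using f(2)[of "height a p"] by simp
    moreover have "0 \<le> (deriv (deriv f) (height a p) - deriv f (height a p) * (deriv f (height a p) / f (height a p))) * q"
      by (intro mult_nonneg_nonneg convex q(1))
    ultimately have "deriv f (height a p) * (deriv f (height a p) / f (height a p)) * DIM('l) = 0"
      using q(2) 0 by linarith
    then show ?thesis using f(2)[of "height a p"] by simp
  qed
  have "\<exists>t. \<forall>s. height a s = t"
  proof (rule parabolic[unfolded parabolic_def, rule_format], intro conjI ballI)
    have "Ck_on k UNIV (\<lambda>t::real. t)" for k
      using Ck_on_const by (cases k) auto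
    then have id: "smooth_on UNIV (\<lambda>t::real. t)" by (simp add: smooth_on_def)
    show "C2_function AS (height a)" using C2_function_of_height[OF id] by simp
    show "bdd_above (range (height a))" using bdd[OF continuous_on_id] by simp
    fix c p assume "c \<in> AS" "p \<in> dom c"
    from laplacian_function_of_height[OF this] obtain q where q: "0 \<le> q"
      "\<forall>F F' F''. (\<forall>t. (F has_real_derivative F' t) (at t)) \<longrightarrow> (\<forall>t. (F' has_real_derivative F'' t) (at t)) \<longrightarrow>
        laplacian gS c (\<lambda>s. F (height a s)) p = F' (height a p) * (deriv f (height a p) / f (height a p)) * DIM('l)
          + (F'' (height a p) - F' (height a p) * (deriv f (height a p) / f (height a p))) * q" by blast
    show "0 \<le> laplacian gS c (height a) p"
      using q(2)[rule_format, of "\<lambda>t. t" "\<lambda>_. 1" "\<lambda>_. 0"] by (simp add: crit)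
  qed
  then show ?thesis .
qed

end

section \<open>The Riemannian distance and the manifold topology\<close>

lemma metric_on_compact_bounds:
  fixes G :: "'e::euclidean_space \<Rightarrow> 'e \<Rightarrow> 'e \<Rightarrow> real"
  assumes G: "metric_on U G" and K: "compact K" "K \<subseteq> U"
  obtains m C where "0 < m" "0 < C" "\<And>y v. y \<in> K \<Longrightarrow> m * norm v \<le> sqrt (G y v v)"
    "\<And>y v. y \<in> K \<Longrightarrow> sqrt (G y v v) \<le> C * norm v"
proof (cases "K = {}")
  case True
  then show ?thesis using that[of 1 1] by simp
next
  case False
  note I = metric_on_D(2)[OF G]
  have "G y v v = (\<Sum>i\<in>Basis. \<Sum>j\<in>Basis. (v \<bullet> i) * ((v \<bullet> j) * G y j i))" if "y \<in> U" for y v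
  proof -
    have 1: "G y v v = (\<Sum>i\<in>Basis. (v \<bullet> i) * G y v i)"
      using linear_expand_Basis[OF inner_form_linear(1)[OF I[OF that]], of v v] by simp
    have 2: "G y v i = (\<Sum>j\<in>Basis. (v \<bullet> j) * G y j i)" for i
      using linear_expand_Basis[OF inner_form_linear(2)[OF I[OF that]], of v i] by simp
    show ?thesis by (subst 1) (simp only: 2 sum_distrib_left)
  qed
  moreover have "continuous_on U (\<lambda>y. G y i j)" for i j
    using metric_on_D(3)[OF G] by (meson continuous_at_imp_continuous_on differentiable_imp_continuous_within)
  then have "continuous_on (K \<times> sphere 0 1) (\<lambda>p. \<Sum>i\<in>Basis. \<Sum>j\<in>Basis. (snd p \<bullet> i) * ((snd p \<bullet> j) * G (fst p) j i))"
    using K(2) by (intro continuous_intros continuous_on_compose2[of U "\<lambda>y. G y _ _" _ fst]) auto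
  ultimately have cont: "continuous_on (K \<times> sphere 0 1) (\<lambda>p. G (fst p) (snd p) (snd p))"
    using K(2) by (elim continuous_on_eq) auto
  have cpt: "compact (K \<times> sphere (0::'e) 1)" using K(1) by (intro compact_Times) auto
  obtain b :: 'e where "b \<in> Basis" using nonempty_Basis by blast
  then have ne: "K \<times> sphere (0::'e) 1 \<noteq> {}" using False norm_Basis by fastforce
  obtain p where p: "p \<in> K \<times> sphere 0 1" "\<And>q. q \<in> K \<times> sphere 0 1 \<Longrightarrow> G (fst p) (snd p) (snd p) \<le> G (fst q) (snd q) (snd q)"
    using continuous_attains_inf[OF cpt ne cont] by blast
  obtain p' where p': "p' \<in> K \<times> sphere 0 1" "\<And>q. q \<in> K \<times> sphere 0 1 \<Longrightarrow> G (fst q) (snd q) (snd q) \<le> G (fst p') (snd p') (snd p')"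
    using continuous_attains_sup[OF cpt ne cont] by blast
  define m where "m = sqrt (G (fst p) (snd p) (snd p))"
  define C where "C = sqrt (G (fst p') (snd p') (snd p'))"
  have pos: "0 < G (fst q) (snd q) (snd q)" if "q \<in> K \<times> sphere 0 1" for q
  proof -
    have "snd q \<noteq> 0" "fst q \<in> U" using that K(2) by auto
    then show ?thesis using I by (auto simp: inner_form_def)
  qed
  have hom: "sqrt (G y v v) = norm v * sqrt (G y ((1 / norm v) *\<^sub>R v) ((1 / norm v) *\<^sub>R v))" if "y \<in> K" "v \<noteq> 0" for y v
    using that K(2) inner_form_bilinear(5,6)[OF I[of y]] by (auto simp: real_sqrt_divide)
  show ?thesis
  proof (rule that[of m C])
    show "0 < m" "0 < C" using pos p(1) p'(1) by (auto simp: m_def C_def)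
    show "m * norm v \<le> sqrt (G y v v)" if "y \<in> K" for y v
    proof (cases "v = 0")
      case False
      have "m \<le> sqrt (G y ((1 / norm v) *\<^sub>R v) ((1 / norm v) *\<^sub>R v))"
        using p(2)[of "(y, (1 / norm v) *\<^sub>R v)"] that False by (simp add: m_def)
      from mult_right_mono[OF this norm_ge_zero[of v]] show ?thesis
        using hom[OF that False] by (simp only: mult.commute)
    qed (use I[of y] that K(2) inner_form_nonneg in auto)
    show "sqrt (G y v v) \<le> C * norm v" if "y \<in> K" for y v
    proof (cases "v = 0")
      case True
      have "inner_form (G y)" using I that K(2) by blast
      then show ?thesis using True by (simp add: inner_form_bilinear)
    next
      case False
      have "sqrt (G y ((1 / norm v) *\<^sub>R v) ((1 / norm v) *\<^sub>R v)) \<le> C"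
        using p'(2)[of "(y, (1 / norm v) *\<^sub>R v)"] that False by (simp add: C_def)
      from mult_right_mono[OF this norm_ge_zero[of v]] show ?thesis
        using hom[OF that False] by (simp only: mult.commute)
    qed
  qed
qed

text \<open>The derivative of a piecewise \<open>C\<^sup>1\<close> curve may be unbounded near the exceptional points, so it need not be
integrable. If it is not, the integral of the bound \<open>h\<close> is infinite; otherwise the fundamental theorem of
calculus holds for the Lebesgue integral.\<close>

lemma norm_diff_le_nn_integral:
  fixes \<beta> :: "real \<Rightarrow> 'a::euclidean_space"
  assumes "a \<le> b" "finite S" "continuous_on {a..b} \<beta>"
    and D: "\<And>x. x \<in> {a..b} - S \<Longrightarrow> (\<beta> has_vector_derivative D x) (at x)" "continuous_on ({a..b} - S) D"
    and h: "\<And>x. x \<in> {a<..<b} - S \<Longrightarrow> ennreal (norm (D x)) \<le> h x"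
  shows "ennreal (norm (\<beta> b - \<beta> a)) \<le> (\<integral>\<^sup>+x\<in>{a..b}. h x \<partial>lborel)"
proof -
  define D' where "D' x = indicator ({a..b} - S) x *\<^sub>R D x" for x
  have S: "{a..b} - S \<in> sets borel" using assms(2) by (intro sets.Diff) (auto intro: borel_closed finite_imp_closed)
  have meas: "D' \<in> borel_measurable borel"
    unfolding D'_def by (rule borel_measurable_continuous_on_indicator[OF S D(2)])
  have le: "(\<integral>\<^sup>+x. norm (D' x) \<partial>lborel) \<le> (\<integral>\<^sup>+x\<in>{a..b}. h x \<partial>lborel)"
  proof (rule nn_integral_mono_AE)
    have "AE x in lborel. x \<notin> S \<union> {a, b}"
      using finite_imp_null_set_lborel[of "S \<union> {a, b}"] assms(2) by (intro AE_not_in) auto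
    then show "AE x in lborel. ennreal (norm (D' x)) \<le> h x * indicator {a..b} x"
      by eventually_elim (use h in \<open>auto simp: D'_def indicator_def\<close>)
  qed
  show ?thesis
  proof (cases "(\<integral>\<^sup>+x. norm (D' x) \<partial>lborel) < \<infinity>")
    case True
    then have int: "integrable lborel D'" using meas by (intro integrableI_bounded) auto
    have "(D has_integral (\<beta> b - \<beta> a)) {a..b}"
      by (rule fundamental_theorem_of_calculus_interior_strong[OF assms(2,1) _ assms(3)]) (use D(1) in auto)
    then have "(D' has_integral (\<beta> b - \<beta> a)) {a..b}"
      by (rule has_integral_spike_finite[OF assms(2), rotated]) (simp add: D'_def)
    then have "(D' has_integral (\<beta> b - \<beta> a)) UNIV"
      by (rule has_integral_on_superset) (auto simp: D'_def)
    then have "\<beta> b - \<beta> a = integral\<^sup>L lborel D'"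
      using has_integral_integral_lborel[OF int] has_integral_unique by blast
    then show ?thesis using integral_norm_bound_ennreal[OF int] le by simp
  next
    case False
    then have "(\<integral>\<^sup>+x\<in>{a..b}. h x \<partial>lborel) = \<infinity>" using le by (simp add: top_unique not_less)
    then show ?thesis by simp
  qed
qed

lemma speed_in_chart:
  assumes A: "riemannian_manifold A g" and c: "c \<in> A" and \<gamma>: "\<gamma> t \<in> dom c" "isCont \<gamma> t"
    and D: "((coord c \<circ> \<gamma>) has_vector_derivative D) (at t)"
  shows "speed A g \<gamma> t = sqrt (g c (\<gamma> t) D D)"
proof -
  have sA: "smooth_atlas A" and rm: "riemannian_metric A g" using A by (auto simp: riemannian_manifold_def)
  define d where "d = (SOME c. c \<in> A \<and> \<gamma> t \<in> dom c)"
  have d: "d \<in> A" "\<gamma> t \<in> dom d"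
    using someI[of "\<lambda>c. c \<in> A \<and> \<gamma> t \<in> dom c" c] c \<gamma>(1) by (auto simp: d_def)
  note cc = smooth_atlas_is_chart[OF sA c] and cd = smooth_atlas_is_chart[OF sA d(1)]
  define \<Phi> where "\<Phi> = local_rep c d (\<lambda>p. p)"
  have sm: "smooth_on (coord c ` (dom c \<inter> dom d)) \<Phi>"
    using sA c d(1) by (auto simp: smooth_atlas_def \<Phi>_def)
  have "(\<Phi> has_derivative fd \<Phi> (coord c (\<gamma> t))) (at ((coord c \<circ> \<gamma>) t))"
    using smooth_on_has_derivative[OF sm, of "coord c (\<gamma> t)"] \<gamma>(1) d(2) by auto
  then have "((\<Phi> \<circ> (coord c \<circ> \<gamma>)) has_vector_derivative fd \<Phi> (coord c (\<gamma> t)) D) (at t)"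
    by (rule vector_derivative_diff_chain_within[OF D has_derivative_at_withinI])
  moreover have "eventually (\<lambda>s. \<gamma> s \<in> dom c \<inter> dom d) (at t)"
    by (rule topological_tendstoD[OF \<gamma>(2)[unfolded isCont_def]])
      (use \<gamma>(1) d(2) is_chart_D(1)[OF cc] is_chart_D(1)[OF cd] in auto)
  then have "eventually (\<lambda>s. (\<Phi> \<circ> (coord c \<circ> \<gamma>)) s = (coord d \<circ> \<gamma>) s) (at t)"
    by eventually_elim (simp add: \<Phi>_def local_rep_coord[OF cc])
  ultimately have "((coord d \<circ> \<gamma>) has_vector_derivative fd \<Phi> (coord c (\<gamma> t)) D) (at t)"
    unfolding has_vector_derivative_def
    by (rule has_derivative_transform_eventually) (simp_all add: \<Phi>_def local_rep_coord[OF cc \<gamma>(1)])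
  then have "vector_derivative (coord d \<circ> \<gamma>) (at t) = differential c d (\<lambda>p. p) (\<gamma> t) D"
    by (simp add: vector_derivative_at differential_def \<Phi>_def)
  moreover have "g c (\<gamma> t) D D = g d (\<gamma> t) (differential c d (\<lambda>p. p) (\<gamma> t) D) (differential c d (\<lambda>p. p) (\<gamma> t) D)"
    using rm c d \<gamma>(1) unfolding riemannian_metric_def by blast
  ultimately show ?thesis by (simp add: speed_def Let_def flip: d_def)
qed

text \<open>Near \<open>l\<close> the length of a curve is at least \<open>m\<close> times its Euclidean length in a chart. So a curve of length less than \<open>m r\<close> that
ends in \<open>l\<close> cannot leave the coordinate ball of radius \<open>r\<close>: after its last time outside the ball, it stays in a
compact part of it, where it would have to be at that time already. Consequently convergence in the Riemannian distance implies convergence in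
the manifold topology.\<close>

lemma riem_dist_small_imp_mem:
  assumes A: "riemannian_manifold A g" and W: "open W" "l \<in> W"
  obtains \<epsilon> where "0 < \<epsilon>" "\<And>p. riem_dist A g p l < ennreal \<epsilon> \<Longrightarrow> p \<in> W"
proof -
  have sA: "smooth_atlas A" and rm: "riemannian_metric A g" using A by (auto simp: riemannian_manifold_def)
  obtain c where c: "c \<in> A" "l \<in> dom c" "is_chart c" using smooth_atlas_cover[OF sA] .
  note cc = is_chart_D[OF c(3)]
  have "open (coord c ` (dom c \<inter> W))" "coord c l \<in> coord c ` (dom c \<inter> W)"
    using open_chart_image[OF c(3) W(1)] c(2) W(2) by auto
  then obtain r where r: "0 < r" "cball (coord c l) r \<subseteq> coord c ` (dom c \<inter> W)"
    using open_contains_cball by blast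
  have r': "cball (coord c l) r \<subseteq> coord c ` dom c" using r(2) by blast
  obtain m C where m: "0 < m" "\<And>y v. y \<in> cball (coord c l) r \<Longrightarrow> m * norm v \<le> sqrt (chart_metric g c y v v)"
    using metric_on_compact_bounds[OF metric_on_chart_metric[OF rm c(1,3)] compact_cball r'] by metis
  define K where "K = dom c \<inter> coord c -` ball (coord c l) r"
  have K: "open K" unfolding K_def by (rule continuous_open_preimage[OF cc(6,1) open_ball])
  have KW: "K \<subseteq> W"
  proof
    fix p assume p: "p \<in> K"
    then have "coord c p \<in> cball (coord c l) r" by (auto simp: K_def)
    then have "coord c p \<in> coord c ` (dom c \<inter> W)" using r(2) by blast
    then obtain q where q: "coord c p = coord c q" "q \<in> dom c \<inter> W" by (rule imageE)
    have "p = q" using p q(1) cc(3)[of p] cc(3)[of q] q(2) by (simp add: K_def)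
    then show "p \<in> W" using q(2) by simp
  qed
  have "p \<in> W" if "riem_dist A g p l < ennreal (m * r)" for p
  proof (rule ccontr)
    assume "p \<notin> W"
    from that have "\<exists>\<gamma>. piecewise_C1_curve A \<gamma> \<and> \<gamma> 0 = p \<and> \<gamma> 1 = l \<and> curve_length A g \<gamma> < ennreal (m * r)"
      unfolding riem_dist_def by (simp add: Inf_less_iff)
    then obtain \<gamma> where \<gamma>: "piecewise_C1_curve A \<gamma>" "\<gamma> 0 = p" "\<gamma> 1 = l" "curve_length A g \<gamma> < ennreal (m * r)"
      by blast
    have cont: "continuous_on {0..1} \<gamma>" using \<gamma>(1) by (simp add: piecewise_C1_curve_def)
    have bound: "ennreal (m * norm (coord c l - coord c (\<gamma> t))) \<le> curve_length A g \<gamma>"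
      if t: "0 \<le> t" "t \<le> 1" and sub: "\<gamma> ` {t..1} \<subseteq> K" for t
    proof -
      have "\<gamma> ` {t..1} \<subseteq> dom c" using sub by (auto simp: K_def)
      then have pw: "(coord c \<circ> \<gamma>) piecewise_C1_differentiable_on {t..1}"
        using \<gamma>(1) c(1) t by (auto simp: piecewise_C1_curve_def)
      then obtain S D where S: "finite S" "continuous_on {t..1} (coord c \<circ> \<gamma>)"
        and D: "\<And>x. x \<in> {t..1} - S \<Longrightarrow> ((coord c \<circ> \<gamma>) has_vector_derivative D x) (at x)" "continuous_on ({t..1} - S) D"
        unfolding piecewise_C1_differentiable_on_def C1_differentiable_on_def by blast
      have "ennreal (norm (m *\<^sub>R (coord c \<circ> \<gamma>) 1 - m *\<^sub>R (coord c \<circ> \<gamma>) t)) \<le> (\<integral>\<^sup>+x\<in>{t..1}. ennreal (speed A g \<gamma> x) \<partial>lborel)"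
      proof (rule norm_diff_le_nn_integral[OF t(2) S(1), where \<beta> = "\<lambda>x. m *\<^sub>R (coord c \<circ> \<gamma>) x" and D = "\<lambda>x. m *\<^sub>R D x"])
        show "continuous_on {t..1} (\<lambda>x. m *\<^sub>R (coord c \<circ> \<gamma>) x)" "continuous_on ({t..1} - S) (\<lambda>x. m *\<^sub>R D x)"
          by (intro continuous_on_scaleR continuous_on_const S(2) D(2))+
        show "((\<lambda>x. m *\<^sub>R (coord c \<circ> \<gamma>) x) has_vector_derivative m *\<^sub>R D x) (at x)" if "x \<in> {t..1} - S" for x
          using has_vector_derivative_scaleR[OF DERIV_const D(1)[OF that], of m] by simp
        show "ennreal (norm (m *\<^sub>R D x)) \<le> ennreal (speed A g \<gamma> x)" if x: "x \<in> {t<..<1} - S" for x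
        proof (rule ennreal_leI)
          have "\<gamma> x \<in> K" using sub x by auto
          then have \<gamma>x: "\<gamma> x \<in> dom c" "coord c (\<gamma> x) \<in> cball (coord c l) r" by (auto simp: K_def)
          have "continuous_on {0<..<1} \<gamma>" by (rule continuous_on_subset[OF cont]) auto
          then have "isCont \<gamma> x" using x t(1) by (simp add: continuous_on_eq_continuous_at)
          then have "speed A g \<gamma> x = sqrt (g c (\<gamma> x) (D x) (D x))"
            using speed_in_chart[where \<gamma> = \<gamma> and t = x, OF A c(1) \<gamma>x(1)] D(1)[of x] x by simp
          moreover have "m * norm (D x) \<le> sqrt (g c (\<gamma> x) (D x) (D x))"
            using m(2)[OF \<gamma>x(2), of "D x"] by (simp add: chart_metric_def cc(3)[OF \<gamma>x(1)])
          ultimately show "norm (m *\<^sub>R D x) \<le> speed A g \<gamma> x" using m(1) by simp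
        qed
      qed
      also have "\<dots> \<le> curve_length A g \<gamma>"
        unfolding curve_length_def using t(1) by (intro nn_integral_mono) (auto simp: indicator_def)
      finally show ?thesis using m(1) \<gamma>(3) by (simp flip: scaleR_diff_right)
    qed
    obtain L where L: "0 \<le> L" "curve_length A g \<gamma> = ennreal L" "L < m * r"
      using \<gamma>(4) by (cases "curve_length A g \<gamma>") (auto simp: ennreal_less_iff)
    (* the compact set in which the curve stays after its last time Sup T outside K *)
    define R where "R = coord_inv c ` cball (coord c l) (L / m)"
    have Lr: "L / m < r" using L(3) m(1) by (simp add: field_simps)
    have "cball (coord c l) (L / m) \<subseteq> coord c ` dom c" using r' Lr by (meson order_trans less_imp_le subset_cball)
    then have "compact R" "R \<subseteq> K"
      using Lr cc(4,5) unfolding R_def K_def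
      by (auto intro!: compact_continuous_image continuous_on_subset[OF cc(7)] simp: subset_iff)
    then have "closed R" by (simp add: compact_imp_closed)
    define T where "T = {0..1} \<inter> \<gamma> -` (- K)"
    have T: "closed T" unfolding T_def using K by (intro continuous_closed_preimage[OF cont]) auto
    have "0 \<in> T" using \<gamma>(2) KW \<open>p \<notin> W\<close> by (auto simp: T_def)
    moreover have bdd: "bdd_above T" unfolding T_def by (meson bdd_above_Icc bdd_above_mono inf_le1)
    ultimately have t0: "Sup T \<in> T" using closed_contains_Sup T by blast
    then have t01: "0 \<le> Sup T" "Sup T \<le> 1" "\<gamma> (Sup T) \<notin> K" by (auto simp: T_def)
    have "l \<in> K" using c(2) r(1) by (simp add: K_def)
    then have "Sup T \<noteq> 1" using t01(3) \<gamma>(3) by auto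
    have after: "\<gamma> t \<in> K" if "Sup T < t" "t \<le> 1" for t
      using cSup_upper[OF _ bdd, of t] that t01(1) by (force simp: T_def)
    have "\<gamma> ` {Sup T<..1} \<subseteq> R"
    proof
      fix q assume "q \<in> \<gamma> ` {Sup T<..1}"
      then obtain t where t: "q = \<gamma> t" "Sup T < t" "t \<le> 1" by auto
      have "ennreal (m * norm (coord c l - coord c (\<gamma> t))) \<le> ennreal L"
        unfolding L(2)[symmetric] by (rule bound) (use t t01 after in auto)
      then have "coord c q \<in> cball (coord c l) (L / m)"
        using L(1) m(1) t(1) by (simp add: dist_norm field_simps)
      moreover have "q \<in> dom c" using after[OF t(2,3)] t(1) by (simp add: K_def)
      ultimately show "q \<in> R" unfolding R_def using cc(3) by (metis imageI)
    qed
    moreover have "closure {Sup T<..1} = {Sup T..1}" using t01(2) \<open>Sup T \<noteq> 1\<close> by (intro closure_greaterThanAtMost) simp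
    ultimately have "\<gamma> ` {Sup T..1} \<subseteq> R"
      using image_closure_subset[of "{Sup T<..1}" \<gamma> R] \<open>closed R\<close> continuous_on_subset[OF cont] t01(1) by auto
    then have "\<gamma> (Sup T) \<in> K" using \<open>R \<subseteq> K\<close> t01(2) by (force simp: image_subset_iff)
    then show False using t01(3) by blast
  qed
  then show ?thesis using that[of "m * r"] m(1) r(1) by simp
qed

section \<open>Local inverses and lifts\<close>

text \<open>The inverse function theorem for maps from a space to itself is applied to \<open>L \<circ> \<Phi>\<close>, where \<open>L\<close> is the inverse of the
differential at \<open>y\<close>.\<close>

lemma smooth_local_inverse:
  fixes \<Phi> :: "'l::euclidean_space \<Rightarrow> 'e::euclidean_space"
  assumes dim: "DIM('l) = DIM('e)" and U: "open U" "y \<in> U" and \<Phi>: "smooth_on U \<Phi>" "inj (fd \<Phi> y)"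
  obtains U' V G where "open U'" "U' \<subseteq> U" "y \<in> U'" "open V" "homeomorphism U' V \<Phi> G"
    "\<And>z. z \<in> V \<Longrightarrow> G differentiable (at z)"
proof -
  have lin: "linear (fd \<Phi> y)" by (rule smooth_on_fd_linear[OF \<Phi>(1) U(2)])
  obtain L where L: "linear L" "L \<circ> fd \<Phi> y = id" "fd \<Phi> y \<circ> L = id"
    using isomorphism_expand linear_injective_isomorphism[OF lin \<Phi>(2)] dim by (auto simp: fun_eq_iff)
  have Lbl: "bounded_linear L" using L(1) by (simp add: linear_conv_bounded_linear)
  define \<Phi>' where "\<Phi>' x = Blinfun (\<lambda>v. L (fd \<Phi> x v))" for x
  have \<Phi>'_apply: "blinfun_apply (\<Phi>' x) v = L (fd \<Phi> x v)" if "x \<in> U" for x v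
    unfolding \<Phi>'_def using smooth_on_fd_linear[OF \<Phi>(1) that] L(1)
    by (subst bounded_linear_Blinfun_apply) (auto simp: linear_compose[unfolded o_def] simp flip: linear_conv_bounded_linear)
  have der: "((\<lambda>x. L (\<Phi> x)) has_derivative blinfun_apply (\<Phi>' x)) (at x)" if "x \<in> U" for x
  proof -
    have "blinfun_apply (\<Phi>' x) = (\<lambda>v. L (fd \<Phi> x v))" using \<Phi>'_apply[OF that] by blast
    then show ?thesis
      using bounded_linear.has_derivative[OF Lbl smooth_on_has_derivative[OF \<Phi>(1) that]] by simp
  qed
  have cont: "continuous_on U \<Phi>'"
  proof (rule continuous_on_blinfun_componentwise)
    fix i :: 'l
    have "continuous_on U (\<lambda>x. L (fd \<Phi> x i))"
      by (rule bounded_linear.continuous_on[OF Lbl smooth_on_continuous[OF smooth_on_fd[OF \<Phi>(1)]]])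
    then show "continuous_on U (\<lambda>x. blinfun_apply (\<Phi>' x) i)" by (rule continuous_on_eq) (simp add: \<Phi>'_apply)
  qed
  have inv: "id_blinfun o\<^sub>L \<Phi>' y = id_blinfun"
    using fun_cong[OF L(2)] by (intro blinfun_eqI) (simp add: \<Phi>'_apply[OF U(2)])
  obtain U' V g g' where *: "open U'" "U' \<subseteq> U" "y \<in> U'" "open V" "homeomorphism U' V (\<lambda>x. L (\<Phi> x)) g"
      "\<And>z. z \<in> V \<Longrightarrow> (g has_derivative (g' z)) (at z)"
    by (rule inverse_function_theorem[OF U(1) der cont U(2) inv], assumption) (rule that; assumption)
  define T where "T = fd \<Phi> y"
  have LT: "L (T z) = z" "T (L x) = x" for z x using L(2,3) by (auto simp: T_def fun_eq_iff)
  have T: "linear T" "bounded_linear T" using lin by (auto simp: T_def linear_conv_bounded_linear)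
  show ?thesis
  proof (rule that[OF *(1-3), of "L -` V" "\<lambda>z. g (L z)"])
    show "open (L -` V)" using *(4) Lbl by (simp add: open_vimage linear_continuous_on)
    have hom: "continuous_on U' \<Phi>"
      using smooth_on_continuous[OF \<Phi>(1)] *(2) continuous_on_subset by blast
    have g: "continuous_on V g" "\<And>x. x \<in> U' \<Longrightarrow> L (\<Phi> x) \<in> V" "\<And>x. x \<in> U' \<Longrightarrow> g (L (\<Phi> x)) = x"
      "\<And>z. z \<in> V \<Longrightarrow> g z \<in> U'" "\<And>z. z \<in> V \<Longrightarrow> L (\<Phi> (g z)) = z"
      using *(5) by (auto simp: homeomorphism_def)
    have "continuous_on (L -` V) (\<lambda>z. g (L z))"
      by (rule continuous_on_compose2[OF g(1) linear_continuous_on[OF Lbl]]) auto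
    moreover have "\<Phi> (g (L z)) = z" if "L z \<in> V" for z
      using LT(2)[of "\<Phi> (g (L z))"] g(5)[OF that] LT(2)[of z] by simp
    ultimately show "homeomorphism U' (L -` V) \<Phi> (\<lambda>z. g (L z))"
      using hom g by (intro homeomorphismI) auto
    show "(\<lambda>z. g (L z)) differentiable (at z)" if "z \<in> L -` V" for z
      using *(6)[of "L z"] that has_derivative_compose[OF bounded_linear_imp_has_derivative[OF Lbl]]
      unfolding differentiable_def by blast
  qed
qed

locale local_isometry =
  fixes A :: "('s::{t2_space,second_countable_topology}, 'l::euclidean_space) atlas"
    and g :: "('s, 'l) metric"
    and B :: "('p::{t2_space,second_countable_topology}, 'e::euclidean_space) atlas"
    and h :: "('p, 'e) metric"
    and F :: "'s \<Rightarrow> 'p"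
  assumes A: "riemannian_manifold A g" and B: "riemannian_manifold B h"
    and F: "isometric_immersion A g B h F" and dim: "DIM('l) = DIM('e)"
begin

lemma atlases: "smooth_atlas A" "smooth_atlas B" and metrics: "riemannian_metric A g" "riemannian_metric B h"
  using A B by (auto simp: riemannian_manifold_def)

lemma charts: "c \<in> A \<Longrightarrow> is_chart c" "d \<in> B \<Longrightarrow> is_chart d"
  by (rule smooth_atlas_is_chart[OF atlases(1)], assumption) (rule smooth_atlas_is_chart[OF atlases(2)])

lemma smooth_F: "smooth_map A B F"
  using F by (simp add: isometric_immersion_def immersion_def)

lemma cont_F: "continuous_on UNIV F"
  by (rule smooth_map_D(1)[OF smooth_F])

lemma overlap:
  assumes "c \<in> A" "d \<in> B"
  shows "open (overlap c d F)" "smooth_on (overlap c d F) (local_rep c d F)"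
    "local_rep c d F ` overlap c d F \<subseteq> coord d ` dom d"
  by (rule open_overlap[OF charts(1)[OF assms(1)] charts(2)[OF assms(2)] cont_F], rule smooth_map_D(2)[OF smooth_F assms],
      rule image_subsetI, erule local_rep_in_chart[OF charts(1)[OF assms(1)]])

lemma coordinate_inverse:
  assumes c: "c \<in> A" "p \<in> dom c" and d: "d \<in> B" "F p \<in> dom d"
  obtains U V G where "open U" "U \<subseteq> overlap c d F" "coord c p \<in> U" "open V" "homeomorphism U V (local_rep c d F) G"
    "\<And>z. z \<in> V \<Longrightarrow> G differentiable (at z)"
proof (rule smooth_local_inverse[OF dim overlap(1)[OF c(1) d(1)] _ overlap(2)[OF c(1) d(1)]])
  show "coord c p \<in> overlap c d F" using c d by auto
  show "inj (fd (local_rep c d F) (coord c p))"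
    using F c d by (auto simp: isometric_immersion_def immersion_def differential_def)
qed (rule that; assumption)

lemma local_section:
  obtains W V \<sigma> where "open W" "p \<in> W" "open V" "continuous_on V \<sigma>" "F ` W \<subseteq> V"
    "\<And>q. q \<in> V \<Longrightarrow> F (\<sigma> q) = q" "\<And>p. p \<in> W \<Longrightarrow> \<sigma> (F p) = p"
proof -
  obtain c where c: "c \<in> A" "p \<in> dom c" "is_chart c" using smooth_atlas_cover[OF atlases(1)] .
  obtain d where d: "d \<in> B" "F p \<in> dom d" "is_chart d" using smooth_atlas_cover[OF atlases(2)] .
  note cc = is_chart_D[OF c(3)] and dd = is_chart_D[OF d(3)]
  obtain U V G where G: "open U" "U \<subseteq> overlap c d F" "coord c p \<in> U" "open V" "homeomorphism U V (local_rep c d F) G"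
    using coordinate_inverse[OF c(1,2) d(1,2)] by metis
  have hom: "continuous_on V G" "\<And>x. x \<in> U \<Longrightarrow> local_rep c d F x \<in> V" "\<And>x. x \<in> U \<Longrightarrow> G (local_rep c d F x) = x"
    "\<And>z. z \<in> V \<Longrightarrow> G z \<in> U" "\<And>z. z \<in> V \<Longrightarrow> local_rep c d F (G z) = z"
    using G(5) by (auto simp: homeomorphism_def)
  define W where "W = dom c \<inter> coord c -` U"
  define V' where "V' = dom d \<inter> coord d -` V"
  define \<sigma> where "\<sigma> = coord_inv c \<circ> G \<circ> coord d"
  have WF: "F q \<in> dom d" "local_rep c d F (coord c q) = coord d (F q)" if "q \<in> W" for q
  proof -
    have "coord c q \<in> overlap c d F" using that G(2) unfolding W_def by blast
    then obtain q' where q': "coord c q = coord c q'" "q' \<in> dom c \<inter> F -` dom d" by (rule imageE)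
    then have "q = q'" using cc(3)[of q] cc(3)[of q'] that by (simp add: W_def)
    then show "F q \<in> dom d" using q'(2) by simp
    show "local_rep c d F (coord c q) = coord d (F q)" using that by (simp add: W_def local_rep_coord[OF c(3)])
  qed
  show ?thesis
  proof (rule that[of W V' \<sigma>])
    show "open W" unfolding W_def by (rule continuous_open_preimage[OF cc(6,1) G(1)])
    show "p \<in> W" using c(2) G(3) by (simp add: W_def)
    show "open V'" unfolding V'_def by (rule continuous_open_preimage[OF dd(6,1) G(4)])
    have "continuous_on (coord d ` V') G"
      by (rule continuous_on_subset[OF hom(1)]) (auto simp: V'_def)
    moreover have "continuous_on (G ` coord d ` V') (coord_inv c)"
      by (rule continuous_on_subset[OF cc(7)]) (use hom(4) G(2) in \<open>auto simp: V'_def\<close>)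
    moreover have "continuous_on V' (coord d)"
      by (rule continuous_on_subset[OF dd(6)]) (auto simp: V'_def)
    ultimately show "continuous_on V' \<sigma>"
      unfolding \<sigma>_def by (intro continuous_on_compose) (simp_all add: image_comp)
    show "F ` W \<subseteq> V'" using WF hom(2) by (force simp: V'_def W_def)
    show "F (\<sigma> q) = q" if "q \<in> V'" for q
    proof -
      have q: "q \<in> dom d" "coord d q \<in> V" using that by (auto simp: V'_def)
      have Gq: "G (coord d q) \<in> overlap c d F" using hom(4)[OF q(2)] G(2) by blast
      then have "coord d (F (\<sigma> q)) = coord d q"
        using hom(5)[OF q(2)] by (simp add: \<sigma>_def local_rep_apply)
      moreover have "F (\<sigma> q) \<in> dom d" using Gq cc(3) by (auto simp: \<sigma>_def)
      ultimately show ?thesis using dd(3) q(1) by metis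
    qed
    show "\<sigma> (F q) = q" if "q \<in> W" for q
      using WF(2)[OF that, symmetric] hom(3)[of "coord c q"] that cc(3)[of q] by (simp add: \<sigma>_def W_def)
  qed
qed

text \<open>Since \<open>dF\<close> preserves lengths, its inverse is bounded with respect to Euclidean norms, uniformly on compact sets.
This yields continuity of the velocity of a lifted curve.\<close>

lemma metric_ratio_bound:
  assumes c: "c \<in> A" and d: "d \<in> B" and K: "compact K" "K \<subseteq> overlap c d F"
  obtains C where "\<And>y v. y \<in> K \<Longrightarrow> norm v \<le> C * norm (fd (local_rep c d F) y v)"
proof -
  let ?\<Phi> = "local_rep c d F"
  note ov = overlap[OF c d]
  obtain m C where m: "0 < m" "\<And>y v. y \<in> K \<Longrightarrow> m * norm v \<le> sqrt (chart_metric g c y v v)"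
    using metric_on_compact_bounds[OF metric_on_chart_metric[OF metrics(1) c charts(1)[OF c]] K(1)] K(2)
    by (metis (no_types, lifting) Int_lower1 image_mono order_trans)
  have "compact (?\<Phi> ` K)"
    by (rule compact_continuous_image[OF continuous_on_subset[OF smooth_on_continuous[OF ov(2)] K(2)] K(1)])
  moreover have "?\<Phi> ` K \<subseteq> coord d ` dom d" by (rule order_trans[OF image_mono[OF K(2)] ov(3)])
  ultimately obtain m' C' where C': "0 < C'" "\<And>y v. y \<in> ?\<Phi> ` K \<Longrightarrow> sqrt (chart_metric h d y v v) \<le> C' * norm v"
    using metric_on_compact_bounds[OF metric_on_chart_metric[OF metrics(2) d charts(2)[OF d]]] by metis
  have "norm v \<le> (C' / m) * norm (fd ?\<Phi> y v)" if "y \<in> K" for y v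
  proof -
    have "m * norm v \<le> sqrt (chart_metric g c y v v)" by (rule m(2)[OF that])
    also have "\<dots> = sqrt (chart_metric h d (?\<Phi> y) (fd ?\<Phi> y v) (fd ?\<Phi> y v))"
      using isometric_immersion_chart_metric[OF F c d charts(1)[OF c] charts(2)[OF d] subsetD[OF K(2) that]] by simp
    also have "\<dots> \<le> C' * norm (fd ?\<Phi> y v)" by (rule C'(2)) (use that in blast)
    finally show ?thesis using m(1) by (simp add: field_simps)
  qed
  then show ?thesis using that by blast
qed

text \<open>The velocity \<open>D\<close> of a lift of a coordinate segment with direction \<open>w\<close> solves \<open>dF D = w\<close>. So a continuous lift is
\<open>C\<^sup>1\<close>, and its speed is that of the segment.\<close>

lemma riem_dist_lift_segment:
  assumes d: "d \<in> B" and \<eta>: "continuous_on {0..1} \<eta>"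
    and seg: "\<And>s. s \<in> {0..1} \<Longrightarrow> F (\<eta> s) \<in> dom d" "\<And>s. s \<in> {0..1} \<Longrightarrow> coord d (F (\<eta> s)) = z + s *\<^sub>R w"
    and L: "\<And>s. s \<in> {0..1} \<Longrightarrow> sqrt (h d (F (\<eta> s)) w w) \<le> L"
  shows "riem_dist A g (\<eta> 0) (\<eta> 1) \<le> ennreal L"
proof -
  have \<eta>': "continuous_on {0<..<1} \<eta>" by (rule continuous_on_subset[OF \<eta>]) auto
  have der: "\<exists>D. ((coord c \<circ> \<eta>) has_vector_derivative D) (at s) \<and> fd (local_rep c d F) (coord c (\<eta> s)) D = w"
    if c: "c \<in> A" and s: "s \<in> {0<..<1}" "\<eta> s \<in> dom c" for c s
  proof -
    have Fs: "F (\<eta> s) \<in> dom d" using seg(1) s(1) by simp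
    note cc = is_chart_D[OF charts(1)[OF c]]
    obtain U V G where G: "open U" "U \<subseteq> overlap c d F" "coord c (\<eta> s) \<in> U" "open V" "homeomorphism U V (local_rep c d F) G"
      "\<And>z. z \<in> V \<Longrightarrow> G differentiable (at z)"
      using coordinate_inverse[OF c s(2) d Fs] by metis
    define J where "J = {0<..<1} \<inter> \<eta> -` (dom c \<inter> coord c -` U)"
    have J: "open J" "s \<in> J"
      using continuous_open_preimage[OF \<eta>' _ continuous_open_preimage[OF cc(6,1) G(1)]] s G(3)
      by (auto simp: J_def)
    have rep: "local_rep c d F (coord c (\<eta> t)) = z + t *\<^sub>R w" if "t \<in> J" for t
      using that seg(2)[of t] by (simp add: J_def local_rep_coord[OF charts(1)[OF c]])
    have eq: "G (z + t *\<^sub>R w) = (coord c \<circ> \<eta>) t" if "t \<in> J" for t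
      using G(5) that by (auto simp: J_def homeomorphism_def simp flip: rep[OF that])
    have "z + s *\<^sub>R w \<in> V"
      using G(5) J(2) by (auto simp: J_def homeomorphism_def simp flip: rep[OF J(2)])
    then have G': "(G has_derivative fd G (z + s *\<^sub>R w)) (at (z + s *\<^sub>R w))"
      using G(6) frechet_derivative_works by blast
    have line: "((\<lambda>t. z + t *\<^sub>R w) has_vector_derivative w) (at s)"
      by (auto intro!: derivative_eq_intros)
    have "((G \<circ> (\<lambda>t. z + t *\<^sub>R w)) has_vector_derivative fd G (z + s *\<^sub>R w) w) (at s)"
      by (rule vector_derivative_diff_chain_within[OF line has_derivative_at_withinI[OF G']])
    then have D: "((coord c \<circ> \<eta>) has_vector_derivative fd G (z + s *\<^sub>R w) w) (at s)"
      by (rule has_vector_derivative_transform_within_open[OF _ J]) (simp add: eq)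
    have "(local_rep c d F has_derivative fd (local_rep c d F) (coord c (\<eta> s))) (at ((coord c \<circ> \<eta>) s))"
      using smooth_on_has_derivative[OF overlap(2)[OF c d]] G(2,3) by auto
    from vector_derivative_diff_chain_within[OF D has_derivative_at_withinI[OF this]]
    have "((local_rep c d F \<circ> (coord c \<circ> \<eta>)) has_vector_derivative
        fd (local_rep c d F) (coord c (\<eta> s)) (fd G (z + s *\<^sub>R w) w)) (at s)" .
    then have "((\<lambda>t. z + t *\<^sub>R w) has_vector_derivative
        fd (local_rep c d F) (coord c (\<eta> s)) (fd G (z + s *\<^sub>R w) w)) (at s)"
      by (rule has_vector_derivative_transform_within_open[OF _ J]) (simp add: rep)
    then have "fd (local_rep c d F) (coord c (\<eta> s)) (fd G (z + s *\<^sub>R w) w) = w"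
      using vector_derivative_unique_at line by blast
    then show ?thesis using D by blast
  qed
  have curve: "piecewise_C1_curve A \<eta>"
    unfolding piecewise_C1_curve_def
  proof (intro conjI \<eta> ballI allI impI)
    fix c a b assume c: "c \<in> A" and "0 \<le> a \<and> a \<le> b \<and> b \<le> 1 \<and> \<eta> ` {a..b} \<subseteq> dom c"
    then have ab: "{a..b} \<subseteq> {0..1}" "\<eta> ` {a..b} \<subseteq> dom c" "0 \<le> a" "b \<le> 1" by auto
    have mem: "s \<in> {0<..<1}" "\<eta> s \<in> dom c" if "s \<in> {a<..<b}" for s
      using that ab(3,4) subsetD[OF ab(2) imageI[of s]] by auto
    note cc = is_chart_D[OF charts(1)[OF c]]
    have cont: "continuous_on {a..b} (coord c \<circ> \<eta>)"
      using continuous_on_subset[OF \<eta> ab(1)] continuous_on_subset[OF cc(6) ab(2)] by (rule continuous_on_compose)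
    let ?\<Phi> = "local_rep c d F"
    have "\<exists>D. \<forall>s\<in>{a<..<b}. ((coord c \<circ> \<eta>) has_vector_derivative D s) (at s) \<and> fd ?\<Phi> (coord c (\<eta> s)) (D s) = w"
      by (intro bchoice ballI der[OF c] mem)
    then obtain D where D: "\<And>s. s \<in> {a<..<b} \<Longrightarrow> ((coord c \<circ> \<eta>) has_vector_derivative D s) (at s)"
      "\<And>s. s \<in> {a<..<b} \<Longrightarrow> fd ?\<Phi> (coord c (\<eta> s)) (D s) = w" by blast
    have ov: "coord c (\<eta> s) \<in> overlap c d F" if "s \<in> {a<..<b}" for s
      using mem[OF that] seg(1)[of s] by auto
    have "continuous_on {a<..<b} D"
      unfolding continuous_on_def
    proof
      fix s assume s: "s \<in> {a<..<b}"
      obtain r where r: "0 < r" "cball (coord c (\<eta> s)) r \<subseteq> overlap c d F"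
        using overlap(1)[OF c d] ov[OF s] open_contains_cball by blast
      obtain C where C: "\<And>y v. y \<in> cball (coord c (\<eta> s)) r \<Longrightarrow> norm v \<le> C * norm (fd ?\<Phi> y v)"
        using metric_ratio_bound[OF c d compact_cball r(2)] by metis
      have "continuous_on {a<..<b} (coord c \<circ> \<eta>)" by (rule continuous_on_subset[OF cont]) auto
      then have lim: "((coord c \<circ> \<eta>) \<longlongrightarrow> coord c (\<eta> s)) (at s within {a<..<b})"
        using s unfolding continuous_on_def by (metis o_apply)
      have "continuous_on (overlap c d F) (\<lambda>y. fd ?\<Phi> y (D s))"
        by (rule smooth_on_continuous[OF smooth_on_fd[OF overlap(2)[OF c d]]])
      then have "isCont (\<lambda>y. fd ?\<Phi> y (D s)) (coord c (\<eta> s))"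
        using overlap(1)[OF c d] ov[OF s] continuous_on_eq_continuous_at by blast
      then have "((\<lambda>t. fd ?\<Phi> ((coord c \<circ> \<eta>) t) (D s)) \<longlongrightarrow> fd ?\<Phi> (coord c (\<eta> s)) (D s)) (at s within {a<..<b})"
        by (rule isCont_tendsto_compose[where g = "\<lambda>y. fd ?\<Phi> y (D s)", OF _ lim])
      then have "((\<lambda>t. C * norm (w - fd ?\<Phi> ((coord c \<circ> \<eta>) t) (D s))) \<longlongrightarrow> C * norm (w - w)) (at s within {a<..<b})"
        unfolding D(2)[OF s] by (intro tendsto_intros)
      then have null: "((\<lambda>t. C * norm (w - fd ?\<Phi> ((coord c \<circ> \<eta>) t) (D s))) \<longlongrightarrow> 0) (at s within {a<..<b})"
        by simp
      have "eventually (\<lambda>t. (coord c \<circ> \<eta>) t \<in> ball (coord c (\<eta> s)) r) (at s within {a<..<b})"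
        by (rule topological_tendstoD[OF lim]) (use r(1) in auto)
      moreover have "eventually (\<lambda>t. t \<in> {a<..<b}) (at s within {a<..<b})"
        by (simp add: eventually_at_filter)
      ultimately have "eventually (\<lambda>t. norm (D t - D s) \<le> C * norm (w - fd ?\<Phi> ((coord c \<circ> \<eta>) t) (D s))) (at s within {a<..<b})"
      proof eventually_elim
        case (elim t)
        have "fd ?\<Phi> (coord c (\<eta> t)) (D t - D s) = w - fd ?\<Phi> (coord c (\<eta> t)) (D s)"
          using linear_diff[OF smooth_on_fd_linear[OF overlap(2)[OF c d] ov[OF elim(2)]]] D(2)[OF elim(2)] by simp
        then show ?case using C[of "coord c (\<eta> t)" "D t - D s"] elim(1) by simp
      qed
      then have "((\<lambda>t. D t - D s) \<longlongrightarrow> 0) (at s within {a<..<b})"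
        by (rule Lim_null_comparison[OF _ null])
      then show "(D \<longlongrightarrow> D s) (at s within {a<..<b})" by (simp add: LIM_zero_iff)
    qed
    then have "(coord c \<circ> \<eta>) C1_differentiable_on ({a..b} - {a, b})"
      using D(1) unfolding C1_differentiable_on_def
      by (intro exI[of _ D]) (simp add: atLeastAtMost_diff_ends)
    then show "(coord c \<circ> \<eta>) piecewise_C1_differentiable_on {a..b}"
      unfolding piecewise_C1_differentiable_on_def using cont by (metis finite.emptyI finite.insertI)
  qed
  have speed: "speed A g \<eta> s \<le> L" if s: "s \<in> {0<..<1}" for s
  proof -
    obtain c where c: "c \<in> A" "\<eta> s \<in> dom c" "is_chart c" using smooth_atlas_cover[OF atlases(1)] .
    obtain D where D: "((coord c \<circ> \<eta>) has_vector_derivative D) (at s)" "fd (local_rep c d F) (coord c (\<eta> s)) D = w"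
      using der[OF c(1) s c(2)] by blast
    have "isCont \<eta> s" using \<eta>' s by (simp add: continuous_on_eq_continuous_at)
    from speed_in_chart[where \<gamma> = \<eta> and t = s, OF A c(1,2) this D(1)]
    have "speed A g \<eta> s = sqrt (g c (\<eta> s) D D)" .
    also have "\<dots> = sqrt (h d (F (\<eta> s)) w w)"
      using isometric_immersion_D[OF F c(1) d c(2) seg(1)] s D(2) by (simp add: differential_def)
    finally show ?thesis using L[of s] s by simp
  qed
  have "curve_length A g \<eta> \<le> (\<integral>\<^sup>+ s. ennreal L * indicator {0..1} s \<partial>(lborel :: real measure))"
    unfolding curve_length_def
  proof (rule nn_integral_mono_AE)
    have "AE s in lborel. s \<notin> {0, 1::real}"
      by (intro AE_not_in finite_imp_null_set_lborel) simp
    then show "AE s in lborel. ennreal (speed A g \<eta> s) * indicator {0..1} s \<le> ennreal L * indicator {0..1} s"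
      by eventually_elim (auto simp: indicator_def intro!: ennreal_leI speed)
  qed
  also have "\<dots> = ennreal L" by (simp add: nn_integral_cmult_indicator)
  finally show ?thesis
    unfolding riem_dist_def using curve by (intro INF_lower2[of \<eta>]) auto
qed

text \<open>A continuous lift of \<open>\<gamma>\<close>, restricted to \<open>[\<tau>, \<tau>']\<close>, from \<open>s\<close> to \<open>s'\<close>. By concatenation this is a preorder on pairs
\<open>(\<tau>, s)\<close>.\<close>

definition lifts :: "(real \<Rightarrow> 'p) \<Rightarrow> real \<Rightarrow> 's \<Rightarrow> real \<Rightarrow> 's \<Rightarrow> bool" where
  "lifts \<gamma> \<tau> s \<tau>' s' \<longleftrightarrow> \<tau> \<le> \<tau>' \<and> (\<exists>\<delta>. continuous_on {\<tau>..\<tau>'} \<delta> \<and> \<delta> \<tau> = s \<and> \<delta> \<tau>' = s' \<and>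
     (\<forall>t\<in>{\<tau>..\<tau>'}. F (\<delta> t) = \<gamma> t))"

lemma lifts_refl: "F s = \<gamma> \<tau> \<Longrightarrow> lifts \<gamma> \<tau> s \<tau> s"
  unfolding lifts_def by (auto intro!: exI[of _ "\<lambda>_. s"])

lemma lifts_trans:
  assumes "lifts \<gamma> \<tau>\<^sub>1 s\<^sub>1 \<tau>\<^sub>2 s\<^sub>2" "lifts \<gamma> \<tau>\<^sub>2 s\<^sub>2 \<tau>\<^sub>3 s\<^sub>3"
  shows "lifts \<gamma> \<tau>\<^sub>1 s\<^sub>1 \<tau>\<^sub>3 s\<^sub>3"
proof -
  obtain \<delta> where \<delta>: "continuous_on {\<tau>\<^sub>1..\<tau>\<^sub>2} \<delta>" "\<delta> \<tau>\<^sub>1 = s\<^sub>1" "\<delta> \<tau>\<^sub>2 = s\<^sub>2" "\<And>t. t \<in> {\<tau>\<^sub>1..\<tau>\<^sub>2} \<Longrightarrow> F (\<delta> t) = \<gamma> t"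
    using assms(1) by (auto simp: lifts_def)
  obtain \<delta>' where \<delta>': "continuous_on {\<tau>\<^sub>2..\<tau>\<^sub>3} \<delta>'" "\<delta>' \<tau>\<^sub>2 = s\<^sub>2" "\<delta>' \<tau>\<^sub>3 = s\<^sub>3" "\<And>t. t \<in> {\<tau>\<^sub>2..\<tau>\<^sub>3} \<Longrightarrow> F (\<delta>' t) = \<gamma> t"
    using assms(2) by (auto simp: lifts_def)
  have le: "\<tau>\<^sub>1 \<le> \<tau>\<^sub>2" "\<tau>\<^sub>2 \<le> \<tau>\<^sub>3" using assms by (auto simp: lifts_def)
  have "continuous_on ({\<tau>\<^sub>1..\<tau>\<^sub>2} \<union> {\<tau>\<^sub>2..\<tau>\<^sub>3}) (\<lambda>t. if t \<le> \<tau>\<^sub>2 then \<delta> t else \<delta>' t)"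
    by (rule continuous_on_cases[OF _ _ \<delta>(1) \<delta>'(1)]) (use \<delta>(3) \<delta>'(2) in auto)
  then have "continuous_on {\<tau>\<^sub>1..\<tau>\<^sub>3} (\<lambda>t. if t \<le> \<tau>\<^sub>2 then \<delta> t else \<delta>' t)"
    using ivl_disj_un_two_touch(4)[OF le] by simp
  then show ?thesis
    unfolding lifts_def using le \<delta> \<delta>' by (auto intro!: exI[of _ "\<lambda>t. if t \<le> \<tau>\<^sub>2 then \<delta> t else \<delta>' t"])
qed

text \<open>A section around \<open>l\<close> lifts a piece of \<open>\<gamma>\<close> of uniform size, starting from any point near \<open>l\<close>.\<close>

lemma lifts_extend:
  assumes \<gamma>: "continuous_on {0..1} \<gamma>" and T: "T \<in> {0..1}" "F l = \<gamma> T"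
  obtains \<epsilon> W where "0 < \<epsilon>" "open W" "l \<in> W"
    "\<And>s \<tau> t. \<lbrakk>s \<in> W; F s = \<gamma> \<tau>; 0 \<le> \<tau>; \<tau> \<le> t; t \<le> 1; \<bar>\<tau> - T\<bar> < \<epsilon>; \<bar>t - T\<bar> < \<epsilon>\<rbrakk> \<Longrightarrow> \<exists>s'. lifts \<gamma> \<tau> s t s'"
proof -
  obtain W V \<sigma> where W: "open W" "l \<in> W" "open V" "continuous_on V \<sigma>" "F ` W \<subseteq> V"
    "\<And>q. q \<in> V \<Longrightarrow> F (\<sigma> q) = q" "\<And>p. p \<in> W \<Longrightarrow> \<sigma> (F p) = p"
    using local_section[of l] by metis
  have "\<gamma> T \<in> V" using W(2,5) T(2) by auto
  then obtain U where U: "open U" "T \<in> U" "\<And>t. t \<in> {0..1} \<Longrightarrow> t \<in> U \<Longrightarrow> \<gamma> t \<in> V"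
    using \<gamma> T(1) W(3) unfolding continuous_on_topological by metis
  obtain \<epsilon> where \<epsilon>: "0 < \<epsilon>" "ball T \<epsilon> \<subseteq> U" using U(1,2) open_contains_ball by blast
  have "\<exists>s'. lifts \<gamma> \<tau> s t s'"
    if "s \<in> W" "F s = \<gamma> \<tau>" "0 \<le> \<tau>" "\<tau> \<le> t" "t \<le> 1" "\<bar>\<tau> - T\<bar> < \<epsilon>" "\<bar>t - T\<bar> < \<epsilon>" for s \<tau> t
  proof -
    have V: "\<gamma> x \<in> V" if "x \<in> {\<tau>..t}" for x
    proof -
      have "x \<in> ball T \<epsilon>" "x \<in> {0..1}"
        using \<open>0 \<le> \<tau>\<close> \<open>t \<le> 1\<close> \<open>\<bar>\<tau> - T\<bar> < \<epsilon>\<close> \<open>\<bar>t - T\<bar> < \<epsilon>\<close> that by (auto simp: dist_real_def)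
      then show ?thesis using U(3) \<epsilon>(2) by blast
    qed
    have "continuous_on {\<tau>..t} \<gamma>" by (rule continuous_on_subset[OF \<gamma>]) (use that in auto)
    then have "continuous_on {\<tau>..t} (\<lambda>x. \<sigma> (\<gamma> x))"
      by (rule continuous_on_compose2[OF W(4)]) (use V in auto)
    then have "lifts \<gamma> \<tau> s t (\<sigma> (\<gamma> t))"
      unfolding lifts_def using that W(6,7) V by (intro conjI exI[of _ "\<lambda>x. \<sigma> (\<gamma> x)"]) (auto simp flip: that(2))
    then show ?thesis by blast
  qed
  then show ?thesis using that[OF \<epsilon>(1) W(1,2)] by blast
qed

lemma riem_dist_lifts:
  assumes d: "d \<in> B" and chart: "\<And>t. t \<in> {0..1} \<Longrightarrow> x + t *\<^sub>R w \<in> coord d ` dom d"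
    and C: "\<And>t. t \<in> {0..1} \<Longrightarrow> sqrt (h d (coord_inv d (x + t *\<^sub>R w)) w w) \<le> C"
    and lift: "lifts (\<lambda>t. coord_inv d (x + t *\<^sub>R w)) \<tau> s \<tau>' s'" "0 \<le> \<tau>" "\<tau>' \<le> 1"
  shows "riem_dist A g s s' \<le> ennreal (C * (\<tau>' - \<tau>))" "riem_dist A g s' s \<le> ennreal (C * (\<tau>' - \<tau>))"
proof -
  note dd = is_chart_D[OF charts(2)[OF d]]
  obtain \<delta> where \<delta>: "continuous_on {\<tau>..\<tau>'} \<delta>" "\<delta> \<tau> = s" "\<delta> \<tau>' = s'" "\<tau> \<le> \<tau>'"
    "\<And>t. t \<in> {\<tau>..\<tau>'} \<Longrightarrow> F (\<delta> t) = coord_inv d (x + t *\<^sub>R w)"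
    using lift(1) by (auto simp: lifts_def)
  have "riem_dist A g (\<delta> \<alpha>) (\<delta> \<beta>) \<le> ennreal (C * \<bar>\<beta> - \<alpha>\<bar>)" if "\<alpha> \<in> {\<tau>..\<tau>'}" "\<beta> \<in> {\<tau>..\<tau>'}" for \<alpha> \<beta>
  proof -
    define \<eta> where "\<eta> u = \<delta> (\<alpha> + u * (\<beta> - \<alpha>))" for u
    have mem: "\<alpha> + u * (\<beta> - \<alpha>) \<in> {\<tau>..\<tau>'}" if "u \<in> {0..1}" for u
    proof -
      have "\<alpha> + u * (\<beta> - \<alpha>) = (1 - u) *\<^sub>R \<alpha> + u *\<^sub>R \<beta>" by (simp add: algebra_simps)
      then show ?thesis
        using convexD_alt[OF convex_closed_interval(1), of \<alpha> \<tau> \<tau>' \<beta> u] \<open>\<alpha> \<in> _\<close> \<open>\<beta> \<in> _\<close> that by simp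
    qed
    have mem01: "\<alpha> + u * (\<beta> - \<alpha>) \<in> {0..1}" if "u \<in> {0..1}" for u
      using mem[OF that] lift(2,3) by auto
    have F\<eta>: "F (\<eta> u) = coord_inv d (x + (\<alpha> + u * (\<beta> - \<alpha>)) *\<^sub>R w)" if "u \<in> {0..1}" for u
      unfolding \<eta>_def by (rule \<delta>(5)[OF mem[OF that]])
    have "riem_dist A g (\<eta> 0) (\<eta> 1) \<le> ennreal (C * \<bar>\<beta> - \<alpha>\<bar>)"
    proof (rule riem_dist_lift_segment[OF d, where z = "x + \<alpha> *\<^sub>R w" and w = "(\<beta> - \<alpha>) *\<^sub>R w"])
      show "continuous_on {0..1} \<eta>"
        unfolding \<eta>_def by (rule continuous_on_compose2[OF \<delta>(1)]) (use mem in \<open>auto intro!: continuous_intros\<close>)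
      fix u :: real assume u: "u \<in> {0..1}"
      note ch = chart[OF mem01[OF u]]
      show F: "F (\<eta> u) \<in> dom d" using dd(5)[OF ch] by (simp add: F\<eta>[OF u])
      show "coord d (F (\<eta> u)) = x + \<alpha> *\<^sub>R w + u *\<^sub>R (\<beta> - \<alpha>) *\<^sub>R w"
        using dd(4)[OF ch] by (simp add: F\<eta>[OF u] algebra_simps)
      have "inner_form (h d (F (\<eta> u)))"
        using metric_on_D(2)[OF metric_on_chart_metric[OF metrics(2) d charts(2)[OF d]] imageI[OF F]]
        by (simp add: chart_metric_def dd(3)[OF F])
      then have "sqrt (h d (F (\<eta> u)) ((\<beta> - \<alpha>) *\<^sub>R w) ((\<beta> - \<alpha>) *\<^sub>R w)) = \<bar>\<beta> - \<alpha>\<bar> * sqrt (h d (F (\<eta> u)) w w)"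
        by (simp add: inner_form_bilinear(5,6) real_sqrt_mult flip: mult.assoc)
      also have "\<dots> \<le> \<bar>\<beta> - \<alpha>\<bar> * C"
        by (intro mult_left_mono) (use C[OF mem01[OF u]] F\<eta>[OF u] in auto)
      finally show "sqrt (h d (F (\<eta> u)) ((\<beta> - \<alpha>) *\<^sub>R w) ((\<beta> - \<alpha>) *\<^sub>R w)) \<le> C * \<bar>\<beta> - \<alpha>\<bar>" by (simp add: mult.commute)
    qed
    then show ?thesis by (simp add: \<eta>_def)
  qed
  from this[of \<tau> \<tau>'] this[of \<tau>' \<tau>] show "riem_dist A g s s' \<le> ennreal (C * (\<tau>' - \<tau>))" "riem_dist A g s' s \<le> ennreal (C * (\<tau>' - \<tau>))"
    using \<delta>(2-4) by auto
qed

text \<open>A lift of the segment is extended in steps, each of which covers at least half of what is still possible. The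
lengths of the steps are controlled by those in the base, so the points reached form a Cauchy sequence with a
limit \<open>l\<close> over \<open>T = lim \<tau>\<^sub>n\<close>. By \<open>lifts_extend\<close> at \<open>l\<close>, almost all of the points can be continued to a common time
\<open>t \<ge> T\<close>, with \<open>t > T\<close> unless \<open>T = 1\<close>. The steps therefore satisfy \<open>\<tau>\<^sub>n + t \<le> 2 \<tau>\<^sub>n\<^sub>+\<^sub>1\<close>, and in the limit \<open>t \<le> T\<close>. So \<open>T = 1\<close>,
and \<open>l\<close> lies over the end of the segment.\<close>

lemma segment_end_in_range:
  assumes complete: "complete_manifold A g" and d: "d \<in> B"
    and chart: "\<And>t. t \<in> {0..1} \<Longrightarrow> x + t *\<^sub>R w \<in> coord d ` dom d"
    and C: "\<And>t. t \<in> {0..1} \<Longrightarrow> sqrt (h d (coord_inv d (x + t *\<^sub>R w)) w w) \<le> C" "0 < C"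
    and s0: "F s\<^sub>0 = coord_inv d x"
  shows "coord_inv d (x + w) \<in> range F"
proof -
  note dd = is_chart_D[OF charts(2)[OF d]]
  define \<gamma> where "\<gamma> t = coord_inv d (x + t *\<^sub>R w)" for t
  have \<gamma>: "continuous_on {0..1} \<gamma>"
    unfolding \<gamma>_def by (rule continuous_on_compose2[OF dd(7)]) (use chart in \<open>auto intro!: continuous_intros\<close>)
  define R where "R = (\<lambda>(\<tau>, s). {t. t \<le> 1 \<and> (\<exists>s'. lifts \<gamma> \<tau> s t s')})"
  define P where "P = (\<lambda>(\<tau>, s). 0 \<le> \<tau> \<and> \<tau> \<le> 1 \<and> F s = \<gamma> \<tau>)"
  define Q where "Q = (\<lambda>(\<tau>, s) (\<tau>', s'). lifts \<gamma> \<tau> s \<tau>' s' \<and> (\<forall>t\<in>R (\<tau>, s). \<tau> + t \<le> 2 * \<tau>'))"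
  have "\<exists>f. \<forall>n. P (f n) \<and> Q (f n) (f (Suc n))"
  proof (rule dependent_nat_choice)
    show "\<exists>p. P p" using s0 by (intro exI[of _ "(0, s\<^sub>0)"]) (simp add: P_def \<gamma>_def)
    fix p assume "P p"
    obtain \<tau> s where p: "p = (\<tau>, s)" by (cases p)
    have \<tau>: "0 \<le> \<tau>" "\<tau> \<le> 1" "F s = \<gamma> \<tau>" using \<open>P p\<close> by (auto simp: p P_def)
    have "\<tau> \<in> R p" using \<tau> lifts_refl by (auto simp: R_def p)
    moreover have bdd: "bdd_above (R p)" by (auto simp: R_def p intro: bdd_aboveI[of _ 1])
    ultimately have "\<exists>t\<in>R p. \<tau> + Sup (R p) \<le> 2 * t"
    proof (cases "Sup (R p) \<le> \<tau>")
      case True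
      then show ?thesis using \<open>\<tau> \<in> R p\<close> by force
    next
      case False
      then have "(\<tau> + Sup (R p)) / 2 < Sup (R p)" by simp
      then obtain t where "t \<in> R p" "(\<tau> + Sup (R p)) / 2 < t"
        using \<open>\<tau> \<in> R p\<close> bdd less_cSup_iff by blast
      then show ?thesis by (intro bexI[of _ t]) auto
    qed
    then obtain t where t: "t \<in> R p" "\<tau> + Sup (R p) \<le> 2 * t" by blast
    then obtain s' where s': "t \<le> 1" "lifts \<gamma> \<tau> s t s'" by (auto simp: R_def p)
    have "P (t, s')" using s' \<tau>(1) by (auto simp: P_def lifts_def)
    moreover have "Q p (t, s')"
      using s'(2) t(2) cSup_upper[OF _ bdd] by (force simp: Q_def p)
    ultimately show "\<exists>q. P q \<and> Q p q" by blast
  qed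
  then obtain f where f: "\<And>n. P (f n)" "\<And>n. Q (f n) (f (Suc n))" by blast
  define \<tau> where "\<tau> n = fst (f n)" for n
  define \<sigma> where "\<sigma> n = snd (f n)" for n
  have f_eq: "f n = (\<tau> n, \<sigma> n)" for n by (simp add: \<tau>_def \<sigma>_def)
  have \<tau>: "0 \<le> \<tau> n" "\<tau> n \<le> 1" "F (\<sigma> n) = \<gamma> (\<tau> n)" for n
    using f(1)[of n] by (auto simp: P_def f_eq)
  have step: "lifts \<gamma> (\<tau> n) (\<sigma> n) (\<tau> (Suc n)) (\<sigma> (Suc n))" for n
    using f(2)[of n] by (simp add: Q_def f_eq)
  have greedy: "\<tau> n + t \<le> 2 * \<tau> (Suc n)" if "t \<le> 1" "lifts \<gamma> (\<tau> n) (\<sigma> n) t s'" for n t s'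
    using f(2)[of n] that by (auto simp: Q_def R_def f_eq)
  have lift: "lifts \<gamma> (\<tau> m) (\<sigma> m) (\<tau> n) (\<sigma> n)" if "m \<le> n" for m n
    using that by (induction rule: dec_induct) (auto intro: lifts_refl \<tau>(3) lifts_trans step)
  have "incseq \<tau>" using lift by (auto simp: incseq_def lifts_def)
  then obtain T where T: "\<tau> \<longlonglongrightarrow> T" "\<And>n. \<tau> n \<le> T"
    using incseq_convergent[of \<tau> 1] \<tau>(2) by metis
  have T01: "0 \<le> T" "T \<le> 1"
    using T(2)[of 0] \<tau>(1)[of 0] LIMSEQ_le_const2[OF T(1)] \<tau>(2) by auto
  have dist: "riem_dist A g (\<sigma> m) (\<sigma> n) \<le> ennreal (C * \<bar>\<tau> n - \<tau> m\<bar>)" for m n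
  proof (cases "m \<le> n")
    case True
    then show ?thesis
      using riem_dist_lifts(1)[OF d chart C(1) lift[OF True, unfolded \<gamma>_def] \<tau>(1,2)] \<open>incseq \<tau>\<close> by (simp add: incseq_def)
  next
    case False
    then have "n \<le> m" by simp
    then show ?thesis
      using riem_dist_lifts(2)[OF d chart C(1) lift[OF \<open>n \<le> m\<close>, unfolded \<gamma>_def] \<tau>(1,2)] \<open>incseq \<tau>\<close> by (simp add: incseq_def)
  qed
  have "\<exists>N. \<forall>m\<ge>N. \<forall>n\<ge>N. riem_dist A g (\<sigma> m) (\<sigma> n) < ennreal e" if "0 < e" for e
  proof -
    have "Cauchy \<tau>" using T(1) by (simp add: LIMSEQ_imp_Cauchy)
    then obtain N where N: "\<And>m n. m \<ge> N \<Longrightarrow> n \<ge> N \<Longrightarrow> dist (\<tau> m) (\<tau> n) < e / C"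
      using C(2) \<open>0 < e\<close> unfolding Cauchy_def by (metis divide_pos_pos)
    have "riem_dist A g (\<sigma> m) (\<sigma> n) < ennreal e" if "m \<ge> N" "n \<ge> N" for m n
    proof -
      have "C * \<bar>\<tau> n - \<tau> m\<bar> < e" using N[OF that] C(2) by (simp add: dist_real_def field_simps abs_minus_commute)
      then show ?thesis using dist[of m n] \<open>0 < e\<close> by (meson ennreal_lessI le_less_trans)
    qed
    then show ?thesis by blast
  qed
  then obtain l where l: "(\<lambda>n. riem_dist A g (\<sigma> n) l) \<longlonglongrightarrow> 0"
    using complete unfolding complete_manifold_def by blast
  have in_nbhd: "eventually (\<lambda>n. \<sigma> n \<in> W) sequentially" if W: "open W" "l \<in> W" for W
  proof -
    obtain \<epsilon> where \<epsilon>: "0 < \<epsilon>" "\<And>p. riem_dist A g p l < ennreal \<epsilon> \<Longrightarrow> p \<in> W"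
      using riem_dist_small_imp_mem[OF A W] by metis
    have "eventually (\<lambda>n. riem_dist A g (\<sigma> n) l < ennreal \<epsilon>) sequentially"
      using order_tendstoD(2)[OF l] \<epsilon>(1) by simp
    then show ?thesis by eventually_elim (rule \<epsilon>(2))
  qed
  then have "\<sigma> \<longlonglongrightarrow> l" by (intro topological_tendstoI)
  then have "(\<lambda>n. F (\<sigma> n)) \<longlonglongrightarrow> F l"
    using cont_F by (intro continuous_on_tendsto_compose[of UNIV F]) auto
  moreover have "(\<lambda>n. \<gamma> (\<tau> n)) \<longlonglongrightarrow> \<gamma> T"
    by (rule continuous_on_tendsto_compose[OF \<gamma> T(1)]) (use T01 \<tau> in auto)
  ultimately have Fl: "F l = \<gamma> T" unfolding \<tau>(3) by (rule LIMSEQ_unique)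
  obtain \<epsilon> W where \<epsilon>: "0 < \<epsilon>" "open W" "l \<in> W"
    "\<And>s \<tau> t. \<lbrakk>s \<in> W; F s = \<gamma> \<tau>; 0 \<le> \<tau>; \<tau> \<le> t; t \<le> 1; \<bar>\<tau> - T\<bar> < \<epsilon>; \<bar>t - T\<bar> < \<epsilon>\<rbrakk> \<Longrightarrow> \<exists>s'. lifts \<gamma> \<tau> s t s'"
    using lifts_extend[OF \<gamma> _ Fl] T01 by auto
  define t where "t = min 1 (T + \<epsilon> / 2)"
  have t: "T \<le> t" "t \<le> 1" "\<bar>t - T\<bar> < \<epsilon>" using T01 \<epsilon>(1) by (auto simp: t_def)
  have "eventually (\<lambda>n. \<bar>\<tau> n - T\<bar> < \<epsilon>) sequentially"
    using tendstoD[OF T(1) \<epsilon>(1)] by (simp add: dist_real_def)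
  then have "eventually (\<lambda>n. \<tau> n + t \<le> 2 * \<tau> (Suc n)) sequentially"
    using in_nbhd[OF \<epsilon>(2,3)]
  proof eventually_elim
    case (elim n)
    have "\<tau> n \<le> t" using T(2)[of n] t(1) by simp
    then obtain s' where "lifts \<gamma> (\<tau> n) (\<sigma> n) t s'"
      using \<epsilon>(4)[OF elim(2) \<tau>(3,1)] t elim(1) by blast
    then show ?case by (rule greedy[OF t(2)])
  qed
  moreover have "(\<lambda>n. \<tau> n + t) \<longlonglongrightarrow> T + t" "(\<lambda>n. 2 * \<tau> (Suc n)) \<longlonglongrightarrow> 2 * T"
    using T(1) LIMSEQ_Suc[OF T(1)] by (auto intro!: tendsto_intros)
  ultimately have "T + t \<le> 2 * T"
    by (intro tendsto_le[OF sequentially_bot, of "\<lambda>n. 2 * \<tau> (Suc n)" _ "\<lambda>n. \<tau> n + t"])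
  then have "T = 1" using \<epsilon>(1) T01 by (auto simp: t_def min_def split: if_splits)
  then have "coord_inv d (x + w) = F l" using Fl by (simp add: \<gamma>_def)
  then show ?thesis by blast
qed

text \<open>The image is open by local sections. A point in its closure is the end of a coordinate segment that starts in the image.\<close>

lemma surj_of_complete_connected:
  assumes complete: "complete_manifold A g" and conn: "connected (UNIV :: 'p set)"
  shows "range F = UNIV"
proof -
  have "open (range F)"
  proof (subst open_subopen, intro ballI)
    fix q assume "q \<in> range F"
    then obtain p where p: "q = F p" by auto
    obtain W V \<sigma> where W: "p \<in> W" "open V" "F ` W \<subseteq> V" "\<And>q. q \<in> V \<Longrightarrow> F (\<sigma> q) = q"
      using local_section[of p] by metis
    then have "V \<subseteq> range F" by (metis rangeI subsetI)
    then show "\<exists>T. open T \<and> q \<in> T \<and> T \<subseteq> range F" using W p by blast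
  qed
  moreover have "closed (range F)"
  proof -
    have "q \<in> range F" if q: "q \<in> closure (range F)" for q
    proof -
      obtain d where d: "d \<in> B" "q \<in> dom d" "is_chart d" using smooth_atlas_cover[OF atlases(2)] .
      note dd = is_chart_D[OF d(3)]
      obtain r where r: "0 < r" "cball (coord d q) r \<subseteq> coord d ` dom d"
        using dd(2) d(2) open_contains_cball by blast
      obtain m C where C: "0 < C" "\<And>y v. y \<in> cball (coord d q) r \<Longrightarrow> sqrt (chart_metric h d y v v) \<le> C * norm v"
        using metric_on_compact_bounds[OF metric_on_chart_metric[OF metrics(2) d(1,3)] compact_cball r(2)] by metis
      have "open (dom d \<inter> coord d -` ball (coord d q) r)" "q \<in> dom d \<inter> coord d -` ball (coord d q) r"
        using continuous_open_preimage[OF dd(6,1)] d(2) r(1) by auto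
      then obtain s where s: "F s \<in> dom d" "coord d (F s) \<in> ball (coord d q) r"
        using open_Int_closure_eq_empty[of _ "range F"] q by blast
      define x where "x = coord d (F s)"
      define w where "w = coord d q - x"
      have seg: "x + t *\<^sub>R w \<in> cball (coord d q) r" if "t \<in> {0..1}" for t
      proof -
        have "x + t *\<^sub>R w = (1 - t) *\<^sub>R x + t *\<^sub>R coord d q" by (simp add: w_def algebra_simps)
        then show ?thesis
          using convexD_alt[OF convex_cball, of x "coord d q" r "coord d q" t] s(2) r(1) that by (simp add: x_def)
      qed
      have "coord_inv d (x + w) \<in> range F"
      proof (rule segment_end_in_range[OF complete d(1)])
        show "x + t *\<^sub>R w \<in> coord d ` dom d" if "t \<in> {0..1}" for t using seg[OF that] r(2) by blast
        (* the summand 1 makes the bound positive when w = 0 *)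
        show "sqrt (h d (coord_inv d (x + t *\<^sub>R w)) w w) \<le> C * (norm w + 1)" if "t \<in> {0..1}" for t
        proof -
          have "sqrt (h d (coord_inv d (x + t *\<^sub>R w)) w w) \<le> C * norm w"
            using C(2)[OF seg[OF that], of w] by (simp add: chart_metric_def)
          then show ?thesis using C(1) by (simp add: algebra_simps)
        qed
        show "0 < C * (norm w + 1)" using C(1) by (simp add: add_nonneg_pos)
        show "F s = coord_inv d x" using dd(3)[OF s(1)] by (simp add: x_def)
      qed
      then show ?thesis using dd(3)[OF d(2)] by (simp add: w_def)
    qed
    then have "closure (range F) \<subseteq> range F" by (rule subsetI)
    then show ?thesis by (simp only: closure_subset_eq)
  qed
  ultimately have "openin (top_of_set UNIV) (range F)" "closedin (top_of_set UNIV) (range F)" by simp_all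
  then have "range F = {} \<or> range F = UNIV"
    using connected_clopen[of "UNIV :: 'p set", THEN iffD1, OF conn, THEN spec, of "range F"] by blast
  then show ?thesis by simp
qed

end

section \<open>The intersection is a slice\<close>

lemma riemannian_manifold_scale:
  assumes "riemannian_manifold A g" "0 < k"
  shows "riemannian_manifold A (\<lambda>c p v w. k * g c p v w)"
proof -
  have A: "smooth_atlas A" and g: "riemannian_metric A g" using assms(1) by (auto simp: riemannian_manifold_def)
  have "bilinear (\<lambda>v w. k * g c p v w)" if "c \<in> A" "p \<in> dom c" for c p
  proof -
    have "bilinear (g c p)" using g that unfolding riemannian_metric_def by blast
    then show ?thesis
      by (subst bilinear_def) (auto intro!: linearI simp: bilinear_ladd bilinear_radd bilinear_lmul bilinear_rmul algebra_simps)
  qed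
  moreover have "smooth_on (coord c ` dom c) (\<lambda>y. k * g c (coord_inv c y) v w)" if "c \<in> A" for c v w
  proof -
    have "smooth_on (coord c ` dom c) (\<lambda>y. g c (coord_inv c y) v w)"
      using g that unfolding riemannian_metric_def by blast
    then show ?thesis
      by (rule smooth_on_bounded_linear[OF bounded_linear_mult_right is_chart_D(2)[OF smooth_atlas_is_chart[OF A that]]])
  qed
  moreover have "k * g c p v w = k * g c p w v" "v \<noteq> 0 \<Longrightarrow> 0 < k * g c p v v" if "c \<in> A" "p \<in> dom c" for c p v w
  proof -
    have "g c p v w = g c p w v" "v \<noteq> 0 \<Longrightarrow> 0 < g c p v v"
      using g that unfolding riemannian_metric_def by blast+
    then show "k * g c p v w = k * g c p w v" "v \<noteq> 0 \<Longrightarrow> 0 < k * g c p v v" using assms(2) by simp_all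
  qed
  moreover have "k * g c p v w = k * g d p (differential c d (\<lambda>p. p) p v) (differential c d (\<lambda>p. p) p w)"
    if "c \<in> A" "d \<in> A" "p \<in> dom c \<inter> dom d" for c d p v w
  proof -
    have "g c p v w = g d p (differential c d (\<lambda>p. p) p v) (differential c d (\<lambda>p. p) p w)"
      using g that unfolding riemannian_metric_def by blast
    then show ?thesis by simp
  qed
  ultimately have "riemannian_metric A (\<lambda>c p v w. k * g c p v w)"
    unfolding riemannian_metric_def by blast
  then show ?thesis using A by (simp add: riemannian_manifold_def)
qed

context warped_intersection
begin

text \<open>As the height is constant, the differential of \<open>a\<close> has no \<open>\<partial>\<^sub>t\<close>-component, and the warped metric reduces to
\<open>f(t)\<^sup>2 g\<^sub>P\<close> on its image.\<close>

lemma local_isometry_projection: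
  assumes dim: "DIM('l) = DIM('e)" and t: "\<And>s. height a s = t"
  shows "local_isometry AS gS AP (\<lambda>c p v w. (f t)\<^sup>2 * gP c p v w) (snd \<circ> a)"
proof -
  let ?F = "snd \<circ> a"
  have ov: "overlap c d ?F = overlap c (cylinder_chart d) a" for c d
    by (simp add: cylinder_chart_def vimage_def mem_Times_iff)
  have rep: "local_rep c d ?F = (\<lambda>x. snd (local_rep c (cylinder_chart d) a x))" for c d
    by (simp add: local_rep_apply cylinder_chart_def fun_eq_iff)
  have const: "fst (local_rep c (cylinder_chart d) a x) = t" for c d x
    using t by (simp add: local_rep_apply cylinder_chart_def height_def)
  have cyl: "cylinder_chart d \<in> cylinder_atlas AP" if "d \<in> AP" for d
    using that by (simp add: cylinder_atlas_def)
  note ca = smooth_map_D(1)[OF maps(4)]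
  have cont: "continuous_on UNIV ?F"
    using continuous_on_snd[OF ca] by (simp add: o_def)
  have sm: "smooth_map AS AP ?F"
    unfolding smooth_map_def ov rep
    by (intro conjI cont ballI smooth_on_bounded_linear[OF bounded_linear_snd]
        open_overlap[OF charts(3) charts(5)[OF cyl] ca] smooth_map_D(2)[OF maps(4) _ cyl])
  have differential: "differential c (cylinder_chart d) a p v = (0, differential c d ?F p v)"
    if c: "c \<in> AS" "p \<in> dom c" and d: "d \<in> AP" "?F p \<in> dom d" for c d p v
  proof -
    have x: "coord c p \<in> overlap c (cylinder_chart d) a" unfolding ov[symmetric] using c d by auto
    note der = smooth_on_has_derivative[OF smooth_map_D(2)[OF maps(4) c(1) cyl[OF d(1)]] x]
    have "fd (\<lambda>x. fst (local_rep c (cylinder_chart d) a x)) (coord c p) v = fst (differential c (cylinder_chart d) a p v)"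
      using fd_eqI[OF has_derivative_fst[OF der]] by (simp add: differential_def)
    moreover have "differential c d ?F p v = snd (differential c (cylinder_chart d) a p v)"
      using fd_eqI[OF has_derivative_snd[OF der]] by (simp add: differential_def rep)
    ultimately show ?thesis by (simp add: const prod_eq_iff)
  qed
  have iso: "gS c p v w = (f t)\<^sup>2 * gP d (?F p) (differential c d ?F p v) (differential c d ?F p w)"
    if c: "c \<in> AS" "p \<in> dom c" and d: "d \<in> AP" "?F p \<in> dom d" for c d p v w
  proof -
    have "a p \<in> dom (cylinder_chart d)" using d(2) by (cases "a p") (simp add: cylinder_chart_def)
    then have "gS c p v w = gM (cylinder_chart d) (a p) (0, differential c d ?F p v) (0, differential c d ?F p w)"
      using a_isometric[OF c(1) cyl[OF d(1)] c(2)] differential[OF c d] by simp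
    then show ?thesis using t[of p] by (cases "a p") (simp add: warped_metric_def height_def)
  qed
  have "inj (differential c d ?F p)" if c: "c \<in> AS" "p \<in> dom c" and d: "d \<in> AP" "?F p \<in> dom d" for c d p
  proof -
    have "coord c p \<in> overlap c d ?F" using c d by auto
    then have lin: "linear (differential c d ?F p)"
      unfolding differential_def using smooth_on_fd_linear[OF smooth_map_D(2)[OF sm c(1) d(1)]] by blast
    have G: "inner_form (gS c p)"
      using metric_on_D(2)[OF metric_on_chart_metric[OF metrics(4) c(1) charts(3)[OF c(1)]] imageI[OF c(2)]]
      by (simp add: chart_metric_def is_chart_D(3)[OF charts(3)[OF c(1)] c(2)])
    have "bilinear (gP d (?F p))" using metrics(3) d unfolding riemannian_metric_def by blast
    then have "v = 0" if "differential c d ?F p v = 0" for v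
      using iso[OF c d, of v v] that inner_form_eq_0_iff[OF G] by (simp add: bilinear_lzero)
    then show ?thesis using lin by (simp add: linear_injective_0)
  qed
  then have "isometric_immersion AS gS AP (\<lambda>c p v w. (f t)\<^sup>2 * gP c p v w) ?F"
    unfolding isometric_immersion_def immersion_def using sm iso by simp
  then show ?thesis
    using riemannian_manifold_scale[OF P, of "(f t)\<^sup>2"] f(2)[of t] S(1) dim by (simp add: local_isometry_def)
qed

end

theorem theorem2:
  fixes n :: nat
    and AQ :: "('q::{t2_space,second_countable_topology}, 'd::euclidean_space) atlas"
    and gQ :: "('q, 'd) metric"
    and AN :: "('n::{t2_space,second_countable_topology}, 'k::euclidean_space) atlas"
    and gN :: "('n, 'k) metric"
    and AP :: "('p::{t2_space,second_countable_topology}, 'e::euclidean_space) atlas"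
    and gP :: "('p, 'e) metric"
    and AS :: "('s::{t2_space,second_countable_topology}, 'l::euclidean_space) atlas"
    and gS :: "('s, 'l) metric"
    and f :: "real \<Rightarrow> real"
    and \<phi> :: "real \<times> 'p \<Rightarrow> 'q"
    and \<psi> :: "'n \<Rightarrow> 'q"
    and a :: "'s \<Rightarrow> real \<times> 'p"
    and b :: "'s \<Rightarrow> 'n"
  assumes dims: "DIM('d) = n + 1" "DIM('k) = n" "DIM('e) + 1 = n" "DIM('l) + 1 = n"
    and ambient: "riemannian_manifold AQ gQ"
    and N_hypersurface: "riemannian_manifold AN gN" "isometric_immersion AN gN AQ gQ \<psi>"
    and N_totally_geodesic: "totally_geodesic AN gN AQ gQ \<psi>"
    and P: "riemannian_manifold AP gP" "connected (UNIV :: 'p set)"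
    and f: "smooth_on UNIV f" "\<And>t. f t > 0"
    and M_hypersurface: "isometric_immersion (cylinder_atlas AP) (warped_metric f gP) AQ gQ \<phi>"
    and H': "\<And>t. deriv (log_deriv f) t \<ge> 0"
    and normal: "normal_submanifolds (cylinder_atlas AP) AN AS AQ gQ \<phi> \<psi> a b"
    and S_induced: "riemannian_manifold AS gS" "isometric_immersion AS gS AQ gQ (\<phi> \<circ> a)"
    and S_complete: "complete_manifold AS gS"
    and S_parabolic: "parabolic AS gS"
    and S_ricci: "ricci_bounded_below AS gS"
    and S_height: "bounded (range (height a))"
  shows "\<exists>t. range a = slice t \<and>
    totally_geodesic AS gS (cylinder_atlas AP) (warped_metric f gP) a"
proof -
  note connected_P = P(2)
  interpret warped_intersection AQ gQ AN gN AP gP AS gS f \<phi> \<psi> a b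
    by unfold_locales (fact ambient N_hypersurface N_totally_geodesic P f M_hypersurface normal S_induced)+
  obtain t where t: "\<And>s. height a s = t"
    using height_constant[OF H' S_parabolic S_height] by blast
  interpret F: local_isometry AS gS AP "\<lambda>c p v w. (f t)\<^sup>2 * gP c p v w" "snd \<circ> a"
    using local_isometry_projection[OF _ t] dims by simp
  have "range (snd \<circ> a) = UNIV" by (rule F.surj_of_complete_connected[OF S_complete connected_P])
  moreover have "range a = Pair t ` range (snd \<circ> a)"
    unfolding image_image by (rule image_cong) (use t in \<open>simp_all add: height_def prod_eq_iff\<close>)
  ultimately have "range a = slice t" by (auto simp: slice_def)
  then show ?thesis using totally_geodesic_a by blast
qed

end
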